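(* For $k=1,2$, let $g^k\in\mathcal C_L$, let $F^k:\Theta\times\mathbb R\times\mathbb R^d\times\mathbb S^d\to\mathbb R$ satisfy Assumption (F) (written out in the context), and let $\mathrm v^k$ be a $\pi$-approximate viscosity solution of $$-\partial_t \mathrm v(t,\mathrm x)-F^k\big(t,\mathrm x,\mathrm v(t,\mathrm x),\nabla_{\mathrm x}\mathrm v(t,\mathrm x),\nabla^2_{\mathrm x}\mathrm v(t,\mathrm x)\big)=0 \ \text{ on } [0,T)\times\Omega,\qquad \mathrm v(T,\cdot)=g^k \ \text{ on }\Omega.$$ Assume that $F^1\ge F^2$ and $g^1\ge g^2$. Then $\mathrm v^1\ge\mathrm v^2$ on $\Theta$.
   Context: **Paths and grids.** Fix $d\ge1$, $T>0$, $L>0$. $\Omega$ is either $C([0,T])$ (continuous $\mathbb R^d$-valued paths on $[0,T]$) or $D([0,T])$ (càdlàg $\mathbb R^d$-valued paths); the result is claimed in both cases. $\Theta=[0,T]\times\Omega$; $\|\mathrm x\|=\sup_{s\le T}|\mathrm x_s|$; $\mathrm x_{t\wedge}=(\mathrm x_{t\wedge s})_{s\le T}$. $\mathbb S^d$ (resp. $\mathbb M^d$) is the set of symmetric (resp. all) real $d\times d$ matrices. A function of $(t,\mathrm x,\dots)$ is non-anticipative if it depends on $\mathrm x$ only through $\mathrm x_{t\wedge}$. A point $x\in\mathbb R^d$ is identified with the constant path, and $\mathrm x\boxplus_t\mathrm x'=\mathrm x\mathbf 1_{[0,t)}+\mathrm x'\mathbf 1_{[t,T]}$. Fix an increasing sequence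 of discrete time grids $\pi=(\pi^n)_{n\ge1}$, $\pi^n=(t^n_i)_{0\le i\le n}$, $0=t^n_0<\dots<t^n_n=T$, $\pi^n\subset\pi^{n+1}$, $|\pi^n|=\max_i|t^n_{i+1}-t^n_i|\to0$. $[\mathrm x]^n_i=(\mathrm x_{t^n_j})_{0\le j\le i}$; $\eta_n(t)=t^n_i$ for $t\in[t^n_i,t^n_{i+1})$, $\eta_n(T)=T$. **Metrics and projections.** Case $\Omega=C([0,T])$: $\rho_t(\mathrm x,\mathrm x')=\|\mathrm x_{t\wedge}-\mathrm x'_{t\wedge}\|$, and for $t\in(t^n_k,t^n_{k+1}]$, $\Pi^n_t[\mathrm x]$ is the path linearly interpolating the values $\mathrm x_{t^n_0},\dots,\mathrm x_{t^n_k},\mathrm x_t$ at times $t^n_0,\dots,t^n_k,t$, constant equal to $\mathrm x_t$ on $[t,T]$. Case $\Omega=D([0,T])$: $\rho_t(\mathrm x,\mathrm x')=\inf_{\lambda\in\Lambda_t}\big(\|\lambda-I_t\|+\|\mathrm x_{t\wedge}-(\mathrm x'\circ\lambda)_{t\wedge}\|\big)+\int_0^t|\mathrm x_s-\mathrm x'_s|\,\mathfrak m(ds)$, where $\Lambda_t$ is the set of strictly increasing continuous bijections of $[0,t]$, $I_t$ the identity of $[0,t]$ (norms are sup norms on $[0,t]$), and $\mathfrak m$ is a fixed finite positive measure on $[0,T]$ with finitely many atoms, all belonging to some grid $\pi^n$; for $t\in(t^n_k,t^n_{k+1}]$, $\Pi^n_t[\mathrm x]=\sum_{i=0}^{k-1}\mathbf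 1_{[t^n_i,t^n_{i+1})}\mathrm x_{t^n_i}+\mathbf 1_{[t^n_k,t)}\mathrm x_{t^n_k}+\mathbf 1_{[t,T]}\mathrm x_t$. In both cases $\Pi^n_0[\mathrm x]\equiv\mathrm x_0$, $\Pi^n=\Pi^n_T$, $\rho=\rho_T$. Continuity/Lipschitz continuity in the path variable is w.r.t. $\rho$ unless stated otherwise; joint continuity in $(t,\mathrm x)$ of non-anticipative maps is w.r.t. $|t-t'|+\rho(\mathrm x_{t\wedge},\mathrm x'_{t'\wedge})$. $\mathcal C_L$ is the set of $g:\Omega\to\mathbb R$ continuous w.r.t. $\|\cdot\|$ with $|g(\mathrm x)|\le L(1+\|\mathrm x\|)$. **Assumption (F)** on $F:[0,T]\times\Omega\times\mathbb R\times\mathbb R^d\times\mathbb S^d\to\mathbb R$: (i) $F$ is non-anticipative, continuous in time; for all $K>0$ there is $C_K>0$ such that $(y,z,\gamma)\mapsto F(t,\mathrm x,y,z,\gamma)$ is $C_K$-Lipschitz whenever $\|\mathrm x\|\le K$; and $|F(t,\mathrm x,0,0,0)|\le L(1+\|\mathrm x\|)$. (ii) For all $K>0$ there is a continuous $\varpi_K:\mathbb R_+\to\mathbb R_+$ with $\varpi_K(0)=0$ and $F(t,\mathrm x,y,\alpha(z-z'),\Gamma_1)-F(t,\mathrm x,y,\alpha(z-z'),\Gamma_2)\le\varpi_K(\alpha|z-z'|^2+|z-z'|)$ for all $(t,\mathrm x,y,z,z')\in\Theta\times\mathbb R\times\mathbb R^d\times\mathbb R^d$, $\Gamma_1,\Gamma_2\in\mathbb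 S^d$, $\alpha>0$ with $\|\mathrm x\|\le K$ and $-3\alpha\begin{pmatrix}I_d&0\\0&I_d\end{pmatrix}\le\begin{pmatrix}\Gamma_1&0\\0&-\Gamma_2\end{pmatrix}\le3\alpha\begin{pmatrix}I_d&-I_d\\-I_d&I_d\end{pmatrix}$. (iii) $\gamma\mapsto F(\cdot,\gamma)$ is non-decreasing for the natural partial order of $\mathbb S^d$. (iv) There are a compact $A_0\subset\mathbb R^{d'}$, $d'\ge1$, non-anticipative continuous maps $\underline\sigma,\overline\sigma:\Theta\times A_0\to\mathbb M^d$, $L$-Lipschitz in $\mathrm x$ uniformly in $(t,a)$, and non-anticipative continuous maps $\underline F,\overline F:\Theta\times\mathbb R\times\mathbb R^d\to\mathbb R$, $L$-Lipschitz in $(\mathrm x,y,z)$, such that for all $\gamma\in\mathbb S^d$: $\underline F+\inf_{a\in A_0}\frac12\mathrm{Tr}[\underline\sigma\underline\sigma^\top(\cdot,a)\gamma]\le F(\cdot,\gamma)\le\overline F+\sup_{a\in A_0}\frac12\mathrm{Tr}[\overline\sigma\overline\sigma^\top(\cdot,a)\gamma]$. **$\pi^n$-viscosity solutions (for a generator $F$).** For $L'>0$, $\mathcal{LSC}^n_{L'}$ (resp. $\mathcal{USC}^n_{L'}$) is the set of non-anticipative $u:\Theta\times\mathbb R^d\to\mathbb R$ with $|u(t,\mathrm x,x)|\le L'(1+\|\mathrm x\|+|x|)$, $u(t,\mathrm x,x)=u(t,\Pi^n_{\eta_n(t)}[\mathrm x],x)$, and $(t,x)\mapsto u(t,\mathrm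 x,x)$ lower (resp. upper) semicontinuous on each $[t^n_i,t^n_{i+1})\times\mathbb R^d$; $\mathcal C^n_{L'}=\mathcal{LSC}^n_{L'}\cap\mathcal{USC}^n_{L'}$. Such $u$ depends on $\mathrm x$, for $t\in[t^n_i,t^n_{i+1})$, only through $[\mathrm x]^n_i$, and at $t=T$ only through $[\mathrm x]^n_n$; this gives meaning to its values at paths of the form $\mathrm x\boxplus_t x$ even if $\Omega=C([0,T])$. At $t=T$ only values with $x=\mathrm x_T$ are considered. Set $F^n(t,\mathrm x,y,z,\gamma)=F(t,\Pi^n_{\eta_n(t)}[\mathrm x],y,z,\gamma)$. A function $u\in\mathcal{LSC}^n_{L'}$ (resp. $\mathcal{USC}^n_{L'}$) is a $\pi^n$-viscosity supersolution (resp. subsolution) if, for all $\mathrm x\in\Omega$ and $0\le i\le n-1$, $(t,x)\mapsto u(t,\mathrm x,x)$ is a viscosity supersolution (resp. subsolution) of $-\partial_t\varphi-F^n(t,\mathrm x,\varphi,D\varphi,D^2\varphi)=0$ on $[t^n_i,t^n_{i+1})\times\mathbb R^d$ (extrema relative to this set), and, with $\delta=1$ (resp. $\delta=-1$), $\liminf_{t\nearrow t^n_{i+1},x'\to x}\delta\big(u(t,\mathrm x,x')-u(t^n_{i+1},\Pi^n[\mathrm x]\boxplus_{t^n_{i+1}}x,x)\big)\ge0$ for all $x\in\mathbb R^d$. A $\pi^n$-viscosity solution is both. Under Assumption (F), for $g\in\mathcal C_L$ there is a unique $\pi^n$-viscosity solution $v^n\in\cup_{L'>0}\mathcal C^n_{L'}$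 with $v^n(T,\mathrm x,\mathrm x_T)=g(\Pi^n[\mathrm x])$ for all $\mathrm x\in\Omega$. **$\pi$-approximate viscosity solution.** $\mathrm v:\Theta\to\mathbb R$ is a $\pi$-approximate viscosity solution of the equation with generator $F$ and terminal condition $g$ if $(v^n)_{n\ge1}$ admits a pointwise limit and $\mathrm v(t,\mathrm x)=\lim_{n\to\infty}v^n(t,\mathrm x,\mathrm x_t)$ for all $(t,\mathrm x)\in\Theta$. *)

theory Defs
  imports "HOL-Analysis.Analysis"
begin

section \<open>Paths\<close>

text \<open>
  A path on \<open>[0,T]\<close> is represented by a function on the whole real line whose values outside
  \<open>[0,T]\<close> are irrelevant: sup norms, metrics and non-anticipativity below only look at \<open>[0,T]\<close>,
  so that every functional considered here is insensitive to the choice of the extension.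
\<close>

type_synonym 'd path = "real \<Rightarrow> real ^ 'd"

type_synonym 'd generator =
  "real \<Rightarrow> 'd path \<Rightarrow> real \<Rightarrow> real ^ 'd \<Rightarrow> real ^ 'd ^ 'd \<Rightarrow> real"

text \<open>
  The two choices of the path space.  The measure entering the metric of the cadlag case is
  part of that choice.
\<close>

datatype path_space = Continuous_Paths | Cadlag_Paths "real measure"

definition cadlag_on :: "real \<Rightarrow> (real \<Rightarrow> 'a::topological_space) \<Rightarrow> bool" where
  "cadlag_on T x \<longleftrightarrow>
     (\<forall>t\<in>{0..<T}. (x \<longlongrightarrow> x t) (at_right t)) \<and> (\<forall>t\<in>{0<..T}. \<exists>l. (x \<longlongrightarrow> l) (at_left t))"

definition Omega :: "real \<Rightarrow> path_space \<Rightarrow> ('d::finite) path set" where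
  "Omega T S = (case S of
      Continuous_Paths \<Rightarrow> {x. continuous_on {0..T} x}
    | Cadlag_Paths m \<Rightarrow> {x. cadlag_on T x})"

definition sup_norm :: "real \<Rightarrow> (real \<Rightarrow> 'a::real_normed_vector) \<Rightarrow> real" where
  "sup_norm t x = (SUP s\<in>{0..t}. norm (x s))"

definition stop :: "real \<Rightarrow> (real \<Rightarrow> 'a) \<Rightarrow> real \<Rightarrow> 'a" where
  "stop t x = (\<lambda>s. x (min t s))"

definition path_concat :: "real \<Rightarrow> (real \<Rightarrow> 'a) \<Rightarrow> (real \<Rightarrow> 'a) \<Rightarrow> real \<Rightarrow> 'a" where
  "path_concat t x x' = (\<lambda>s. if s < t then x s else x' s)"

text \<open>
  Two paths satisfy \<open>stop t x = stop t x'\<close> as functions on \<open>[0,T]\<close> iff they agree on \<open>[0,t]\<close>.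
\<close>

definition non_anticipative ::
  "real \<Rightarrow> path_space \<Rightarrow> (real \<Rightarrow> ('d::finite) path \<Rightarrow> 'b) \<Rightarrow> bool" where
  "non_anticipative T S f \<longleftrightarrow>
     (\<forall>t\<in>{0..T}. \<forall>x\<in>Omega T S. \<forall>x'\<in>Omega T S.
        (\<forall>s\<in>{0..t}. x s = x' s) \<longrightarrow> f t x = f t x')"

section \<open>Metrics on the path space\<close>

definition time_changes :: "real \<Rightarrow> (real \<Rightarrow> real) set" where
  "time_changes t =
     {l. strict_mono_on {0..t} l \<and> continuous_on {0..t} l \<and> bij_betw l {0..t} {0..t}}"

definition rho :: "path_space \<Rightarrow> real \<Rightarrow> ('d::finite) path \<Rightarrow> 'd path \<Rightarrow> real" where
  "rho S t x x' = (case S of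
      Continuous_Paths \<Rightarrow> sup_norm t (\<lambda>s. x s - x' s)
    | Cadlag_Paths m \<Rightarrow>
        (INF l\<in>time_changes t. sup_norm t (\<lambda>s. l s - s) + sup_norm t (\<lambda>s. x s - x' (l s)))
        + (LINT s:{0..t}|m. norm (x s - x' s)))"

definition jointly_continuous ::
  "real \<Rightarrow> path_space \<Rightarrow> 'a::metric_space set
   \<Rightarrow> (real \<Rightarrow> ('d::finite) path \<Rightarrow> 'a \<Rightarrow> 'b::metric_space) \<Rightarrow> bool" where
  "jointly_continuous T S A f \<longleftrightarrow>
     (\<forall>t\<in>{0..T}. \<forall>x\<in>Omega T S. \<forall>a\<in>A. \<forall>e>0. \<exists>d>0.
        \<forall>t'\<in>{0..T}. \<forall>x'\<in>Omega T S. \<forall>a'\<in>A.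
          \<bar>t - t'\<bar> + rho S T (stop t x) (stop t' x') < d \<and> dist a a' < d
          \<longrightarrow> dist (f t x a) (f t' x' a') < e)"

definition C_L :: "real \<Rightarrow> path_space \<Rightarrow> real \<Rightarrow> (('d::finite) path \<Rightarrow> real) set" where
  "C_L T S L = {g.
     (\<forall>x\<in>Omega T S. \<forall>e>0. \<exists>d>0. \<forall>x'\<in>Omega T S.
        sup_norm T (\<lambda>s. x s - x' s) < d \<longrightarrow> \<bar>g x - g x'\<bar> < e) \<and>
     (\<forall>x\<in>Omega T S. \<bar>g x\<bar> \<le> L * (1 + sup_norm T x))}"

section \<open>Time grids and projections\<close>

text \<open>\<open>\<pi> n i\<close> is the \<open>i\<close>-th point of the \<open>n\<close>-th grid; it is only meaningful for \<open>1 \<le> n\<close>, \<open>i \<le> n\<close>.\<close>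

type_synonym grids = "nat \<Rightarrow> nat \<Rightarrow> real"

definition grid_sequence :: "real \<Rightarrow> grids \<Rightarrow> bool" where
  "grid_sequence T \<pi> \<longleftrightarrow>
     (\<forall>n\<ge>1. \<pi> n 0 = 0 \<and> \<pi> n n = T \<and> strict_mono_on {0..n} (\<pi> n)) \<and>
     (\<forall>n\<ge>1. \<pi> n ` {0..n} \<subseteq> \<pi> (Suc n) ` {0..Suc n}) \<and>
     (\<lambda>n. Max ((\<lambda>i. \<bar>\<pi> n (Suc i) - \<pi> n i\<bar>) ` {..<n})) \<longlonglongrightarrow> 0"

definition admissible_space :: "real \<Rightarrow> grids \<Rightarrow> path_space \<Rightarrow> bool" where
  "admissible_space T \<pi> S = (case S of
      Continuous_Paths \<Rightarrow> True
    | Cadlag_Paths m \<Rightarrow>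
        sets m = sets (restrict_space borel {0..T}) \<and> finite_measure m \<and>
        finite {s\<in>{0..T}. measure m {s} > 0} \<and>
        {s\<in>{0..T}. measure m {s} > 0} \<subseteq> (\<Union>n\<in>{1..}. \<pi> n ` {0..n}))"

text \<open>
  Last grid point \<open>\<le> t\<close> (so \<open>eta \<pi> n T = T\<close>) and first grid point \<open>> t\<close> (used for \<open>0 \<le> t < T\<close>).
\<close>

definition eta :: "grids \<Rightarrow> nat \<Rightarrow> real \<Rightarrow> real" where
  "eta \<pi> n t = Max {s \<in> \<pi> n ` {0..n}. s \<le> t}"

definition next_point :: "grids \<Rightarrow> nat \<Rightarrow> real \<Rightarrow> real" where
  "next_point \<pi> n t = Min {s \<in> \<pi> n ` {0..n}. t < s}"

text \<open>
  The projection \<open>\<Pi>\<^sup>n\<^sub>t[x]\<close>.  In the continuous case, for \<open>t \<in> (t\<^sub>k, t\<^sub>k\<^sub>+\<^sub>1]\<close> and \<open>s < t\<close>, the numbers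
  \<open>a\<close> and \<open>b\<close> are the neighbours of \<open>s\<close> in \<open>t\<^sub>0 < \<dots> < t\<^sub>k < t\<close>, and the path is interpolated
  linearly between them.  The path is constant equal to \<open>x t\<close> from \<open>t\<close> on, in particular
  it is constant equal to \<open>x 0\<close> for \<open>t = 0\<close>.
\<close>

definition Proj ::
  "path_space \<Rightarrow> grids \<Rightarrow> nat \<Rightarrow> real \<Rightarrow> ('d::finite) path \<Rightarrow> 'd path" where
  "Proj S \<pi> n t x = (\<lambda>s.
     if t \<le> s then x t
     else (case S of
        Continuous_Paths \<Rightarrow>
          (let a = eta \<pi> n s; b = min t (next_point \<pi> n s)
           in x a + ((s - a) / (b - a)) *\<^sub>R (x b - x a))
      | Cadlag_Paths m \<Rightarrow> x (eta \<pi> n s)))"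

section \<open>The assumption on the generator\<close>

definition symmetric_mat :: "real ^ 'd ^ 'd \<Rightarrow> bool" where
  "symmetric_mat A \<longleftrightarrow> transpose A = A"

definition mat_le :: "real ^ 'd ^ 'd \<Rightarrow> real ^ 'd ^ 'd \<Rightarrow> bool" where
  "mat_le A B \<longleftrightarrow> (\<forall>v. v \<bullet> (A *v v) \<le> v \<bullet> (B *v v))"

definition block_mat ::
  "real ^ 'd ^ 'd \<Rightarrow> real ^ 'd ^ 'd \<Rightarrow> real ^ 'd ^ 'd \<Rightarrow> real ^ 'd ^ 'd
   \<Rightarrow> real ^ ('d + 'd) ^ ('d + 'd)" where
  "block_mat A B C D = (\<chi> i j. case i of
      Inl p \<Rightarrow> (case j of Inl q \<Rightarrow> A $ p $ q | Inr q \<Rightarrow> B $ p $ q)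
    | Inr p \<Rightarrow> (case j of Inl q \<Rightarrow> C $ p $ q | Inr q \<Rightarrow> D $ p $ q))"

definition F_regular :: "real \<Rightarrow> path_space \<Rightarrow> real \<Rightarrow> ('d::finite) generator \<Rightarrow> bool" where
  "F_regular T S L F \<longleftrightarrow>
     (\<forall>y z \<gamma>. symmetric_mat \<gamma> \<longrightarrow> non_anticipative T S (\<lambda>t x. F t x y z \<gamma>)) \<and>
     (\<forall>x\<in>Omega T S. \<forall>y z \<gamma>. symmetric_mat \<gamma> \<longrightarrow> continuous_on {0..T} (\<lambda>t. F t x y z \<gamma>)) \<and>
     (\<forall>K>0. \<exists>C>0. \<forall>t\<in>{0..T}. \<forall>x\<in>Omega T S. sup_norm T x \<le> K \<longrightarrow>
        (\<forall>y z \<gamma> y' z' \<gamma>'. symmetric_mat \<gamma> \<longrightarrow> symmetric_mat \<gamma>' \<longrightarrow>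
           \<bar>F t x y z \<gamma> - F t x y' z' \<gamma>'\<bar> \<le> C * (\<bar>y - y'\<bar> + norm (z - z') + norm (\<gamma> - \<gamma>')))) \<and>
     (\<forall>t\<in>{0..T}. \<forall>x\<in>Omega T S. \<bar>F t x 0 0 0\<bar> \<le> L * (1 + sup_norm T x))"

definition F_structure :: "real \<Rightarrow> path_space \<Rightarrow> ('d::finite) generator \<Rightarrow> bool" where
  "F_structure T S F \<longleftrightarrow>
     (\<forall>K>0. \<exists>w :: real \<Rightarrow> real.
        continuous_on {0..} w \<and> (\<forall>r\<ge>0. 0 \<le> w r) \<and> w 0 = 0 \<and>
        (\<forall>t\<in>{0..T}. \<forall>x\<in>Omega T S. \<forall>y z z' \<Gamma>1 \<Gamma>2 \<alpha>.
           symmetric_mat \<Gamma>1 \<longrightarrow> symmetric_mat \<Gamma>2 \<longrightarrow> \<alpha> > 0 \<longrightarrow> sup_norm T x \<le> K \<longrightarrow>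
           mat_le ((- 3 * \<alpha>) *\<^sub>R block_mat (mat 1) 0 0 (mat 1)) (block_mat \<Gamma>1 0 0 (- \<Gamma>2)) \<longrightarrow>
           mat_le (block_mat \<Gamma>1 0 0 (- \<Gamma>2))
                  ((3 * \<alpha>) *\<^sub>R block_mat (mat 1) (- mat 1) (- mat 1) (mat 1)) \<longrightarrow>
           F t x y (\<alpha> *\<^sub>R (z - z')) \<Gamma>1 - F t x y (\<alpha> *\<^sub>R (z - z')) \<Gamma>2
             \<le> w (\<alpha> * (norm (z - z'))\<^sup>2 + norm (z - z'))))"

definition F_monotone :: "real \<Rightarrow> path_space \<Rightarrow> ('d::finite) generator \<Rightarrow> bool" where
  "F_monotone T S F \<longleftrightarrow>
     (\<forall>t\<in>{0..T}. \<forall>x\<in>Omega T S. \<forall>y z \<gamma> \<gamma>'.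
        symmetric_mat \<gamma> \<longrightarrow> symmetric_mat \<gamma>' \<longrightarrow> mat_le \<gamma> \<gamma>' \<longrightarrow> F t x y z \<gamma> \<le> F t x y z \<gamma>')"

definition sigma_coefficient ::
  "real \<Rightarrow> path_space \<Rightarrow> real \<Rightarrow> (real ^ 'e) set
   \<Rightarrow> (real \<Rightarrow> ('d::finite) path \<Rightarrow> real ^ 'e \<Rightarrow> real ^ 'd ^ 'd) \<Rightarrow> bool" where
  "sigma_coefficient T S L A \<sigma> \<longleftrightarrow>
     (\<forall>a\<in>A. non_anticipative T S (\<lambda>t x. \<sigma> t x a)) \<and>
     jointly_continuous T S A \<sigma> \<and>
     (\<forall>t\<in>{0..T}. \<forall>a\<in>A. \<forall>x\<in>Omega T S. \<forall>x'\<in>Omega T S.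
        norm (\<sigma> t x a - \<sigma> t x' a) \<le> L * rho S T x x')"

definition bound_coefficient ::
  "real \<Rightarrow> path_space \<Rightarrow> real
   \<Rightarrow> (real \<Rightarrow> ('d::finite) path \<Rightarrow> real \<Rightarrow> real ^ 'd \<Rightarrow> real) \<Rightarrow> bool" where
  "bound_coefficient T S L G \<longleftrightarrow>
     (\<forall>y z. non_anticipative T S (\<lambda>t x. G t x y z)) \<and>
     jointly_continuous T S UNIV (\<lambda>t x (y, z). G t x y z) \<and>
     (\<forall>t\<in>{0..T}. \<forall>x\<in>Omega T S. \<forall>x'\<in>Omega T S. \<forall>y y' z z'.
        \<bar>G t x y z - G t x' y' z'\<bar> \<le> L * (rho S T x x' + \<bar>y - y'\<bar> + norm (z - z')))"

text \<open>
  The control set lives in \<open>real ^ 'e\<close>; its dimension, which is existentially quantified in the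
  mathematical statement, is the type argument.
\<close>

definition F_bounds ::
  "'e::finite itself \<Rightarrow> real \<Rightarrow> path_space \<Rightarrow> real \<Rightarrow> ('d::finite) generator \<Rightarrow> bool" where
  "F_bounds (TY :: 'e itself) T S L F \<longleftrightarrow>
     (\<exists>(A :: (real ^ 'e) set) \<sigma>l \<sigma>u Fl Fu.
        compact A \<and> A \<noteq> {} \<and>
        sigma_coefficient T S L A \<sigma>l \<and> sigma_coefficient T S L A \<sigma>u \<and>
        bound_coefficient T S L Fl \<and> bound_coefficient T S L Fu \<and>
        (\<forall>t\<in>{0..T}. \<forall>x\<in>Omega T S. \<forall>y z \<gamma>. symmetric_mat \<gamma> \<longrightarrow>
           Fl t x y z + (INF a\<in>A. 1/2 * trace (\<sigma>l t x a ** transpose (\<sigma>l t x a) ** \<gamma>))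
             \<le> F t x y z \<gamma> \<and>
           F t x y z \<gamma>
             \<le> Fu t x y z + (SUP a\<in>A. 1/2 * trace (\<sigma>u t x a ** transpose (\<sigma>u t x a) ** \<gamma>))))"

definition assumption_F ::
  "'e::finite itself \<Rightarrow> real \<Rightarrow> path_space \<Rightarrow> real \<Rightarrow> ('d::finite) generator \<Rightarrow> bool" where
  "assumption_F TY T S L F \<longleftrightarrow>
     F_regular T S L F \<and> F_structure T S F \<and> F_monotone T S F \<and> F_bounds TY T S L F"

section \<open>Viscosity solutions on the grid\<close>

definition lsc_on :: "'a::topological_space set \<Rightarrow> ('a \<Rightarrow> real) \<Rightarrow> bool" where
  "lsc_on A f \<longleftrightarrow> (\<forall>p\<in>A. \<forall>c<f p. \<forall>\<^sub>F q in at p within A. c < f q)"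

definition usc_on :: "'a::topological_space set \<Rightarrow> ('a \<Rightarrow> real) \<Rightarrow> bool" where
  "usc_on A f \<longleftrightarrow> (\<forall>p\<in>A. \<forall>c>f p. \<forall>\<^sub>F q in at p within A. f q < c)"

definition slab :: "grids \<Rightarrow> nat \<Rightarrow> nat \<Rightarrow> (real \<times> (real ^ 'd)) set" where
  "slab \<pi> n i = {\<pi> n i..<\<pi> n (Suc i)} \<times> UNIV"

text \<open>
  At \<open>t = T\<close> only the values \<open>u T x (x T)\<close> matter, and conditions are imposed on these only.
\<close>

definition relevant :: "real \<Rightarrow> real \<Rightarrow> ('d::finite) path \<Rightarrow> real ^ 'd \<Rightarrow> bool" where
  "relevant T t x y \<longleftrightarrow> t < T \<or> y = x T"

definition grid_functions ::
  "real \<Rightarrow> path_space \<Rightarrow> grids \<Rightarrow> nat \<Rightarrow> real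
   \<Rightarrow> (real \<Rightarrow> ('d::finite) path \<Rightarrow> real ^ 'd \<Rightarrow> real) set" where
  "grid_functions T S \<pi> n L' = {u.
     (\<forall>t\<in>{0..T}. \<forall>x\<in>Omega T S. \<forall>x'\<in>Omega T S. \<forall>y.
        relevant T t x y \<longrightarrow> (\<forall>s\<in>{0..t}. x s = x' s) \<longrightarrow> u t x y = u t x' y) \<and>
     (\<forall>t\<in>{0..T}. \<forall>x\<in>Omega T S. \<forall>y. relevant T t x y \<longrightarrow>
        \<bar>u t x y\<bar> \<le> L' * (1 + sup_norm T x + norm y)) \<and>
     (\<forall>t\<in>{0..T}. \<forall>x\<in>Omega T S. \<forall>y. relevant T t x y \<longrightarrow>
        u t x y = u t (Proj S \<pi> n (eta \<pi> n t) x) y)}"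

definition LSC_n ::
  "real \<Rightarrow> path_space \<Rightarrow> grids \<Rightarrow> nat \<Rightarrow> real
   \<Rightarrow> (real \<Rightarrow> ('d::finite) path \<Rightarrow> real ^ 'd \<Rightarrow> real) set" where
  "LSC_n T S \<pi> n L' = {u \<in> grid_functions T S \<pi> n L'.
     \<forall>x\<in>Omega T S. \<forall>i<n. lsc_on (slab \<pi> n i) (\<lambda>(t, y). u t x y)}"

definition USC_n ::
  "real \<Rightarrow> path_space \<Rightarrow> grids \<Rightarrow> nat \<Rightarrow> real
   \<Rightarrow> (real \<Rightarrow> ('d::finite) path \<Rightarrow> real ^ 'd \<Rightarrow> real) set" where
  "USC_n T S \<pi> n L' = {u \<in> grid_functions T S \<pi> n L'.
     \<forall>x\<in>Omega T S. \<forall>i<n. usc_on (slab \<pi> n i) (\<lambda>(t, y). u t x y)}"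

definition C_n ::
  "real \<Rightarrow> path_space \<Rightarrow> grids \<Rightarrow> nat \<Rightarrow> real
   \<Rightarrow> (real \<Rightarrow> ('d::finite) path \<Rightarrow> real ^ 'd \<Rightarrow> real) set" where
  "C_n T S \<pi> n L' = LSC_n T S \<pi> n L' \<inter> USC_n T S \<pi> n L'"

text \<open>
  The value of \<open>u\<close> at a grid time \<open>t\<close> and an arbitrary function \<open>z\<close>, which need not belong to
  \<open>Omega\<close>: the projection only uses the values of \<open>z\<close> at the grid points up to \<open>t\<close> and always
  lies in \<open>Omega\<close>.  For \<open>z\<close> in \<open>Omega\<close> this is \<open>u t z y\<close>, by the third clause of
  \<open>grid_functions\<close>.
\<close>

definition grid_value ::
  "path_space \<Rightarrow> grids \<Rightarrow> nat \<Rightarrow> (real \<Rightarrow> ('d::finite) path \<Rightarrow> real ^ 'd \<Rightarrow> real)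
   \<Rightarrow> real \<Rightarrow> 'd path \<Rightarrow> real ^ 'd \<Rightarrow> real" where
  "grid_value S \<pi> n u t z y = u t (Proj S \<pi> n (eta \<pi> n t) z) y"

definition F_n :: "path_space \<Rightarrow> grids \<Rightarrow> nat \<Rightarrow> ('d::finite) generator \<Rightarrow> 'd generator" where
  "F_n S \<pi> n F t x y z \<gamma> = F t (Proj S \<pi> n (eta \<pi> n t) x) y z \<gamma>"

text \<open>
  \<open>\<phi>\<close> is of class \<open>C\<^sup>1\<^sup>,\<^sup>2\<close> on \<open>[a,b) \<times> \<real>\<^sup>d\<close> with time derivative \<open>\<phi>t\<close>, gradient \<open>\<phi>x\<close> and
  Hessian \<open>\<phi>xx\<close>; the time derivative is one-sided at \<open>a\<close>.
\<close>

definition C12_on ::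
  "real \<Rightarrow> real \<Rightarrow> (real \<Rightarrow> real ^ 'd \<Rightarrow> real) \<Rightarrow> (real \<Rightarrow> real ^ 'd \<Rightarrow> real)
   \<Rightarrow> (real \<Rightarrow> real ^ 'd \<Rightarrow> real ^ 'd) \<Rightarrow> (real \<Rightarrow> real ^ 'd \<Rightarrow> real ^ 'd ^ 'd) \<Rightarrow> bool" where
  "C12_on a b \<phi> \<phi>t \<phi>x \<phi>xx \<longleftrightarrow>
     (\<forall>t\<in>{a..<b}. \<forall>y.
        ((\<lambda>s. \<phi> s y) has_real_derivative \<phi>t t y) (at t within {a..<b}) \<and>
        ((\<lambda>y'. \<phi> t y') has_derivative (\<lambda>h. \<phi>x t y \<bullet> h)) (at y) \<and>
        ((\<lambda>y'. \<phi>x t y') has_derivative (\<lambda>h. \<phi>xx t y *v h)) (at y)) \<and>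
     continuous_on ({a..<b} \<times> UNIV) (\<lambda>(t, y). \<phi> t y) \<and>
     continuous_on ({a..<b} \<times> UNIV) (\<lambda>(t, y). \<phi>t t y) \<and>
     continuous_on ({a..<b} \<times> UNIV) (\<lambda>(t, y). \<phi>x t y) \<and>
     continuous_on ({a..<b} \<times> UNIV) (\<lambda>(t, y). \<phi>xx t y)"

text \<open>
  Viscosity super- and subsolutions of \<open>- \<partial>\<^sub>t\<phi> - G(t, \<phi>, D\<phi>, D\<^sup>2\<phi>) = 0\<close> on \<open>[a,b) \<times> \<real>\<^sup>d\<close>: test
  functions touch at local extrema relative to this set, normalised to extremal value \<open>0\<close>.
\<close>

definition viscosity_supersolution ::
  "real \<Rightarrow> real \<Rightarrow> (real \<Rightarrow> real \<Rightarrow> real ^ 'd \<Rightarrow> real ^ 'd ^ 'd \<Rightarrow> real)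
   \<Rightarrow> (real \<Rightarrow> real ^ 'd \<Rightarrow> real) \<Rightarrow> bool" where
  "viscosity_supersolution a b G w \<longleftrightarrow>
     (\<forall>\<phi> \<phi>t \<phi>x \<phi>xx. C12_on a b \<phi> \<phi>t \<phi>x \<phi>xx \<longrightarrow>
        (\<forall>t\<in>{a..<b}. \<forall>y. w t y = \<phi> t y \<longrightarrow>
           (\<forall>\<^sub>F (s, y') in at (t, y) within {a..<b} \<times> UNIV. w s y' - \<phi> s y' \<ge> 0) \<longrightarrow>
           - \<phi>t t y - G t (\<phi> t y) (\<phi>x t y) (\<phi>xx t y) \<ge> 0))"

definition viscosity_subsolution ::
  "real \<Rightarrow> real \<Rightarrow> (real \<Rightarrow> real \<Rightarrow> real ^ 'd \<Rightarrow> real ^ 'd ^ 'd \<Rightarrow> real)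
   \<Rightarrow> (real \<Rightarrow> real ^ 'd \<Rightarrow> real) \<Rightarrow> bool" where
  "viscosity_subsolution a b G w \<longleftrightarrow>
     (\<forall>\<phi> \<phi>t \<phi>x \<phi>xx. C12_on a b \<phi> \<phi>t \<phi>x \<phi>xx \<longrightarrow>
        (\<forall>t\<in>{a..<b}. \<forall>y. w t y = \<phi> t y \<longrightarrow>
           (\<forall>\<^sub>F (s, y') in at (t, y) within {a..<b} \<times> UNIV. w s y' - \<phi> s y' \<le> 0) \<longrightarrow>
           - \<phi>t t y - G t (\<phi> t y) (\<phi>x t y) (\<phi>xx t y) \<le> 0))"

definition jump_condition ::
  "real \<Rightarrow> path_space \<Rightarrow> grids \<Rightarrow> nat \<Rightarrow> real
   \<Rightarrow> (real \<Rightarrow> ('d::finite) path \<Rightarrow> real ^ 'd \<Rightarrow> real) \<Rightarrow> bool" where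
  "jump_condition T S \<pi> n \<delta> u \<longleftrightarrow>
     (\<forall>x\<in>Omega T S. \<forall>i<n. \<forall>y.
        Liminf (at_left (\<pi> n (Suc i)) \<times>\<^sub>F nhds y)
          (\<lambda>(t, y'). ereal (\<delta> * (u t x y'
             - grid_value S \<pi> n u (\<pi> n (Suc i))
                 (path_concat (\<pi> n (Suc i)) (Proj S \<pi> n T x) (\<lambda>_. y)) y))) \<ge> 0)"

definition pi_supersolution ::
  "real \<Rightarrow> path_space \<Rightarrow> grids \<Rightarrow> nat \<Rightarrow> ('d::finite) generator
   \<Rightarrow> (real \<Rightarrow> 'd path \<Rightarrow> real ^ 'd \<Rightarrow> real) \<Rightarrow> bool" where
  "pi_supersolution T S \<pi> n F u \<longleftrightarrow>
     (\<exists>L'>0. u \<in> LSC_n T S \<pi> n L') \<and>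
     (\<forall>x\<in>Omega T S. \<forall>i<n.
        viscosity_supersolution (\<pi> n i) (\<pi> n (Suc i)) (\<lambda>t. F_n S \<pi> n F t x) (\<lambda>t. u t x)) \<and>
     jump_condition T S \<pi> n 1 u"

definition pi_subsolution ::
  "real \<Rightarrow> path_space \<Rightarrow> grids \<Rightarrow> nat \<Rightarrow> ('d::finite) generator
   \<Rightarrow> (real \<Rightarrow> 'd path \<Rightarrow> real ^ 'd \<Rightarrow> real) \<Rightarrow> bool" where
  "pi_subsolution T S \<pi> n F u \<longleftrightarrow>
     (\<exists>L'>0. u \<in> USC_n T S \<pi> n L') \<and>
     (\<forall>x\<in>Omega T S. \<forall>i<n.
        viscosity_subsolution (\<pi> n i) (\<pi> n (Suc i)) (\<lambda>t. F_n S \<pi> n F t x) (\<lambda>t. u t x)) \<and>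
     jump_condition T S \<pi> n (- 1) u"

definition pi_solution ::
  "real \<Rightarrow> path_space \<Rightarrow> grids \<Rightarrow> nat \<Rightarrow> ('d::finite) generator
   \<Rightarrow> (real \<Rightarrow> 'd path \<Rightarrow> real ^ 'd \<Rightarrow> real) \<Rightarrow> bool" where
  "pi_solution T S \<pi> n F u \<longleftrightarrow> pi_supersolution T S \<pi> n F u \<and> pi_subsolution T S \<pi> n F u"

text \<open>
  The solution \<open>vn n\<close> on the \<open>n\<close>-th grid is unique (up to its irrelevant values), so that
  quantifying existentially over the sequence refers to the same object.
\<close>

definition pi_approximate_viscosity_solution ::
  "real \<Rightarrow> path_space \<Rightarrow> grids \<Rightarrow> ('d::finite) generator \<Rightarrow> ('d path \<Rightarrow> real)
   \<Rightarrow> (real \<Rightarrow> 'd path \<Rightarrow> real) \<Rightarrow> bool" where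
  "pi_approximate_viscosity_solution T S \<pi> F g v \<longleftrightarrow>
     (\<exists>vn :: nat \<Rightarrow> real \<Rightarrow> 'd path \<Rightarrow> real ^ 'd \<Rightarrow> real.
        (\<forall>n\<ge>1. vn n \<in> (\<Union>L'\<in>{0<..}. C_n T S \<pi> n L') \<and> pi_solution T S \<pi> n F (vn n) \<and>
           (\<forall>x\<in>Omega T S. vn n T x (x T) = g (Proj S \<pi> n T x))) \<and>
        (\<forall>t\<in>{0..T}. \<forall>x\<in>Omega T S. (\<lambda>n. vn n t x (x t)) \<longlonglongrightarrow> v t x))"

end

theory Submission
  imports Defs
begin

text \<open>
  Between two grid times the path is frozen, so that the generator does not depend on the space
  variable, and it suffices to compare a subsolution \<open>u\<close> and a supersolution \<open>v\<close> on each slab,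
  backwards in time; the jump conditions pass the ordering on from one slab to the preceding one.
  On a slab, \<open>u - v\<close> is a subsolution of an extremal equation, which the barrier
  \<open>(1 + \<bar>y\<bar>\<^sup>2) / (t - a)\<^sup>n\<close> contradicts for large \<open>n\<close> if the quotient of \<open>u - v\<close> and the barrier has a
  positive maximum.  The equation for \<open>u - v\<close> comes from sup-convolutions: these are
  semiconvex, hence twice differentiable almost everywhere (Rademacher's theorem applied to the
  resolvent of the subdifferential), and by Jensen's lemma there is a point of second-order
  differentiability at which \<open>u - v\<close>, up to a small linear term, touches its test function.
\<close>

section \<open>Rademacher's theorem\<close>

text \<open>The generator is merely continuous in time, with a modulus that depends on the size of
  the Hessian at which it is evaluated, and Hessians of sup-convolutions grow as the regularisation
  is refined. Hence space and time are regularised with separate parameters. The spatial one is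
  fixed, and with it bounds on all spatial slopes and Hessians; only then is time refined until the
  points selected for \<open>u\<close> and \<open>v\<close> have times within the resulting modulus.
  The power in the barrier comes from its logarithmic derivative: the time derivative of (t -
  a)^(-n) is -n/(t - a) times the function, and n/(b - a) can be made to exceed the Lipschitz
  constant times the relative size of value, slope and Hessian of the barrier. The factor 1 + |y|^2
  beats the linear growth of the solutions, and the singularity at a keeps the maximum away from the
  left end. Rademacher's theorem yields information about convex functions because the resolvent is
  Lipschitz and therefore carries its own null set of bad points to a null set.\<close>

lemma negligible_contracting_cover:
  fixes T :: "'a::euclidean_space set"
  assumes T: "bounded T" and c: "0 < c" "c < 1"
    and cov: "\<And>U. open U \<Longrightarrow> T \<subseteq> U \<Longrightarrow>
                \<exists>B\<in>sets borel. negligible (T - B) \<and> emeasure lborel B \<le> ennreal c * emeasure lborel U"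
  shows "negligible T"
proof -
  \<comment> \<open>\<open>s\<close> is the outer Lebesgue measure of \<open>T\<close>, finite since
    \<open>T\<close> is bounded. The covering hypothesis will give \<open>s \<le> c * s\<close>,
    which forces \<open>s = 0\<close>.\<close>
  define s where "s = (INF U\<in>{U. open U \<and> T \<subseteq> U}. emeasure lborel U)"
  obtain R where R: "R > 0" "T \<subseteq> ball 0 R"
    using T bounded_subset_ballD by blast
  have fin: "s < \<infinity>"
  proof -
    have "s \<le> emeasure lborel (ball (0::'a) R)"
      unfolding s_def using R by (intro INF_lower) auto
    also have "\<dots> < \<infinity>"
      using R by (simp add: emeasure_ball)
    finally show ?thesis .
  qed
  \<comment> \<open>Up to a null set \<open>T\<close> lies in \<open>B\<close>, and outer regularity
    puts an open set of nearly the measure of \<open>B\<close> around \<open>B\<close> and that null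
    set.\<close>
  have key: "s \<le> ennreal c * emeasure lborel U" if U: "open U" "T \<subseteq> U" for U
  proof -
    obtain B where B: "B \<in> sets borel" "negligible (T - B)"
        "emeasure lborel B \<le> ennreal c * emeasure lborel U"
      using cov[OF U] by blast
    have "T - B \<in> null_sets lebesgue"
      using B(2) negligible_iff_null_sets by blast
    then obtain N where N: "N \<in> null_sets lborel" "T - B \<subseteq> N"
      using null_sets_completion_iff2[of "T - B" lborel] by blast
    have NB: "N \<union> B \<in> sets borel" using N B by auto
    have le: "s \<le> ennreal c * emeasure lborel U + ennreal e" if "e > 0" for e
    proof -
      obtain V where V: "open V" "N \<union> B \<subseteq> V" "emeasure lborel (V - (N \<union> B)) < ennreal e"
        using outer_regular_lborel[OF NB \<open>e > 0\<close>] by blast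
      have "s \<le> emeasure lborel V"
        unfolding s_def using V N by (intro INF_lower) auto
      also have "V = (N \<union> B) \<union> (V - (N \<union> B))" using V by auto
      also have "emeasure lborel \<dots> \<le> emeasure lborel (N \<union> B) + emeasure lborel (V - (N \<union> B))"
        using NB V by (intro emeasure_subadditive) auto
      also have "emeasure lborel (N \<union> B) = emeasure lborel B"
        using N B by (subst Un_commute, subst emeasure_Un_null_set) auto
      also have "emeasure lborel B + emeasure lborel (V - (N \<union> B)) \<le> ennreal c * emeasure lborel U + ennreal e"
        using B V by (intro add_mono) auto
      finally show ?thesis .
    qed
    show ?thesis
      by (rule ennreal_le_epsilon) (use le in auto)
  qed
  have "s = 0"
  proof (rule ccontr)
    assume "s \<noteq> 0"
    define r where "r = enn2real s"
    have sr: "s = ennreal r" using fin by (simp add: r_def)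
    have "r > 0" using \<open>s \<noteq> 0\<close> sr by (metis ennreal_neg not_less)
    have "s < ennreal (r / c)"
      using c \<open>r > 0\<close> by (simp add: sr ennreal_less_iff field_simps)
    then obtain U where U: "open U" "T \<subseteq> U" "emeasure lborel U < ennreal (r / c)"
      unfolding s_def INF_less_iff by blast
    obtain m where m: "emeasure lborel U = ennreal m" "m \<ge> 0" "m < r / c"
      using U(3) by (metis ennreal_cases ennreal_less_iff infinity_ennreal_def not_less top_greatest)
    have "s \<le> ennreal (c * m)"
      using key[OF U(1,2)] m c by (simp add: ennreal_mult)
    then have "r \<le> c * m"
      using sr m c by (simp add: ennreal_le_iff)
    then show False using m(3) c by (simp add: field_simps)
  qed
  show ?thesis
    unfolding negligible_outer_le
  proof (intro allI impI)
    fix e :: real assume "e > 0"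
    then have "s < ennreal e" by (simp add: \<open>s = 0\<close>)
    then obtain U where U: "open U" "T \<subseteq> U" "emeasure lborel U < ennreal e"
      unfolding s_def INF_less_iff by blast
    then have "U \<in> lmeasurable"
      by (intro fmeasurableI) (auto simp: less_top[symmetric] intro: order.strict_trans)
    moreover have "measure lebesgue U \<le> e"
      using U \<open>e > 0\<close> by (simp add: measure_def enn2real_leI less_imp_le)
    ultimately show "\<exists>T'. T \<subseteq> T' \<and> T' \<in> lmeasurable \<and> measure lebesgue T' \<le> e"
      using U by blast
  qed
qed

text \<open>The Vitali covering theorem for balls selected by a predicate. A selected ball only has
  to contain the given point, not to be centred there, so its radius is kept below half of the room
  \<open>e\<close> available inside \<open>U\<close>.\<close>

lemma Vitali_disjoint_cballs:
  fixes T :: "'a::euclidean_space set"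
  assumes U: "open U" "T \<subseteq> U"
    and fine: "\<And>x d. x \<in> T \<Longrightarrow> d > 0 \<Longrightarrow> \<exists>a r. 0 < r \<and> r < d \<and> x \<in> cball a r \<and> P a r"
  obtains C :: "('a \<times> real) set" where "countable C"
    "disjoint_family_on (\<lambda>i. cball (fst i) (snd i)) C"
    "\<And>a r. (a, r) \<in> C \<Longrightarrow> 0 < r \<and> P a r \<and> cball a r \<subseteq> U"
    "negligible (T - (\<Union>i\<in>C. cball (fst i) (snd i)))"
proof -
  define K where "K = {i. 0 < snd i \<and> P (fst i) (snd i) \<and> cball (fst i) (snd i) \<subseteq> U}"
  have fineK: "\<exists>i. i \<in> K \<and> x \<in> cball (fst i) (snd i) \<and> snd i < d" if xd: "x \<in> T" "d > 0" for x d
  proof -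
    have "x \<in> U" using U xd by auto
    then obtain e where e: "e > 0" "ball x e \<subseteq> U"
      by (rule openE[OF U(1)])
    obtain a r where ar: "0 < r" "r < min d (e / 2)" "x \<in> cball a r" "P a r"
      using fine[OF xd(1), of "min d (e / 2)"] xd(2) e(1) by (metis half_gt_zero min_less_iff_conj)
    have "cball a r \<subseteq> ball x e"
    proof
      fix y assume "y \<in> cball a r"
      then have "dist x y \<le> r + r"
        using ar(3) dist_triangle2[of x y a] by (auto simp: dist_commute)
      then show "y \<in> ball x e" using ar(2) by auto
    qed
    then have "(a, r) \<in> K" using e ar by (auto simp: K_def)
    then show ?thesis using ar by (intro exI[of _ "(a, r)"]) auto
  qed
  have "\<exists>C. countable C \<and> C \<subseteq> K \<and>
     pairwise (\<lambda>i j. disjnt (cball (fst i) (snd i)) (cball (fst j) (snd j))) C \<and>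
     negligible (T - (\<Union>i \<in> C. cball (fst i) (snd i)))"
  proof (rule Vitali_covering_theorem_cballs[of K snd T fst, OF _ fineK])
    show "0 < snd i" if "i \<in> K" for i using that by (simp add: K_def)
  qed blast+
  then obtain C where C: "countable C" "C \<subseteq> K"
     "pairwise (\<lambda>i j. disjnt (cball (fst i) (snd i)) (cball (fst j) (snd j))) C"
     "negligible (T - (\<Union>i \<in> C. cball (fst i) (snd i)))"
    by blast
  show thesis
  proof (rule that[OF C(1) _ _ C(4)])
    show "disjoint_family_on (\<lambda>i. cball (fst i) (snd i)) C"
      using C(3) by (auto simp: disjoint_family_on_def pairwise_def disjnt_def)
    show "0 < r \<and> P a r \<and> cball a r \<subseteq> U" if "(a, r) \<in> C" for a r
      using subsetD[OF C(2) that] unfolding K_def by simp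
  qed
qed

text \<open>Around a porous point the ball of radius \<open>2 * r\<close> contains a hole of radius
  \<open>\<eta> * r\<close> free of \<open>A\<close>, so \<open>A\<close> fills at most the fraction
  \<open>1 - (\<eta> / 2) ^ DIM('a)\<close> of it. Disjoint Vitali balls of this kind cover almost
  all the porous points, and the parts of \<open>A\<close> in them form a contracting cover.\<close>

lemma negligible_porous:
  fixes A :: "'a::euclidean_space set"
  assumes A: "A \<in> sets borel" and \<eta>: "0 < \<eta>" "\<eta> \<le> 1"
  shows "negligible {x\<in>A. \<forall>d>0. \<exists>r y. 0 < r \<and> r < d \<and> dist x y \<le> r \<and> ball y (\<eta> * r) \<inter> A = {}}"
proof -
  define T where "T = {x\<in>A. \<forall>d>0. \<exists>r y. 0 < r \<and> r < d \<and> dist x y \<le> r \<and> ball y (\<eta> * r) \<inter> A = {}}"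
  define \<kappa> where "\<kappa> = (\<eta> / 2) ^ DIM('a)"
  \<comment> \<open>Half of \<open>\<kappa>\<close> is given away so that \<open>c\<close> stays
    positive under the crude bound \<open>\<kappa> \<le> 1\<close>.\<close>
  define c where "c = 1 - \<kappa> / 2"
  have \<kappa>: "0 < \<kappa>" "\<kappa> \<le> 1" using \<eta> by (auto simp: \<kappa>_def intro!: power_le_one)
  have c: "0 < c" "c < 1" "1 - \<kappa> \<le> c" using \<kappa> by (auto simp: c_def)
  have "negligible (T \<inter> ball 0 (real n))" for n
  proof (rule negligible_contracting_cover[of _ c])
    fix U :: "'a set" assume U: "open U" "T \<inter> ball 0 (real n) \<subseteq> U"
    define P where "P = (\<lambda>a r. emeasure lborel (A \<inter> cball a r) \<le> ennreal c * emeasure lborel (cball a r))"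
    have fine: "\<exists>a r. 0 < r \<and> r < d \<and> x \<in> cball a r \<and> P a r" if x: "x \<in> T \<inter> ball 0 (real n)" "d > 0" for x d
    proof -
      have "\<forall>d>0. \<exists>r y. 0 < r \<and> r < d \<and> dist x y \<le> r \<and> ball y (\<eta> * r) \<inter> A = {}"
        using x by (simp add: T_def)
      then obtain r y where r: "0 < r" "r < d / 2" "dist x y \<le> r" "ball y (\<eta> * r) \<inter> A = {}"
        using half_gt_zero[OF \<open>d > 0\<close>] by meson
      let ?B = "cball x (2 * r)"
      have sub: "ball y (\<eta> * r) \<subseteq> ?B"
      proof
        fix z assume "z \<in> ball y (\<eta> * r)"
        then have "dist y z < \<eta> * r" by simp
        moreover have "\<eta> * r \<le> 1 * r" using r \<eta> by (intro mult_right_mono) auto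
        ultimately show "z \<in> ?B" using r(3) dist_triangle[of x z y] by simp
      qed
      have "emeasure lborel (A \<inter> ?B) \<le> emeasure lborel (?B - ball y (\<eta> * r))"
        using r(4) A by (intro emeasure_mono) auto
      also have "\<dots> = emeasure lborel ?B - emeasure lborel (ball y (\<eta> * r))"
        using sub r \<eta> by (intro emeasure_Diff) (auto simp: emeasure_ball)
      also have "\<dots> = ennreal (unit_ball_vol (DIM('a)) * (2*r) ^ DIM('a) - unit_ball_vol (DIM('a)) * (\<eta>*r) ^ DIM('a))"
        using r \<eta> by (simp add: emeasure_ball emeasure_cball ennreal_minus)
      also have "unit_ball_vol (DIM('a)) * (2*r) ^ DIM('a) - unit_ball_vol (DIM('a)) * (\<eta>*r) ^ DIM('a)
            = (1 - \<kappa>) * (unit_ball_vol (DIM('a)) * (2*r) ^ DIM('a))"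
        by (simp add: \<kappa>_def power_mult_distrib power_divide field_simps)
      also have "ennreal \<dots> \<le> ennreal (c * (unit_ball_vol (DIM('a)) * (2*r) ^ DIM('a)))"
        using c r by (intro ennreal_leI mult_right_mono) auto
      also have "\<dots> = ennreal c * emeasure lborel ?B"
        using r c by (simp add: emeasure_cball ennreal_mult)
      finally have "P x (2 * r)" by (simp add: P_def)
      then show ?thesis using r by (intro exI[of _ x] exI[of _ "2 * r"]) auto
    qed
    obtain C where C: "countable C" "disjoint_family_on (\<lambda>i. cball (fst i) (snd i)) C"
        "\<And>a r. (a, r) \<in> C \<Longrightarrow> 0 < r \<and> P a r \<and> cball a r \<subseteq> U"
        "negligible (T \<inter> ball 0 (real n) - (\<Union>i\<in>C. cball (fst i) (snd i)))"
      using Vitali_disjoint_cballs[OF U fine] by (metis (no_types, lifting))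
    let ?B = "\<Union>i\<in>C. A \<inter> cball (fst i) (snd i)"
    have 1: "?B \<in> sets borel" using C(1) A by (intro sets.countable_UN') auto
    have "emeasure lborel ?B = (\<integral>\<^sup>+i. emeasure lborel (A \<inter> cball (fst i) (snd i)) \<partial>count_space C)"
    proof (rule emeasure_UN_countable)
      show "disjoint_family_on (\<lambda>i. A \<inter> cball (fst i) (snd i)) C"
        using C(2) unfolding disjoint_family_on_def by blast
    qed (use C(1) A in auto)
    also have "\<dots> \<le> (\<integral>\<^sup>+i. ennreal c * emeasure lborel (cball (fst i) (snd i)) \<partial>count_space C)"
      using C(3) by (intro nn_integral_mono) (auto simp: P_def)
    also have "\<dots> = ennreal c * (\<integral>\<^sup>+i. emeasure lborel (cball (fst i) (snd i)) \<partial>count_space C)"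
      by (rule nn_integral_cmult) auto
    also have "(\<integral>\<^sup>+i. emeasure lborel (cball (fst i) (snd i)) \<partial>count_space C)
        = emeasure lborel (\<Union>i\<in>C. cball (fst i) (snd i))"
      using C(1,2) by (intro emeasure_UN_countable[symmetric]) auto
    also have "\<dots> \<le> emeasure lborel U"
    proof (rule emeasure_mono)
      show "(\<Union>i\<in>C. cball (fst i) (snd i)) \<subseteq> U"
      proof (rule UN_least)
        fix i assume "i \<in> C" then show "cball (fst i) (snd i) \<subseteq> U" using C(3)[of "fst i" "snd i"] by simp
      qed
    qed (use U in auto)
    finally have 2: "emeasure lborel ?B \<le> ennreal c * emeasure lborel U"
      by (simp add: mult_left_mono)
    have "T \<inter> ball 0 (real n) - ?B \<subseteq> T \<inter> ball 0 (real n) - (\<Union>i\<in>C. cball (fst i) (snd i))"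
      unfolding T_def by blast
    then have "negligible (T \<inter> ball 0 (real n) - ?B)"
      using C(4) negligible_subset by blast
    with 1 2 show "\<exists>B\<in>sets borel. negligible (T \<inter> ball 0 (real n) - B) \<and>
        emeasure lborel B \<le> ennreal c * emeasure lborel U"
      by blast
  qed (use c in auto)
  then have "negligible (\<Union>n. T \<inter> ball 0 (real n))"
    by (rule negligible_Union_nat)
  also have "(\<Union>n. T \<inter> ball 0 (real n)) = T"
    using reals_Archimedean2 by (auto simp: dist_norm)
  finally show ?thesis by (simp add: T_def)
qed

lemma negligible_sphere_real: "negligible (sphere a r :: real set)"
proof (rule negligible_subset)
  show "sphere a r \<subseteq> {a - r, a + r}" by (auto simp: sphere_def dist_real_def)
qed auto

section \<open>Differentiability almost everywhere on the line\<close>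

text \<open>The interval from \<open>a - r\<close> to \<open>a + r\<close> may contain
  \<open>x\<close> anywhere, in particular as an end point: one-sided difference quotients are
  included, and the intervals are the balls of a Vitali cover.\<close>

definition slopes_below :: "(real \<Rightarrow> real) \<Rightarrow> real \<Rightarrow> real \<Rightarrow> bool" where
  "slopes_below F p x \<longleftrightarrow> (\<forall>d>0. \<exists>a r. 0 < r \<and> r < d \<and> x \<in> cball a r \<and> F (a + r) - F (a - r) < p * (2 * r))"

definition slopes_above :: "(real \<Rightarrow> real) \<Rightarrow> real \<Rightarrow> real \<Rightarrow> bool" where
  "slopes_above F q x \<longleftrightarrow> (\<forall>d>0. \<exists>a r. 0 < r \<and> r < d \<and> x \<in> cball a r \<and> F (a + r) - F (a - r) > q * (2 * r))"

text \<open>Vitali's argument with the Stieltjes measure \<open>\<mu>\<close> of \<open>F\<close>.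
  Inside a cover by intervals on which \<open>\<mu>\<close> is below \<open>p\<close> times length,
  a second cover uses intervals on which \<open>\<mu>\<close> exceeds \<open>q\<close> times length.
  For the second cover, \<open>q\<close> times its length is at most its
  \<open>\<mu>\<close>-measure, which is at most \<open>p\<close> times the length of
  \<open>U\<close>: a contraction by \<open>p / q\<close>.\<close>

lemma negligible_monotone_oscillating_slopes:
  fixes F :: "real \<Rightarrow> real"
  assumes F: "mono F" "continuous_on UNIV F" and pq: "0 < p" "p < q"
  shows "negligible {x. slopes_below F p x \<and> slopes_above F q x}"
proof -
  define T where "T = {x. slopes_below F p x \<and> slopes_above F q x}"
  define \<mu> where "\<mu> = interval_measure F"
  have \<mu>sets[simp]: "sets \<mu> = sets borel" by (simp add: \<mu>_def)
  have \<mu>: "emeasure \<mu> (cball a r) = ennreal (F (a + r) - F (a - r))" if "r > 0" for a r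
    unfolding \<mu>_def using that F
    by (subst cball_eq_atLeastAtMost, subst emeasure_interval_measure_Icc) (auto simp: mono_def)
  have len: "emeasure lborel (cball a r) = ennreal (2 * r)" if "r > 0" for a r :: real
    using that by (simp add: cball_eq_atLeastAtMost)
  have "negligible (T \<inter> ball 0 (real n))" for n
  proof (rule negligible_contracting_cover[of _ "p / q"])
    fix U :: "real set" assume U: "open U" "T \<inter> ball 0 (real n) \<subseteq> U"
    obtain C where C: "countable C" "disjoint_family_on (\<lambda>i. cball (fst i) (snd i)) C"
        "\<And>a r. (a, r) \<in> C \<Longrightarrow> 0 < r \<and> F (a + r) - F (a - r) < p * (2 * r) \<and> cball a r \<subseteq> U"
        "negligible (T \<inter> ball 0 (real n) - (\<Union>i\<in>C. cball (fst i) (snd i)))"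
      by (rule Vitali_disjoint_cballs[OF U, of "\<lambda>a r. F (a + r) - F (a - r) < p * (2 * r)"])
        (auto simp: T_def slopes_below_def)
    \<comment> \<open>The second cover has to be placed inside an open set; passing to open
      intervals loses only countably many end points.\<close>
    define V where "V = (\<Union>i\<in>C. ball (fst i) (snd i))"
    have V: "open V" by (auto simp: V_def)
    obtain D where D: "countable D" "disjoint_family_on (\<lambda>i. cball (fst i) (snd i)) D"
        "\<And>a r. (a, r) \<in> D \<Longrightarrow> 0 < r \<and> F (a + r) - F (a - r) > q * (2 * r) \<and> cball a r \<subseteq> V"
        "negligible (T \<inter> V - (\<Union>i\<in>D. cball (fst i) (snd i)))"
      by (rule Vitali_disjoint_cballs[OF V, of "T \<inter> V" "\<lambda>a r. F (a + r) - F (a - r) > q * (2 * r)"])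
        (auto simp: T_def slopes_above_def)
    let ?B = "\<Union>i\<in>D. cball (fst i) (snd i)"
    have "negligible (\<Union>i\<in>C. sphere (fst i) (snd i))"
      using C(1) by (intro negligible_countable_Union) (auto simp: negligible_sphere_real)
    moreover have "T \<inter> ball 0 (real n) - ?B \<subseteq> (T \<inter> ball 0 (real n) - (\<Union>i\<in>C. cball (fst i) (snd i)))
        \<union> (\<Union>i\<in>C. sphere (fst i) (snd i)) \<union> (T \<inter> V - ?B)"
    proof
      fix x assume x: "x \<in> T \<inter> ball 0 (real n) - ?B"
      have "(\<Union>i\<in>C. cball (fst i) (snd i)) \<subseteq> V \<union> (\<Union>i\<in>C. sphere (fst i) (snd i))"
        unfolding V_def UN_Un_distrib[symmetric] by (intro UN_mono) auto
      then show "x \<in> (T \<inter> ball 0 (real n) - (\<Union>i\<in>C. cball (fst i) (snd i)))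
        \<union> (\<Union>i\<in>C. sphere (fst i) (snd i)) \<union> (T \<inter> V - ?B)"
        using x by blast
    qed
    ultimately have 1: "negligible (T \<inter> ball 0 (real n) - ?B)"
      using C(4) D(4) by (meson negligible_Un negligible_subset)
    have "ennreal q * emeasure lborel ?B = ennreal q * (\<integral>\<^sup>+i. emeasure lborel (cball (fst i) (snd i)) \<partial>count_space D)"
      using D(1,2) by (subst emeasure_UN_countable) auto
    also have "\<dots> = (\<integral>\<^sup>+i. ennreal q * emeasure lborel (cball (fst i) (snd i)) \<partial>count_space D)"
      by (rule nn_integral_cmult[symmetric]) auto
    also have "\<dots> \<le> (\<integral>\<^sup>+i. emeasure \<mu> (cball (fst i) (snd i)) \<partial>count_space D)"
    proof (rule nn_integral_mono)
      fix i assume "i \<in> space (count_space D)"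
      then have i: "0 < snd i" "F (fst i + snd i) - F (fst i - snd i) > q * (2 * snd i)"
        using D(3)[of "fst i" "snd i"] by auto
      show "ennreal q * emeasure lborel (cball (fst i) (snd i)) \<le> emeasure \<mu> (cball (fst i) (snd i))"
        unfolding \<mu>[OF i(1)] len[OF i(1)] using i pq
        by (subst ennreal_mult[symmetric]) (auto intro!: ennreal_leI)
    qed
    also have "\<dots> = emeasure \<mu> ?B"
      using D(1,2) by (intro emeasure_UN_countable[symmetric]) auto
    also have "\<dots> \<le> emeasure \<mu> (\<Union>i\<in>C. cball (fst i) (snd i))"
    proof (rule emeasure_mono)
      show "?B \<subseteq> (\<Union>i\<in>C. cball (fst i) (snd i))"
      proof -
        have "?B \<subseteq> V"
        proof (rule UN_least)
          fix i assume "i \<in> D" then show "cball (fst i) (snd i) \<subseteq> V" using D(3)[of "fst i" "snd i"] by simp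
        qed
        also have "V \<subseteq> (\<Union>i\<in>C. cball (fst i) (snd i))"
          unfolding V_def using ball_subset_cball by blast
        finally show ?thesis .
      qed
    qed (use C(1) in auto)
    also have "\<dots> = (\<integral>\<^sup>+i. emeasure \<mu> (cball (fst i) (snd i)) \<partial>count_space C)"
      using C(1,2) by (intro emeasure_UN_countable) auto
    also have "\<dots> \<le> (\<integral>\<^sup>+i. ennreal p * emeasure lborel (cball (fst i) (snd i)) \<partial>count_space C)"
    proof (rule nn_integral_mono)
      fix i assume "i \<in> space (count_space C)"
      then have i: "0 < snd i" "F (fst i + snd i) - F (fst i - snd i) < p * (2 * snd i)"
        using C(3)[of "fst i" "snd i"] by auto
      show "emeasure \<mu> (cball (fst i) (snd i)) \<le> ennreal p * emeasure lborel (cball (fst i) (snd i))"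
        unfolding \<mu>[OF i(1)] len[OF i(1)] using i pq
        by (subst ennreal_mult[symmetric]) (auto intro!: ennreal_leI)
    qed
    also have "\<dots> = ennreal p * (\<integral>\<^sup>+i. emeasure lborel (cball (fst i) (snd i)) \<partial>count_space C)"
      by (rule nn_integral_cmult) auto
    also have "\<dots> = ennreal p * emeasure lborel (\<Union>i\<in>C. cball (fst i) (snd i))"
      using C(1,2) by (subst emeasure_UN_countable) auto
    also have "\<dots> \<le> ennreal p * emeasure lborel U"
    proof (intro mult_left_mono emeasure_mono)
      show "(\<Union>i\<in>C. cball (fst i) (snd i)) \<subseteq> U"
      proof (rule UN_least)
        fix i assume "i \<in> C" then show "cball (fst i) (snd i) \<subseteq> U" using C(3)[of "fst i" "snd i"] by simp
      qed
    qed (use U in auto)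
    finally have *: "ennreal q * emeasure lborel ?B \<le> ennreal p * emeasure lborel U" .
    have "emeasure lborel ?B = ennreal (1 / q) * (ennreal q * emeasure lborel ?B)"
      using pq by (subst mult.assoc[symmetric], subst ennreal_mult[symmetric]) auto
    also have "\<dots> \<le> ennreal (1 / q) * (ennreal p * emeasure lborel U)"
      by (intro mult_left_mono *) auto
    also have "\<dots> = ennreal (p / q) * emeasure lborel U"
      using pq by (subst mult.assoc[symmetric], subst ennreal_mult[symmetric]) auto
    finally have 2: "emeasure lborel ?B \<le> ennreal (p / q) * emeasure lborel U" .
    show "\<exists>B\<in>sets borel. negligible (T \<inter> ball 0 (real n) - B) \<and>
        emeasure lborel B \<le> ennreal (p / q) * emeasure lborel U"
      using 1 2 D(1) by (intro bexI[of _ ?B]) auto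
  qed (use pq in auto)
  then have "negligible (\<Union>n. T \<inter> ball 0 (real n))"
    by (rule negligible_Union_nat)
  also have "(\<Union>n. T \<inter> ball 0 (real n)) = T"
    using reals_Archimedean2 by (auto simp: dist_norm)
  finally show ?thesis by (simp add: T_def)
qed

definition quotient_near :: "('a::real_normed_vector \<Rightarrow> real) \<Rightarrow> 'a \<Rightarrow> real \<Rightarrow> real \<Rightarrow> real \<Rightarrow> 'a \<Rightarrow> bool" where
  "quotient_near f b q d e x \<longleftrightarrow> (\<forall>t. \<bar>t\<bar> \<le> d \<longrightarrow> \<bar>f (x + t *\<^sub>R b) - f x - q * t\<bar> \<le> e * \<bar>t\<bar>)"

text \<open>
  Differentiability at \<open>x\<close> in the direction \<open>b\<close>, expressed by countably many closed conditions on \<open>x\<close>.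
\<close>

definition slope_exists :: "('a::real_normed_vector \<Rightarrow> real) \<Rightarrow> 'a \<Rightarrow> 'a \<Rightarrow> bool" where
  "slope_exists f b x \<longleftrightarrow> (\<forall>e>0. \<exists>q\<in>\<rat>. \<exists>d>0. quotient_near f b q d e x)"

text \<open>Adding \<open>(L + 1) * x\<close> turns \<open>f\<close> into an increasing
  \<open>F\<close> with slopes between \<open>1\<close> and \<open>2 * L + 1\<close>, positive as
  the oscillation lemma requires. Off the null set where slopes oscillate across some rational gap,
  all short slopes of \<open>F\<close> cluster at one value.\<close>

lemma negligible_Lipschitz_not_differentiable_real:
  fixes f :: "real \<Rightarrow> real"
  assumes lip: "\<And>x y. \<bar>f x - f y\<bar> \<le> L * \<bar>x - y\<bar>"
  shows "negligible {x. \<not> slope_exists f 1 x}"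
proof -
  define F where "F = (\<lambda>x. f x + (L + 1) * x)"
  have L: "L \<ge> 0" using lip[of 1 0] by simp
  have F: "F y - F x \<ge> y - x" "F y - F x \<le> (2 * L + 1) * (y - x)" if "x \<le> y" for x y
    using lip[of y x] that by (auto simp: F_def algebra_simps abs_le_iff)
  have monoF: "mono F" using F(1) by (fastforce simp: mono_def)
  have contF: "continuous_on UNIV F"
  proof -
    have "L-lipschitz_on UNIV f" using lip L by (auto simp: lipschitz_on_def dist_real_def)
    then show ?thesis unfolding F_def by (intro continuous_intros lipschitz_on_continuous_on)
  qed
  let ?N = "\<Union>p\<in>{p\<in>\<rat>. 0 < p}. \<Union>q\<in>{q\<in>\<rat>. p < q}. {x. slopes_below F p x \<and> slopes_above F q x}"
  have cR: "countable {p\<in>\<rat>::real set. P p}" for P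
    by (rule countable_subset[OF _ countable_rat]) auto
  have "negligible {x. slopes_below F p x \<and> slopes_above F q x}" if "0 < p" "p < q" for p q
    by (rule negligible_monotone_oscillating_slopes[OF monoF contF that])
  then have "negligible ?N"
    using cR by (intro negligible_countable_Union) (auto intro!: negligible_countable_Union)
  moreover have "slope_exists f 1 x" if x: "x \<notin> ?N" for x
    unfolding slope_exists_def
  proof (intro allI impI)
    fix e :: real assume e: "e > 0"
    \<comment> \<open>\<open>Inf H\<close> is the limit superior of the slopes at
      \<open>x\<close>.\<close>
    define H where "H = {q. \<not> slopes_above F q x}"
    have hi0: "slopes_above F q x" if "q < 1" for q
      unfolding slopes_above_def
    proof (intro allI impI)
      fix d :: real assume "d > 0"
      have "q * d < d" using that \<open>d > 0\<close> by simp
      moreover have "d \<le> F (x + d/2) - F (x - d/2)"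
        using F(1)[of "x - d/2" "x + d/2"] \<open>d > 0\<close> by simp
      moreover have "q * (2 * (d/2)) = q * d" by simp
      ultimately have "q * (2 * (d/2)) < F (x + d/2) - F (x - d/2)" by linarith
      then show "\<exists>a r. 0 < r \<and> r < d \<and> x \<in> cball a r \<and> q * (2 * r) < F (a + r) - F (a - r)"
        using \<open>d > 0\<close> by (intro exI[of _ x] exI[of _ "d/2"]) auto
    qed
    then have bdd: "bdd_below H" unfolding H_def by (intro bdd_belowI[of _ 1]) (force simp: not_less[symmetric])
    have "\<not> slopes_above F (2 * L + 1) x"
    proof
      assume "slopes_above F (2 * L + 1) x"
      then obtain a r where "0 < r" "F (a + r) - F (a - r) > (2 * L + 1) * (2 * r)"
        unfolding slopes_above_def using zero_less_one by blast
      then show False using F(2)[of "a - r" "a + r"] by (auto simp: algebra_simps)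
    qed
    then have ne: "H \<noteq> {}" by (auto simp: H_def)
    define l where "l = Inf H"
    have "l \<ge> 1" unfolding l_def using hi0 ne
      by (intro cInf_greatest) (force simp: H_def not_less[symmetric])+
    obtain q1 where q1: "q1 \<in> H" "q1 < l + e / 3"
      using cInf_lessD[OF ne, of "l + e / 3"] e by (auto simp: l_def)
    \<comment> \<open>Slopes above \<open>q0 < l\<close> occur at all scales. As \<open>x\<close>
      does not oscillate across the rational gap from \<open>p\<close> to \<open>q0\<close>, there
      are no slopes below \<open>p\<close> at small scales, and all short slopes lie in
      \<open>[p, q1]\<close>, of length less than \<open>2 * e / 3\<close>.\<close>
    obtain q0 where q0: "q0 \<in> \<rat>" "max (1/2) (l - e / 3) < q0" "q0 < l"
      using Rats_dense_in_real[of "max (1/2) (l - e / 3)" l] \<open>l \<ge> 1\<close> e by auto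
    obtain p where p: "p \<in> \<rat>" "max (1/2) (l - e / 3) < p" "p < q0"
      using Rats_dense_in_real[OF q0(2)] by auto
    have "slopes_above F q0 x"
      using q0(3) cInf_lower[OF _ bdd, of q0] unfolding l_def by (auto simp: H_def)
    then have "\<not> slopes_below F p x"
      using x p q0 by auto
    then obtain d1 where d1: "d1 > 0" "\<And>a r. 0 < r \<Longrightarrow> r < d1 \<Longrightarrow> x \<in> cball a r \<Longrightarrow> F (a + r) - F (a - r) \<ge> p * (2 * r)"
      unfolding slopes_below_def by (meson not_less)
    obtain d2 where d2: "d2 > 0" "\<And>a r. 0 < r \<Longrightarrow> r < d2 \<Longrightarrow> x \<in> cball a r \<Longrightarrow> F (a + r) - F (a - r) \<le> q1 * (2 * r)"
      using q1(1) unfolding slopes_above_def H_def mem_Collect_eq by (meson not_less)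
    \<comment> \<open>Subtracting \<open>L + 1\<close> undoes the tilt; the spare
      \<open>e / 3\<close> pays for making \<open>q\<close> rational.\<close>
    obtain q where q: "q \<in> \<rat>" "p - (L + 1) - e / 3 < q" "q < p - (L + 1)"
      using Rats_dense_in_real[of "p - (L + 1) - e / 3" "p - (L + 1)"] e by auto
    define d where "d = min d1 d2"
    have "\<bar>f (x + t) - f x - q * t\<bar> \<le> e * \<bar>t\<bar>" if t: "\<bar>t\<bar> \<le> d" for t
    proof (cases "t = 0")
      case False
      define s where "s = (F (x + t) - F x) / t"
      have "x \<in> cball (x + t / 2) (\<bar>t\<bar> / 2)" by (simp add: dist_real_def)
      moreover have "F (x + t / 2 + \<bar>t\<bar> / 2) - F (x + t / 2 - \<bar>t\<bar> / 2) = s * (2 * (\<bar>t\<bar> / 2))"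
      proof (cases "t > 0")
        case True
        then have eq: "x + t / 2 + \<bar>t\<bar> / 2 = x + t" "x + t / 2 - \<bar>t\<bar> / 2 = x" by auto
        show ?thesis unfolding eq s_def using True by simp
      next
        case F: False
        then have eq: "x + t / 2 + \<bar>t\<bar> / 2 = x" "x + t / 2 - \<bar>t\<bar> / 2 = x + t" by auto
        show ?thesis unfolding eq s_def using False F by simp
      qed
      moreover have "0 < \<bar>t\<bar> / 2" "\<bar>t\<bar> / 2 < d1" "\<bar>t\<bar> / 2 < d2" using False t d1(1) d2(1) by (auto simp: d_def)
      ultimately have "p * \<bar>t\<bar> \<le> s * \<bar>t\<bar>" "s * \<bar>t\<bar> \<le> q1 * \<bar>t\<bar>"
        using d1(2)[of "\<bar>t\<bar> / 2" "x + t / 2"] d2(2)[of "\<bar>t\<bar> / 2" "x + t / 2"] by auto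
      then have s: "p \<le> s" "s \<le> q1" using False by auto
      have "f (x + t) - f x - q * t = (s - (L + 1) - q) * t"
        using False by (simp add: s_def F_def field_simps)
      moreover have "\<bar>s - (L + 1) - q\<bar> \<le> e"
        using s q q1 p by (auto simp: abs_le_iff)
      ultimately show ?thesis
        by (simp add: abs_mult mult_right_mono)
    qed simp
    moreover have "d > 0" using d1 d2 by (simp add: d_def)
    ultimately show "\<exists>q\<in>\<rat>. \<exists>d>0. quotient_near f 1 q d e x"
      using q(1) unfolding quotient_near_def by (intro bexI[of _ q] exI[of _ d]) auto
  qed
  ultimately show ?thesis
    by (elim negligible_subset) blast
qed

section \<open>Differentiability almost everywhere in several variables\<close>

lemma Lipschitz_real:
  fixes f :: "'a::euclidean_space \<Rightarrow> real"
  assumes lip: "\<And>x y. \<bar>f x - f y\<bar> \<le> L * norm (x - y)"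
  shows "L \<ge> 0" "continuous_on UNIV f"
proof -
  obtain b :: 'a where "b \<in> Basis" using nonempty_Basis by blast
  then show "L \<ge> 0" using lip[of b 0] by simp
  then show "continuous_on UNIV f"
    using lip by (intro lipschitz_on_continuous_on[of L]) (auto simp: lipschitz_on_def dist_norm)
qed

text \<open>The slopes offered for different tolerances are not assumed to agree. Testing two of
  them on a small vector along their difference shows that they are within the sum of their
  tolerances, so they form a Cauchy sequence, whose limit is the gradient.\<close>

lemma differentiable_if_linear_approximations:
  fixes f :: "'a::euclidean_space \<Rightarrow> real"
  assumes ap: "\<And>e. e > 0 \<Longrightarrow> \<exists>v. \<exists>d>0. \<forall>h. norm h < d \<longrightarrow> \<bar>f (x + h) - f x - v \<bullet> h\<bar> \<le> e * norm h"
  shows "f differentiable (at x)"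
proof -
  define e where "e = (\<lambda>m. 1 / real (Suc m))"
  have e: "e m > 0" for m by (simp add: e_def)
  have "\<forall>m. \<exists>v. \<exists>d>0. \<forall>h. norm h < d \<longrightarrow> \<bar>f (x + h) - f x - v \<bullet> h\<bar> \<le> e m * norm h"
    using ap e by blast
  then obtain v d where d: "\<And>m. d m > 0"
    and v: "\<And>m h. norm h < d m \<Longrightarrow> \<bar>f (x + h) - f x - v m \<bullet> h\<bar> \<le> e m * norm h"
    by metis
  have dist: "norm (v m - v n) \<le> e m + e n" for m n
  proof (cases "v m = v n")
    case False
    define w where "w = v m - v n"
    define s where "s = min (d m) (d n) / (2 * norm w)"
    have w: "norm w > 0" using False by (simp add: w_def)
    have s: "s > 0" "norm (s *\<^sub>R w) < d m" "norm (s *\<^sub>R w) < d n"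
      using w d[of m] d[of n] by (auto simp: s_def)
    have "\<bar>(v m - v n) \<bullet> (s *\<^sub>R w)\<bar> \<le> e m * norm (s *\<^sub>R w) + e n * norm (s *\<^sub>R w)"
      using v[OF s(2)] v[OF s(3)] by (simp add: inner_diff_left del: inner_scaleR_right)
    then have "s * (norm w * norm w) \<le> (e m + e n) * (s * norm w)"
      using s(1) by (simp add: w_def[symmetric] dot_square_norm power2_eq_square abs_mult algebra_simps)
    then have "(s * norm w) * norm w \<le> (s * norm w) * (e m + e n)" by (simp add: mult_ac)
    then have "norm w \<le> e m + e n" using s(1) w by (subst (asm) mult_le_cancel_left_pos) auto
    then show ?thesis by (simp add: w_def)
  qed (use e[of m] e[of n] in auto)
  have e0: "e \<longlonglongrightarrow> 0" unfolding e_def by (rule LIMSEQ_Suc, rule lim_inverse_n[unfolded inverse_eq_divide])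
  have "Cauchy v"
  proof (rule CauchyI)
    fix r :: real assume "r > 0"
    then obtain M where M: "\<And>m. m \<ge> M \<Longrightarrow> \<bar>e m\<bar> < r / 2"
      using LIMSEQ_D[OF e0, of "r / 2"] by auto
    show "\<exists>M. \<forall>m\<ge>M. \<forall>n\<ge>M. norm (v m - v n) < r"
    proof (intro exI allI impI)
      fix m n assume "M \<le> m" "M \<le> n"
      then show "norm (v m - v n) < r" using M[of m] M[of n] dist[of m n] by auto
    qed
  qed
  then obtain w where w: "v \<longlonglongrightarrow> w" using Cauchy_convergent_iff convergent_def by blast
  have vw: "norm (v m - w) \<le> e m" for m
  proof (rule LIMSEQ_le)
    show "(\<lambda>n. norm (v m - v n)) \<longlonglongrightarrow> norm (v m - w)" by (intro tendsto_intros w)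
    show "(\<lambda>n. e m + e n) \<longlonglongrightarrow> e m" using tendsto_add[OF tendsto_const e0, of "e m"] by simp
  qed (use dist in auto)
  have "(f has_derivative (\<lambda>h. w \<bullet> h)) (at x)"
    unfolding has_derivative_at_alt
  proof (intro conjI allI impI bounded_linear_inner_right)
    fix r :: real assume "r > 0"
    then obtain M where "\<forall>n\<ge>M. norm (e n - 0) < r / 2"
      using LIMSEQ_D[OF e0, of "r / 2"] by auto
    then obtain m where m: "e m < r / 2" using that[of M] e[of M] by force
    show "\<exists>d>0. \<forall>y. norm (y - x) < d \<longrightarrow> norm (f y - f x - w \<bullet> (y - x)) \<le> r * norm (y - x)"
    proof (intro exI[of _ "d m"] conjI d allI impI)
      fix y assume y: "norm (y - x) < d m"
      have "\<bar>(v m - w) \<bullet> (y - x)\<bar> \<le> e m * norm (y - x)"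
        using Cauchy_Schwarz_ineq2[of "v m - w" "y - x"] mult_right_mono[OF vw[of m], of "norm (y - x)"] by simp
      then have "\<bar>f y - f x - w \<bullet> (y - x)\<bar> \<le> (2 * e m) * norm (y - x)"
        using v[OF y] by (simp add: inner_diff_left)
      also have "\<dots> \<le> r * norm (y - x)" using m by (intro mult_right_mono) auto
      finally show "norm (f y - f x - w \<bullet> (y - x)) \<le> r * norm (y - x)" by simp
    qed
  qed
  then show ?thesis unfolding differentiable_def by blast
qed

lemma closed_quotient_near:
  fixes f :: "'a::real_normed_vector \<Rightarrow> real"
  assumes f: "continuous_on UNIV f"
  shows "closed {x. quotient_near f b q d e x}"
  unfolding quotient_near_def
proof -
  have "closed {x. \<bar>t\<bar> \<le> d \<longrightarrow> \<bar>f (x + t *\<^sub>R b) - f x - q * t\<bar> \<le> e * \<bar>t\<bar>}" for t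
  proof (cases "\<bar>t\<bar> \<le> d")
    case True
    then show ?thesis
      by (simp, intro closed_Collect_le continuous_intros continuous_on_compose2[OF f]) auto
  qed simp
  then show "closed {x. \<forall>t. \<bar>t\<bar> \<le> d \<longrightarrow> \<bar>f (x + t *\<^sub>R b) - f x - q * t\<bar> \<le> e * \<bar>t\<bar>}"
    by (rule closed_Collect_all)
qed

text \<open>Fubini along \<open>b\<close> without a change of coordinates: by translation invariance
  the measure of the bad set is the average of the measures of its translates by multiples
  \<open>s *\<^sub>R b\<close> with \<open>s\<close> in \<open>[0, 1]\<close>. After exchanging the
  integrals the inner one runs along a line, where the one-dimensional result makes it
  vanish.\<close>

lemma negligible_not_directionally_differentiable:
  fixes f :: "'a::euclidean_space \<Rightarrow> real"
  assumes lip: "\<And>x y. \<bar>f x - f y\<bar> \<le> L * norm (x - y)"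
  shows "negligible {x. \<not> slope_exists f b x}" (is "negligible ?N")
proof -
  note L = Lipschitz_real(1)[OF lip] and cont = Lipschitz_real(2)[OF lip]
  define A where "A = (\<lambda>m k q. {x. quotient_near f b q (1 / real (Suc k)) (1 / real (Suc m)) x})"
  \<comment> \<open>With \<open>q\<close> rational and with tolerances and radii of the form
    \<open>1 / Suc m\<close>, the set is obtained from closed sets by countable operations. It is
    thus Borel, as the exchange of integrals requires.\<close>
  have N: "?N = - (\<Inter>m. \<Union>k. \<Union>q\<in>\<rat>. A m k q)"
  proof -
    have near_mono: "quotient_near f b q d' e' x" if "quotient_near f b q d e x" "d' \<le> d" "e \<le> e'" for q d d' e e' x
      unfolding quotient_near_def
    proof (intro allI impI)
      fix t assume "\<bar>t\<bar> \<le> d'"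
      then have "\<bar>f (x + t *\<^sub>R b) - f x - q * t\<bar> \<le> e * \<bar>t\<bar>"
        using that(1,2) unfolding quotient_near_def by simp
      also have "\<dots> \<le> e' * \<bar>t\<bar>" using that(3) by (intro mult_right_mono) auto
      finally show "\<bar>f (x + t *\<^sub>R b) - f x - q * t\<bar> \<le> e' * \<bar>t\<bar>" .
    qed
    have "slope_exists f b x \<longleftrightarrow> (\<forall>m. \<exists>k. \<exists>q\<in>\<rat>. x \<in> A m k q)" for x
    proof (intro iffI allI)
      fix m assume "slope_exists f b x"
      moreover have "1 / real (Suc m) > 0" by simp
      ultimately obtain q d where qd: "q \<in> \<rat>" "d > 0" "quotient_near f b q d (1 / real (Suc m)) x"
        unfolding slope_exists_def by blast
      obtain k where "1 / real (Suc k) < d" using nat_approx_posE[OF qd(2)] .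
      then have "x \<in> A m k q" using near_mono[OF qd(3)] by (simp add: A_def)
      then show "\<exists>k. \<exists>q\<in>\<rat>. x \<in> A m k q" using qd(1) by blast
    next
      assume *: "\<forall>m. \<exists>k. \<exists>q\<in>\<rat>. x \<in> A m k q"
      show "slope_exists f b x"
        unfolding slope_exists_def
      proof (intro allI impI)
        fix e :: real assume "e > 0"
        obtain m where m: "1 / real (Suc m) < e" using nat_approx_posE[OF \<open>e > 0\<close>] .
        obtain k q where kq: "q \<in> \<rat>" "x \<in> A m k q" using * by blast
        have "quotient_near f b q (1 / real (Suc k)) e x"
          using kq(2) m near_mono unfolding A_def by force
        then show "\<exists>q\<in>\<rat>. \<exists>d>0. quotient_near f b q d e x"
          using kq(1) by (intro bexI[of _ q] exI[of _ "1 / real (Suc k)"]) auto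
      qed
    qed
    then have "?N = - {x. \<forall>m. \<exists>k. \<exists>q\<in>\<rat>. x \<in> A m k q}" by (simp add: set_eq_iff)
    moreover have "{x. \<forall>m. \<exists>k. \<exists>q\<in>\<rat>. x \<in> A m k q} = (\<Inter>m. \<Union>k. \<Union>q\<in>\<rat>. A m k q)"
      by (simp add: set_eq_iff)
    ultimately show ?thesis by simp
  qed
  have Ab: "A m k q \<in> sets borel" for m k q
    unfolding A_def by (intro borel_closed closed_quotient_near cont)
  have Nb: "?N \<in> sets borel"
  proof -
    have "(\<Inter>m. \<Union>k. \<Union>q\<in>\<rat>. A m k q) \<in> sets borel"
      using Ab by (intro sets.countable_INT'' sets.countable_UN' countable_rat countableI_type image_subsetI) auto
    then show ?thesis unfolding N by (rule borel_comp)
  qed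
  define \<xi> :: "'a \<Rightarrow> ennreal" where "\<xi> = indicator ?N"
  have \<xi>[measurable]: "\<xi> \<in> borel_measurable borel" using Nb by (simp add: \<xi>_def)
  have transl: "(\<integral>\<^sup>+x. \<xi> (x + s *\<^sub>R b) \<partial>lborel) = emeasure lborel ?N" for s
  proof -
    have "emeasure lborel ?N = (\<integral>\<^sup>+x. \<xi> x \<partial>lborel)"
      unfolding \<xi>_def using Nb by simp
    also have "\<dots> = (\<integral>\<^sup>+x. \<xi> x \<partial>distr lborel borel ((+) (s *\<^sub>R b)))"
      by (simp add: lborel_distr_plus)
    also have "\<dots> = (\<integral>\<^sup>+x. \<xi> (s *\<^sub>R b + x) \<partial>lborel)"
      by (rule nn_integral_distr) auto
    finally show ?thesis by (simp add: add.commute)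
  qed
  have line: "(\<integral>\<^sup>+s. indicator {0..1} s * \<xi> (x + s *\<^sub>R b) \<partial>lborel) = 0" for x
  proof -
    let ?g = "\<lambda>s. f (x + s *\<^sub>R b)"
    have "negligible {s. \<not> slope_exists ?g 1 s}"
    proof (rule negligible_Lipschitz_not_differentiable_real)
      fix s t
      have "\<bar>?g s - ?g t\<bar> \<le> L * norm ((s - t) *\<^sub>R b)"
        using lip[of "x + s *\<^sub>R b" "x + t *\<^sub>R b"] by (simp add: algebra_simps)
      then show "\<bar>?g s - ?g t\<bar> \<le> (L * norm b) * \<bar>s - t\<bar>" by (simp add: mult_ac)
    qed
    moreover have "slope_exists ?g 1 s \<longleftrightarrow> slope_exists f b (x + s *\<^sub>R b)" for s
      unfolding slope_exists_def quotient_near_def by (simp add: algebra_simps)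
    ultimately have "negligible {s. x + s *\<^sub>R b \<in> ?N}" by simp
    then have "{s. x + s *\<^sub>R b \<in> ?N} \<in> null_sets lebesgue"
      using negligible_iff_null_sets by blast
    then have "AE s in lebesgue. x + s *\<^sub>R b \<notin> ?N"
      using AE_iff_null_sets[OF null_setsD2, of "{s. x + s *\<^sub>R b \<in> ?N}" lebesgue] by simp
    then have "AE s in lborel. x + s *\<^sub>R b \<notin> ?N"
      by (simp only: AE_completion_iff)
    then have "AE s in lborel. indicator {0..1} s * \<xi> (x + s *\<^sub>R b) = 0"
      by (rule AE_mp) (auto simp: \<xi>_def)
    then show ?thesis
      by (subst nn_integral_0_iff_AE) auto
  qed
  have "emeasure lborel ?N = (\<integral>\<^sup>+s. indicator {0..1::real} s * emeasure lborel ?N \<partial>lborel)"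
    by (subst nn_integral_multc) auto
  also have "\<dots> = (\<integral>\<^sup>+s. (\<integral>\<^sup>+x. indicator {0..1} s * \<xi> (x + s *\<^sub>R b) \<partial>lborel) \<partial>lborel)"
    by (subst nn_integral_cmult) (auto simp: transl)
  also have "\<dots> = (\<integral>\<^sup>+x. (\<integral>\<^sup>+s. indicator {0..1} s * \<xi> (x + s *\<^sub>R b) \<partial>lborel) \<partial>lborel)"
    by (rule lborel_pair.Fubini') measurable
  also have "\<dots> = 0" by (simp add: line)
  finally have "?N \<in> null_sets lborel" using Nb by auto
  then show ?thesis using negligible_iff_null_sets null_sets_completionI by blast
qed

text \<open>On \<open>A m k q\<close> the partial difference quotients are controlled uniformly,
  with slopes \<open>q\<close> and radius \<open>1 / Suc k\<close>. If \<open>x\<close> is a point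
  of this set but not a porous one, every \<open>z\<close> near \<open>x\<close> has a point
  \<open>a\<close> of the set much closer to it than \<open>x\<close> is; each coordinate step on
  the way from \<open>x\<close> to \<open>x + h\<close> can then be made from such an
  \<open>a\<close> instead, at the price of a small Lipschitz error. There are countably many such
  sets, each with negligible porous part.\<close>

theorem Rademacher_real:
  fixes f :: "'a::euclidean_space \<Rightarrow> real"
  assumes lip: "\<And>x y. \<bar>f x - f y\<bar> \<le> L * norm (x - y)"
  shows "negligible {x. \<not> f differentiable (at x)}"
proof -
  note L = Lipschitz_real(1)[OF lip] and cont = Lipschitz_real(2)[OF lip]
  define \<eta> where "\<eta> = (\<lambda>m. 1 / real (Suc m))"
  define A where "A = (\<lambda>m k (q :: 'a \<Rightarrow> real). {x. \<forall>b\<in>Basis. quotient_near f b (q b) (1 / real (Suc k)) (\<eta> m) x})"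
  define D where "D = (\<lambda>b. {x. \<not> slope_exists f b x})"
  define P where "P = (\<lambda>m k q. {x\<in>A m k q. \<forall>d>0. \<exists>r y. 0 < r \<and> r < d \<and> dist x y \<le> r \<and> ball y (\<eta> m * r) \<inter> A m k q = {}})"
  have \<eta>: "0 < \<eta> m" "\<eta> m \<le> 1" for m by (auto simp: \<eta>_def)
  have Acl: "closed (A m k q)" for m k q
  proof -
    have "A m k q = (\<Inter>b\<in>Basis. {x. quotient_near f b (q b) (1 / real (Suc k)) (\<eta> m) x})" by (auto simp: A_def)
    then show ?thesis by (auto intro!: closed_INT closed_quotient_near cont)
  qed
  let ?Q = "PiE (Basis :: 'a set) (\<lambda>_. \<rat>)"
  let ?N = "(\<Union>b\<in>Basis. D b) \<union> (\<Union>m. \<Union>k. \<Union>q\<in>?Q. P m k q)"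
  have "negligible (P m k q)" for m k q
    unfolding P_def using Acl \<eta> by (intro negligible_porous) auto
  moreover have "countable ?Q" by (intro countable_PiE countable_rat) auto
  moreover have "negligible (D b)" for b
    unfolding D_def by (rule negligible_not_directionally_differentiable[OF lip])
  ultimately have "negligible ?N"
    by (intro negligible_Un negligible_countable_Union countable_image)
      (auto intro!: negligible_countable_Union intro: countable_finite)
  moreover have "f differentiable (at x)" if x: "x \<notin> ?N" for x
  proof (rule differentiable_if_linear_approximations)
    fix e :: real assume "e > 0"
    \<comment> \<open>Each of the \<open>DIM('a)\<close> coordinate steps costs
      \<open>\<eta> m * norm h\<close> for the quotient and twice \<open>L * (\<eta> m * r)\<close>
      for moving between \<open>z\<close> and \<open>a\<close>.\<close>
    define K where "K = real DIM('a) * (1 + 2 * L * real DIM('a))"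
    have "K > 0" using L by (simp add: K_def add_pos_nonneg)
    obtain m where "\<eta> m < e / K" unfolding \<eta>_def
      using nat_approx_posE[of "e / K"] \<open>e > 0\<close> \<open>K > 0\<close> by auto
    then have m: "K * \<eta> m \<le> e" using \<open>K > 0\<close> by (simp add: field_simps)
    have "\<forall>b\<in>Basis. \<exists>q\<in>\<rat>. \<exists>d>0. quotient_near f b q d (\<eta> m) x"
      using x \<eta>(1)[of m] unfolding D_def slope_exists_def by blast
    then obtain q d where q: "\<And>b. b \<in> Basis \<Longrightarrow> q b \<in> \<rat>" and d: "\<And>b. b \<in> Basis \<Longrightarrow> d b > 0"
      and qd: "\<And>b. b \<in> Basis \<Longrightarrow> quotient_near f b (q b) (d b) (\<eta> m) x"
      by metis
    define q' where "q' = restrict q Basis"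
    have q': "q' \<in> ?Q" using q by (auto simp: q'_def)
    have "Min (d ` (Basis :: 'a set)) > 0" using d by simp
    then obtain k where "1 / real (Suc k) < Min (d ` (Basis :: 'a set))" by (rule nat_approx_posE)
    then have k: "b \<in> Basis \<Longrightarrow> 1 / real (Suc k) \<le> d b" for b by auto
    have xA: "x \<in> A m k q'"
      using qd k unfolding A_def quotient_near_def q'_def by fastforce
    have "x \<notin> P m k q'" using x q' by blast
    then obtain d0 where d0: "d0 > 0" "\<And>r y. 0 < r \<Longrightarrow> r < d0 \<Longrightarrow> dist x y \<le> r \<Longrightarrow> ball y (\<eta> m * r) \<inter> A m k q' \<noteq> {}"
      using xA unfolding P_def by blast
    define v where "v = (\<Sum>b\<in>Basis. q' b *\<^sub>R b)"
    define \<delta> where "\<delta> = min (d0 / real DIM('a)) (1 / real (Suc k))"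
    have "\<delta> > 0" using d0 by (simp add: \<delta>_def)
    have "\<bar>f (x + h) - f x - v \<bullet> h\<bar> \<le> e * norm h" if h: "norm h < \<delta>" for h
    proof (cases "h = 0")
      case False
      \<comment> \<open>All corners of the coordinate path from \<open>x\<close> to
        \<open>x + h\<close> lie within \<open>r\<close> of \<open>x\<close>.\<close>
      define r where "r = real DIM('a) * norm h"
      have r: "0 < r" "r < d0" using False h by (auto simp: r_def \<delta>_def field_simps)
      have hb: "\<bar>h \<bullet> b\<bar> \<le> norm h" if "b \<in> Basis" for b using Basis_le_norm[OF that] .
      have "\<bar>f (x + (\<Sum>b\<in>B. (h \<bullet> b) *\<^sub>R b)) - f x - (\<Sum>b\<in>B. q' b * (h \<bullet> b))\<bar>
         \<le> real (card B) * ((1 + 2 * L * real DIM('a)) * \<eta> m * norm h)" if "finite B" "B \<subseteq> Basis" for B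
        using that
      proof (induction B rule: finite_induct)
        case (insert c B)
        define z where "z = x + (\<Sum>b\<in>B. (h \<bullet> b) *\<^sub>R b)"
        have "norm (\<Sum>b\<in>B. (h \<bullet> b) *\<^sub>R b) \<le> (\<Sum>b\<in>B. norm h)"
          using insert.prems by (intro sum_norm_le) (auto simp: hb)
        also have "\<dots> \<le> r" using insert.prems card_mono[of Basis B] by (simp add: r_def mult_right_mono)
        finally have "dist x z \<le> r" by (simp add: z_def dist_norm norm_minus_commute)
        then obtain a where a: "dist z a < \<eta> m * r" "a \<in> A m k q'"
          using d0(2)[OF r] by (auto simp: disjoint_iff)
        have c: "c \<in> Basis" using insert.prems by auto
        have "\<bar>h \<bullet> c\<bar> \<le> 1 / real (Suc k)" using hb[OF c] h by (simp add: \<delta>_def)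
        then have "\<bar>f (a + (h \<bullet> c) *\<^sub>R c) - f a - q' c * (h \<bullet> c)\<bar> \<le> \<eta> m * \<bar>h \<bullet> c\<bar>"
          using a(2) c by (simp add: A_def quotient_near_def)
        also have "\<dots> \<le> \<eta> m * norm h" using hb[OF c] \<eta>(1)[of m] by (intro mult_left_mono) auto
        finally have 1: "\<bar>f (a + (h \<bullet> c) *\<^sub>R c) - f a - q' c * (h \<bullet> c)\<bar> \<le> \<eta> m * norm h" .
        have "L * norm (z - a) \<le> L * (\<eta> m * r)" using a(1) L by (intro mult_left_mono) (auto simp: dist_norm)
        then have 2: "\<bar>f z - f a\<bar> \<le> L * (\<eta> m * r)"
            "\<bar>f (z + (h \<bullet> c) *\<^sub>R c) - f (a + (h \<bullet> c) *\<^sub>R c)\<bar> \<le> L * (\<eta> m * r)"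
          using lip[of z a] lip[of "z + (h \<bullet> c) *\<^sub>R c" "a + (h \<bullet> c) *\<^sub>R c"] by auto
        have 3: "\<bar>f z - f x - (\<Sum>b\<in>B. q' b * (h \<bullet> b))\<bar>
            \<le> real (card B) * ((1 + 2 * L * real DIM('a)) * \<eta> m * norm h)"
          using insert unfolding z_def by simp
        have eq: "x + (\<Sum>b\<in>insert c B. (h \<bullet> b) *\<^sub>R b) = z + (h \<bullet> c) *\<^sub>R c"
          "(\<Sum>b\<in>insert c B. q' b * (h \<bullet> b)) = (\<Sum>b\<in>B. q' b * (h \<bullet> b)) + q' c * (h \<bullet> c)"
          "real (card (insert c B)) = real (card B) + 1"
          using insert.hyps by (auto simp: z_def)
        define E where "E = (1 + 2 * L * real DIM('a)) * \<eta> m * norm h"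
        have E: "\<eta> m * norm h + 2 * (L * (\<eta> m * r)) = E" "(real (card B) + 1) * E = real (card B) * E + E"
          by (simp_all add: r_def E_def algebra_simps)
        show ?case unfolding eq E_def[symmetric] E(2) using 1 2 3[folded E_def] E(1) by linarith
      qed simp
      from this[of Basis] have "\<bar>f (x + (\<Sum>b\<in>Basis. (h \<bullet> b) *\<^sub>R b)) - f x - (\<Sum>b\<in>Basis. q' b * (h \<bullet> b))\<bar>
         \<le> K * \<eta> m * norm h" by (simp add: K_def mult_ac)
      also have "(\<Sum>b\<in>Basis. q' b * (h \<bullet> b)) = v \<bullet> h"
        unfolding v_def inner_sum_left inner_scaleR_left by (simp add: inner_commute)
      also have "K * \<eta> m * norm h \<le> e * norm h" using m by (intro mult_right_mono) auto
      finally show ?thesis by (simp add: euclidean_representation)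
    qed simp
    then show "\<exists>v. \<exists>d>0. \<forall>h. norm h < d \<longrightarrow> \<bar>f (x + h) - f x - v \<bullet> h\<bar> \<le> e * norm h"
      using \<open>\<delta> > 0\<close> by blast
  qed
  ultimately show ?thesis
    by (elim negligible_subset) blast
qed

theorem Rademacher:
  fixes f :: "'a::euclidean_space \<Rightarrow> 'b::euclidean_space"
  assumes lip: "\<And>x y. norm (f x - f y) \<le> L * norm (x - y)"
  shows "negligible {x. \<not> f differentiable (at x)}"
proof -
  have "{x. \<not> f differentiable (at x)} \<subseteq> (\<Union>b\<in>Basis. {x. \<not> (\<lambda>x. f x \<bullet> b) differentiable (at x)})"
    using differentiable_componentwise_within[of f _ UNIV] by auto
  moreover have "negligible {x. \<not> (\<lambda>x. f x \<bullet> b) differentiable (at x)}" if "b \<in> Basis" for b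
  proof (rule Rademacher_real)
    show "\<bar>f x \<bullet> b - f y \<bullet> b\<bar> \<le> L * norm (x - y)" for x y
      using Basis_le_norm[OF that, of "f x - f y"] lip[of x y] by (simp add: inner_diff_left)
  qed
  then have "negligible (\<Union>b\<in>Basis. {x. \<not> (\<lambda>x. f x \<bullet> b) differentiable (at x)})"
    by (intro negligible_Union) auto
  ultimately show ?thesis
    by (rule negligible_subset[rotated])
qed

section \<open>Second-order expansions of convex functions\<close>

lemma zero_if_inner_le_quadratic:
  fixes v :: "'a::real_inner"
  assumes d: "d > 0" and le: "\<And>h. norm h \<le> d \<Longrightarrow> v \<bullet> h \<le> C * (norm h)\<^sup>2"
  shows "v = 0"
proof (rule ccontr)
  assume "v \<noteq> 0"
  define n where "n = norm v"
  have n: "n > 0" using \<open>v \<noteq> 0\<close> by (simp add: n_def)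
  define s where "s = min (d / n) (1 / (2 * (\<bar>C\<bar> + 1)))"
  have s: "s > 0" using d n by (simp add: s_def)
  have "s * n \<le> d" using n by (simp add: s_def min_def field_simps)
  then have "v \<bullet> (s *\<^sub>R v) \<le> C * (norm (s *\<^sub>R v))\<^sup>2"
    using s by (intro le) (simp add: n_def)
  then have "s * n\<^sup>2 \<le> C * (s\<^sup>2 * n\<^sup>2)"
    using s by (simp add: n_def dot_square_norm power_mult_distrib)
  also have "\<dots> \<le> (\<bar>C\<bar> + 1) * (s\<^sup>2 * n\<^sup>2)" by (intro mult_right_mono) auto
  also have "\<dots> = ((\<bar>C\<bar> + 1) * s) * (s * n\<^sup>2)" by (simp add: power2_eq_square)
  also have "\<dots> \<le> 1/2 * (s * n\<^sup>2)"
  proof (intro mult_right_mono)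
    have "s \<le> 1 / (2 * (\<bar>C\<bar> + 1))" by (simp add: s_def)
    then show "(\<bar>C\<bar> + 1) * s \<le> 1/2" by (simp add: field_simps add_pos_nonneg)
  qed (use s in auto)
  finally show False using s n by simp
qed

lemma nonpos_if_le_small_multiples:
  fixes a c :: real
  assumes "\<And>e. e > 0 \<Longrightarrow> a \<le> e * c"
  shows "a \<le> 0"
proof (rule field_le_epsilon)
  fix e :: real assume "e > 0"
  have "a \<le> e / (\<bar>c\<bar> + 1) * c" using \<open>e > 0\<close> by (intro assms) (simp add: add_nonneg_pos)
  also have "\<dots> \<le> e / (\<bar>c\<bar> + 1) * (\<bar>c\<bar> + 1)" using \<open>e > 0\<close> by (intro mult_left_mono) auto
  also have "\<dots> = e" by (simp add: add_nonneg_eq_0_iff)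
  finally show "a \<le> 0 + e" by simp
qed

text \<open>\<open>A\<close> may fail to be symmetric: only its quadratic form enters, and the
  spatial part of that form is symmetrised when it meets the generator.\<close>

definition second_order_expansion ::
  "('a::real_inner \<Rightarrow> real) \<Rightarrow> 'a \<Rightarrow> 'a \<Rightarrow> ('a \<Rightarrow> 'a) \<Rightarrow> bool" where
  "second_order_expansion f x g A \<longleftrightarrow> bounded_linear A \<and> (\<forall>e>0. \<exists>d>0. \<forall>h. norm h < d \<longrightarrow>
     \<bar>f (x + h) - f x - g \<bullet> h - (h \<bullet> A h) / 2\<bar> \<le> e * (norm h)\<^sup>2)"

text \<open>
  A real function with a bounded subgradient everywhere, that is, a Lipschitz convex function
  with a chosen selection of its subdifferential.
\<close>

locale subgradient =
  fixes f :: "'a::euclidean_space \<Rightarrow> real" and G :: "'a \<Rightarrow> 'a" and R :: real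
  assumes sub: "f x + G x \<bullet> (y - x) \<le> f y" and bound: "norm (G x) \<le> R"
begin

lemma lipschitz: "\<bar>f x - f y\<bar> \<le> R * norm (x - y)"
proof -
  have *: "f x - f y \<le> R * norm (x - y)" for x y
  proof -
    have "- (G x \<bullet> (y - x)) \<le> norm (G x) * norm (y - x)"
      using Cauchy_Schwarz_ineq2[of "G x" "y - x"] by linarith
    also have "\<dots> \<le> R * norm (y - x)" by (intro mult_right_mono bound) auto
    finally show ?thesis using sub[of x y] by (simp add: norm_minus_commute)
  qed
  show ?thesis using *[of x y] *[of y x] by (simp add: norm_minus_commute abs_le_iff)
qed

lemma R_nonneg: "R \<ge> 0"
  using norm_ge_zero bound order_trans by blast

lemma continuous: "continuous_on A f"
  using lipschitz R_nonneg
  by (intro lipschitz_on_continuous_on[of R]) (auto simp: lipschitz_on_def dist_norm)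

lemma convex_combination:
  assumes "0 \<le> t" "t \<le> 1"
  shows "f (x + t *\<^sub>R (y - x)) \<le> (1 - t) * f x + t * f y"
proof -
  define m where "m = x + t *\<^sub>R (y - x)"
  have "(1 - t) * (f m + G m \<bullet> (x - m)) + t * (f m + G m \<bullet> (y - m)) \<le> (1 - t) * f x + t * f y"
    using assms sub by (intro add_mono mult_left_mono) auto
  moreover have "(1 - t) * (G m \<bullet> (x - m)) + t * (G m \<bullet> (y - m)) = G m \<bullet> ((1 - t) *\<^sub>R (x - m) + t *\<^sub>R (y - m))"
    by (simp add: inner_add_right)
  moreover have "(1 - t) *\<^sub>R (x - m) + t *\<^sub>R (y - m) = 0"
    by (simp add: m_def algebra_simps)
  moreover have "(1 - t) * (f m + a) + t * (f m + b) = f m + ((1 - t) * a + t * b)" for a b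
    by (simp add: algebra_simps)
  ultimately show ?thesis unfolding m_def[symmetric] by simp
qed

section \<open>The resolvent and the Moreau envelope\<close>

text \<open>This says that \<open>w - x\<close> is a subgradient at \<open>x\<close>:
  \<open>x\<close> is the image of \<open>w\<close> under the inverse of identity plus
  subdifferential, the proximal point of \<open>w\<close>.\<close>

definition resolvent_point :: "'a \<Rightarrow> 'a \<Rightarrow> bool" where
  "resolvent_point w x \<longleftrightarrow> (\<forall>y. f x + (w - x) \<bullet> (y - x) \<le> f y)"

text \<open>The point minimises \<open>f\<close> plus half the squared distance to \<open>w\<close>.
  Outside radius \<open>2 * R\<close> the quadratic term outweighs what a function with Lipschitz
  constant \<open>R\<close> can gain, so a minimum over that ball is global.\<close>

lemma resolvent_point_exists: "\<exists>x. resolvent_point w x"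
proof -
  define \<phi> where "\<phi> = (\<lambda>x. f x + (norm (x - w))\<^sup>2 / 2)"
  have "compact (cball w (2 * R))" "cball w (2 * R) \<noteq> {}" using R_nonneg by auto
  moreover have "continuous_on (cball w (2 * R)) \<phi>"
    unfolding \<phi>_def by (intro continuous_intros continuous) auto
  ultimately obtain x where x: "x \<in> cball w (2 * R)" "\<And>y. y \<in> cball w (2 * R) \<Longrightarrow> \<phi> x \<le> \<phi> y"
    using continuous_attains_inf[of "cball w (2 * R)" \<phi>] by blast
  have min: "\<phi> x \<le> \<phi> y" for y
  proof (cases "y \<in> cball w (2 * R)")
    case False
    then have n: "norm (y - w) > 2 * R" by (simp add: dist_norm norm_minus_commute)
    have "\<phi> x \<le> \<phi> w" using R_nonneg by (intro x) auto
    also have "\<dots> = f w" by (simp add: \<phi>_def)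
    also have "\<dots> \<le> f y + R * norm (y - w)" using lipschitz[of w y] by (simp add: norm_minus_commute)
    also have "R * norm (y - w) \<le> norm (y - w) / 2 * norm (y - w)" using n by (intro mult_right_mono) auto
    also have "f y + norm (y - w) / 2 * norm (y - w) = \<phi> y" by (simp add: \<phi>_def power2_eq_square)
    finally show ?thesis by simp
  qed (use x in auto)
  have "f x + (w - x) \<bullet> (y - x) \<le> f y" for y
  proof -
    \<comment> \<open>The first-order condition without derivatives: minimality is tested at a
      fraction \<open>s\<close> of the way from \<open>x\<close> to \<open>y\<close>, convexity
      brings in \<open>f y\<close>, and the error left after division by \<open>s\<close> vanishes
      with \<open>s\<close>.\<close>
    have *: "f x - f y - (x - w) \<bullet> (y - x) \<le> t * (norm (y - x))\<^sup>2" if "t > 0" for t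
    proof -
      define s where "s = min t 1"
      have s: "0 < s" "s \<le> 1" "s \<le> t" using that by (auto simp: s_def)
      have "\<phi> x \<le> \<phi> (x + s *\<^sub>R (y - x))" by (rule min)
      also have "\<dots> \<le> (1 - s) * f x + s * f y + (norm (x + s *\<^sub>R (y - x) - w))\<^sup>2 / 2"
        unfolding \<phi>_def using s convex_combination[of s x y] by simp
      also have "(norm (x + s *\<^sub>R (y - x) - w))\<^sup>2
          = (norm (x - w))\<^sup>2 + 2 * s * ((x - w) \<bullet> (y - x)) + s * s * (norm (y - x))\<^sup>2"
      proof -
        have "x + s *\<^sub>R (y - x) - w = (x - w) + s *\<^sub>R (y - x)" by simp
        then show ?thesis unfolding power2_norm_eq_inner
          by (simp only: inner_add_left inner_add_right inner_scaleR_left inner_scaleR_right inner_commute[of "y - x" "x - w"]) (simp add: algebra_simps)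
      qed
      finally have "s * (f x - f y - (x - w) \<bullet> (y - x)) \<le> s * (s / 2 * (norm (y - x))\<^sup>2)"
        by (simp add: \<phi>_def algebra_simps) (simp add: field_simps)
      then have "f x - f y - (x - w) \<bullet> (y - x) \<le> s / 2 * (norm (y - x))\<^sup>2"
        using s(1) by (simp add: mult_le_cancel_left)
      also have "\<dots> \<le> t * (norm (y - x))\<^sup>2" using s by (intro mult_right_mono) auto
      finally show ?thesis .
    qed
    have "f x - f y - (x - w) \<bullet> (y - x) \<le> 0"
      by (rule nonpos_if_le_small_multiples) (rule *)
    then show ?thesis by (simp add: inner_diff_left)
  qed
  then show ?thesis unfolding resolvent_point_def by blast
qed

text \<open>The choice is immaterial: by the monotonicity below, \<open>w\<close> has only one
  resolvent point.\<close>

definition J :: "'a \<Rightarrow> 'a" where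
  "J w = (SOME x. resolvent_point w x)"

lemma J: "f (J w) + (w - J w) \<bullet> (y - J w) \<le> f y"
  using someI_ex[OF resolvent_point_exists[of w]] unfolding J_def resolvent_point_def by blast

text \<open>The sum of the two subgradient inequalities. It yields both uniqueness and the Lipschitz
  constant 1.\<close>

lemma resolvent_points_monotone:
  assumes "resolvent_point w x" "resolvent_point w' x'"
  shows "(norm (x - x'))\<^sup>2 \<le> (w - w') \<bullet> (x - x')"
proof -
  have "f x + (w - x) \<bullet> (x' - x) \<le> f x'" "f x' + (w' - x') \<bullet> (x - x') \<le> f x"
    using assms unfolding resolvent_point_def by blast+
  then show ?thesis
    unfolding power2_norm_eq_inner by (simp add: algebra_simps inner_commute)
qed

lemma J_nonexpansive: "norm (J w - J w') \<le> 1 * norm (w - w')"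
proof -
  have "(norm (J w - J w'))\<^sup>2 \<le> (w - w') \<bullet> (J w - J w')"
    by (rule resolvent_points_monotone) (auto simp: resolvent_point_def J)
  also have "\<dots> \<le> norm (w - w') * norm (J w - J w')" using norm_cauchy_schwarz by blast
  finally show ?thesis
    by (cases "J w = J w'") (auto simp: power2_eq_square)
qed

lemma J_eq: "J (x + G x) = x"
proof -
  have "(norm (J (x + G x) - x))\<^sup>2 \<le> ((x + G x) - (x + G x)) \<bullet> (J (x + G x) - x)"
    by (rule resolvent_points_monotone) (use sub in \<open>auto simp: resolvent_point_def J\<close>)
  then show ?thesis by simp
qed

text \<open>The Moreau envelope. Its gradient is \<open>w - J w\<close> everywhere, so that
  differentiability of \<open>J\<close> becomes second-order differentiability of the
  envelope.\<close>

definition envelope :: "'a \<Rightarrow> real" where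
  "envelope w = f (J w) + (norm (J w - w))\<^sup>2 / 2"

text \<open>\<open>J w\<close> is a competitor in the minimisation solved by
  \<open>J w'\<close>.\<close>

lemma envelope_le: "envelope w' \<le> envelope w + (w - J w) \<bullet> (w' - w) + (norm (w' - w))\<^sup>2 / 2"
proof -
  define a b where "a = J w" and "b = J w'"
  have "f b + (w' - b) \<bullet> (a - b) \<le> f a" unfolding b_def by (rule J)
  moreover have "0 \<le> (a - b) \<bullet> (a - b)" by simp
  ultimately show ?thesis
    unfolding envelope_def a_def[symmetric] b_def[symmetric] power2_norm_eq_inner
    by (simp add: algebra_simps inner_commute) (simp add: field_simps)
qed

lemma envelope_diff:
  "\<bar>envelope w' - envelope w - (w - J w) \<bullet> (w' - w)\<bar> \<le> (norm (w' - w))\<^sup>2"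
proof -
  have "envelope w \<le> envelope w' + (w' - J w') \<bullet> (w - w') + (norm (w - w'))\<^sup>2 / 2" by (rule envelope_le)
  moreover have "(J w' - J w) \<bullet> (w' - w) \<le> (norm (w' - w))\<^sup>2"
  proof -
    have "(J w' - J w) \<bullet> (w' - w) \<le> norm (J w' - J w) * norm (w' - w)" by (rule norm_cauchy_schwarz)
    also have "\<dots> \<le> norm (w' - w) * norm (w' - w)" using J_nonexpansive[of w' w] by (intro mult_right_mono) auto
    finally show ?thesis by (simp add: power2_eq_square)
  qed
  moreover have "(w' - J w') \<bullet> (w - w') = - ((w - J w) \<bullet> (w' - w)) - (norm (w' - w))\<^sup>2 + (J w' - J w) \<bullet> (w' - w)"
    unfolding power2_norm_eq_inner by (simp add: algebra_simps inner_commute)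
  moreover have "norm (w - w') = norm (w' - w)" by (rule norm_minus_commute)
  moreover have "(norm (w' - w))\<^sup>2 \<ge> 0" by simp
  ultimately show ?thesis using envelope_le[of w' w] unfolding abs_le_iff by (simp only:) linarith
qed

lemma envelope_has_derivative: "(envelope has_derivative (\<lambda>h. (w - J w) \<bullet> h)) (at w)"
  unfolding has_derivative_at_alt
proof (intro conjI allI impI bounded_linear_inner_right)
  fix e :: real assume "e > 0"
  show "\<exists>d>0. \<forall>y. norm (y - w) < d \<longrightarrow> norm (envelope y - envelope w - (w - J w) \<bullet> (y - w)) \<le> e * norm (y - w)"
  proof (intro exI[of _ e] conjI \<open>e > 0\<close> allI impI)
    fix y assume "norm (y - w) < e"
    then have "(norm (y - w))\<^sup>2 \<le> e * norm (y - w)"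
      unfolding power2_eq_square by (intro mult_right_mono) auto
    then show "norm (envelope y - envelope w - (w - J w) \<bullet> (y - w)) \<le> e * norm (y - w)"
      using envelope_diff[of y w] by simp
  qed
qed

text \<open>The mean value theorem on the segment from \<open>w\<close> to \<open>w + k\<close>,
  applied to the remainder \<open>\<psi>\<close>: its derivative compares the gradient of the
  envelope with its linearisation, which is what differentiability of \<open>J\<close> at
  \<open>w\<close> controls.\<close>

lemma envelope_Taylor:
  assumes B: "(J has_derivative B) (at w)" and "\<eta> > 0"
  shows "\<exists>d>0. \<forall>k. norm k < d \<longrightarrow>
    \<bar>envelope (w + k) - envelope w - (w - J w) \<bullet> k - (k \<bullet> (k - B k)) / 2\<bar> \<le> \<eta> * (norm k)\<^sup>2"
proof -
  obtain d where d: "d > 0" "\<And>y. norm (y - w) < d \<Longrightarrow> norm (J y - J w - B (y - w)) \<le> \<eta> * norm (y - w)"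
    using B \<open>\<eta> > 0\<close> unfolding has_derivative_at_alt by blast
  have linB: "bounded_linear B" using B has_derivative_bounded_linear by blast
  have "\<bar>envelope (w + k) - envelope w - (w - J w) \<bullet> k - (k \<bullet> (k - B k)) / 2\<bar> \<le> \<eta> * (norm k)\<^sup>2"
    if k: "norm k < d" for k
  proof -
    define \<psi> where "\<psi> = (\<lambda>t. envelope (w + t *\<^sub>R k) - t * ((w - J w) \<bullet> k) - t\<^sup>2 / 2 * (k \<bullet> (k - B k)))"
    define \<psi>' where "\<psi>' = (\<lambda>t. (w + t *\<^sub>R k - J (w + t *\<^sub>R k)) \<bullet> k - (w - J w) \<bullet> k - t * (k \<bullet> (k - B k)))"
    have der: "(\<psi> has_real_derivative \<psi>' t) (at t)" for t
    proof -
      have "((\<lambda>t. envelope (w + t *\<^sub>R k)) has_derivative (\<lambda>h. (w + t *\<^sub>R k - J (w + t *\<^sub>R k)) \<bullet> (h *\<^sub>R k))) (at t)"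
        by (rule has_derivative_compose[OF _ envelope_has_derivative]) (auto intro!: derivative_eq_intros)
      then have "((\<lambda>t. envelope (w + t *\<^sub>R k)) has_real_derivative (w + t *\<^sub>R k - J (w + t *\<^sub>R k)) \<bullet> k) (at t)"
        by (simp add: has_field_derivative_def mult.commute[of _ "_ \<bullet> _"])
      then show ?thesis unfolding \<psi>_def \<psi>'_def
        by (auto intro!: derivative_eq_intros)
    qed
    obtain t where t: "0 < t" "t < 1" "\<psi> 1 - \<psi> 0 = (1 - 0) * \<psi>' t"
      using MVT2[of 0 1 \<psi> \<psi>'] der by auto
    have Bt: "B (t *\<^sub>R k) = t *\<^sub>R B k" using linear_scale[OF bounded_linear.linear[OF linB]] .
    have "\<psi>' t = - ((J (w + t *\<^sub>R k) - J w - B (t *\<^sub>R k)) \<bullet> k)"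
      unfolding Bt \<psi>'_def by (simp add: algebra_simps inner_commute)
    then have "\<bar>\<psi>' t\<bar> \<le> norm (J (w + t *\<^sub>R k) - J w - B (t *\<^sub>R k)) * norm k"
      using Cauchy_Schwarz_ineq2 by (metis abs_minus_cancel)
    also have "\<dots> \<le> (\<eta> * norm k) * norm k"
    proof (intro mult_right_mono)
      have tk: "norm (t *\<^sub>R k) \<le> norm k" using t by (simp add: mult_left_le_one_le)
      then have "norm (J (w + t *\<^sub>R k) - J w - B (t *\<^sub>R k)) \<le> \<eta> * norm (t *\<^sub>R k)"
        using d(2)[of "w + t *\<^sub>R k"] k by simp
      also have "\<dots> \<le> \<eta> * norm k" using tk \<open>\<eta> > 0\<close> by (intro mult_left_mono) auto
      finally show "norm (J (w + t *\<^sub>R k) - J w - B (t *\<^sub>R k)) \<le> \<eta> * norm k" .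
    qed auto
    also have "\<dots> = \<eta> * (norm k)\<^sup>2" by (simp add: power2_eq_square)
    finally show ?thesis using t(3) by (simp add: \<psi>_def)
  qed
  then show ?thesis using d(1) by blast
qed

section \<open>Alexandrov expansions under a touching paraboloid\<close>

text \<open>If the subgradients at \<open>x\<close> and \<open>x + h\<close> differed by too large a
  \<open>v\<close>, then from \<open>x + h\<close> the function would rise in the direction of
  \<open>v\<close> above the paraboloid at \<open>x\<close>. The test step \<open>k\<close> along
  \<open>v\<close> has the length of \<open>h\<close>; hence
  \<open>norm (h + k) \<le> 2 * norm h\<close> and the factor 4.\<close>

lemma subgradient_diff_le:
  assumes C: "\<And>h. norm h \<le> r \<Longrightarrow> f (x + h) \<le> f x + G x \<bullet> h + C * (norm h)\<^sup>2" and "C \<ge> 0"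
    and h: "norm h \<le> r / 2"
  shows "norm (G (x + h) - G x) \<le> 4 * C * norm h"
proof (cases "h = 0 \<or> G (x + h) = G x")
  case False
  define v where "v = G (x + h) - G x"
  define k where "k = (norm h / norm v) *\<^sub>R v"
  have nk: "norm k = norm h" and vk: "v \<bullet> k = norm v * norm h"
    using False by (auto simp: k_def v_def dot_square_norm power2_eq_square)
  have nhk: "norm (h + k) \<le> 2 * norm h" using norm_triangle_ineq[of h k] nk by simp
  have "f x + G x \<bullet> h + G (x + h) \<bullet> k \<le> f (x + h) + G (x + h) \<bullet> k" using sub[of x "x + h"] by simp
  also have "\<dots> \<le> f (x + (h + k))" using sub[of "x + h" "x + (h + k)"] by simp
  also have "\<dots> \<le> f x + G x \<bullet> (h + k) + C * (norm (h + k))\<^sup>2" using nhk h by (intro C) simp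
  also have "C * (norm (h + k))\<^sup>2 \<le> C * (2 * norm h)\<^sup>2"
    using nhk \<open>C \<ge> 0\<close> by (intro mult_left_mono power_mono) auto
  finally have "v \<bullet> k \<le> C * (2 * norm h)\<^sup>2"
    by (simp add: v_def algebra_simps)
  then have "norm v * norm h \<le> (4 * C * norm h) * norm h"
    unfolding vk by (simp add: power2_eq_square)
  then show ?thesis using False by (simp add: v_def)
qed (use \<open>C \<ge> 0\<close> in auto)

text \<open>
  Mignot's argument for Alexandrov's theorem.  At a point where \<open>f\<close> lies below a paraboloid the
  inverse \<open>x \<mapsto> x + G x\<close> of the resolvent is Lipschitz, so that the derivative of the resolvent
  is invertible there; no Sard type result is needed.
\<close>

lemma second_order_Taylor:
  assumes C: "\<And>h. norm h \<le> r \<Longrightarrow> f (x + h) \<le> f x + G x \<bullet> h + C * (norm h)\<^sup>2" and C0: "C \<ge> 0" and r: "r > 0"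
    and B: "(J has_derivative B) (at (x + G x))"
  shows "\<exists>A. second_order_expansion f x (G x) A"
proof -
  define g w M where "g = G x" and "w = x + g" and "M = 1 + 4 * C"
  have M: "M \<ge> 1" using C0 by (simp add: M_def)
  \<comment> \<open>\<open>k h\<close> is the increment of \<open>x + G x\<close>, a right inverse
    of \<open>J\<close>, so that \<open>J\<close> maps \<open>w + k h\<close> to
    \<open>x + h\<close>. Differentiability of \<open>J\<close> then says that
    \<open>B (k h)\<close> equals \<open>h\<close> up to smaller order.\<close>
  define k where "k = (\<lambda>h. h + G (x + h) - g)"
  have Jw: "J w = x" unfolding w_def g_def by (rule J_eq)
  have Jk: "J (w + k h) = x + h" for h
    using J_eq[of "x + h"] by (simp add: w_def k_def algebra_simps)
  have nk: "norm (k h) \<le> M * norm h" if "norm h \<le> r / 2" for h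
  proof -
    have "norm (k h) \<le> norm h + norm (G (x + h) - g)"
      unfolding k_def using norm_triangle_ineq[of h "G (x + h) - g"] by (simp add: algebra_simps)
    also have "norm (G (x + h) - g) \<le> 4 * C * norm h"
      unfolding g_def by (rule subgradient_diff_le[OF C C0 that])
    finally show ?thesis by (simp add: M_def algebra_simps)
  qed
  have linB: "bounded_linear B" using B has_derivative_bounded_linear by blast
  interpret B: bounded_linear B by fact
  have near: "\<exists>d>0. \<forall>h. norm h < d \<longrightarrow> norm (k h) < d' \<and> norm (h - B (k h)) \<le> e * norm h"
    if "e > 0" "d' > 0" for e d'
  proof -
    have eM: "e / M > 0" using that M by simp
    then obtain d where d: "d > 0" "\<And>y. norm (y - w) < d \<Longrightarrow> norm (J y - J w - B (y - w)) \<le> e / M * norm (y - w)"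
      using B unfolding has_derivative_at_alt w_def g_def by blast
    define d2 where "d2 = min (r / 2) (min d d' / M)"
    have "d2 > 0" using d that r M by (simp add: d2_def)
    moreover have "norm (k h) < d' \<and> norm (h - B (k h)) \<le> e * norm h" if h: "norm h < d2" for h
    proof -
      have 1: "norm (k h) \<le> M * norm h" using h by (intro nk) (simp add: d2_def)
      have 2: "M * norm h < min d d'" using h M by (auto simp: d2_def field_simps)
      have "norm (J (w + k h) - J w - B (k h)) \<le> e / M * norm (k h)"
        using d(2)[of "w + k h"] 1 2 by simp
      also have "\<dots> \<le> e / M * (M * norm h)" using 1 eM by (intro mult_left_mono) auto
      finally have "norm (h - B (k h)) \<le> e * norm h" using M by (simp add: Jk Jw)
      then show ?thesis using 1 2 by simp
    qed
    ultimately show ?thesis by blast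
  qed
  \<comment> \<open>A small vector \<open>h\<close> orthogonal to the range of \<open>B\<close>
    would be orthogonal to \<open>B (k h)\<close>, although that vector is within
    \<open>norm h / 2\<close> of \<open>h\<close>.\<close>
  have surjB: "surj B"
  proof (rule ccontr)
    assume "\<not> surj B"
    then have "span (range B) \<noteq> UNIV"
      using linear_subspace_image[OF B.linear subspace_UNIV] by (metis span_eq_iff)
    then obtain n where n: "n \<noteq> 0" "\<And>y. y \<in> span (range B) \<Longrightarrow> orthogonal n y"
      using orthogonal_to_subspace_exists_gen[of "range B" UNIV] by (metis psubsetI span_UNIV subset_UNIV)
    obtain d where d: "d > 0" "\<And>h. norm h < d \<Longrightarrow> norm (h - B (k h)) \<le> 1/2 * norm h"
      using near[of "1/2" 1] by auto
    define h where "h = (d / (2 * norm n)) *\<^sub>R n"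
    have h: "norm h < d" "h \<noteq> 0" using n(1) d(1) by (auto simp: h_def)
    have "orthogonal n (B (k h))" using n(2)[of "B (k h)"] by (simp add: span_base)
    then have "orthogonal h (B (k h))" unfolding orthogonal_def by (subst h_def) simp
    then have "h \<bullet> (h - B (k h)) = (norm h)\<^sup>2"
      by (simp add: inner_diff_right orthogonal_def power2_norm_eq_inner)
    moreover have "h \<bullet> (h - B (k h)) \<le> norm h * norm (h - B (k h))" by (rule norm_cauchy_schwarz)
    moreover have "norm h * norm (h - B (k h)) \<le> norm h * (1/2 * norm h)"
      using d(2)[OF h(1)] by (intro mult_left_mono) auto
    ultimately have "(norm h)\<^sup>2 \<le> 1/2 * (norm h)\<^sup>2" by (simp add: power2_eq_square)
    then show False using h(2) by simp
  qed
  obtain S where S: "linear S" "\<And>x. S (B x) = x" "\<And>x. B (S x) = x"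
    using linear_surjective_isomorphism[OF B.linear surjB] by metis
  then have blS: "bounded_linear S" using linear_conv_bounded_linear by blast
  interpret S: bounded_linear S by fact
  obtain K where K: "K > 0" "\<And>x. norm (S x) \<le> norm x * K"
    using S.pos_bounded by blast
  \<comment> \<open>The subdifferential is the inverse of the resolvent minus the identity, so its
    derivative has to be the inverse \<open>S\<close> of \<open>B\<close> minus the
    identity.\<close>
  define A where "A = (\<lambda>h. S h - h)"
  have "bounded_linear A" unfolding A_def by (intro bounded_linear_sub blS bounded_linear_ident)
  moreover have "\<exists>d>0. \<forall>h. norm h < d \<longrightarrow>
           \<bar>f (x + h) - f x - G x \<bullet> h - (h \<bullet> A h) / 2\<bar> \<le> e * (norm h)\<^sup>2" if "e > 0" for e
  proof -
    define e1 where "e1 = min 1 (e / (4 * K))"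
    define e2 where "e2 = e / (2 * M\<^sup>2)"
    have e1: "e1 > 0" "e1 \<le> 1" "K * e1 \<le> e / 4" using \<open>e > 0\<close> K(1) by (auto simp: e1_def min_def field_simps)
    have e2: "e2 > 0" "e2 * M\<^sup>2 = e / 2" using \<open>e > 0\<close> M by (auto simp: e2_def)
    obtain d2 where d2: "d2 > 0" "\<And>k. norm k < d2 \<Longrightarrow>
        \<bar>envelope (w + k) - envelope w - (w - J w) \<bullet> k - (k \<bullet> (k - B k)) / 2\<bar> \<le> e2 * (norm k)\<^sup>2"
      using envelope_Taylor[OF B e2(1)] unfolding w_def g_def by blast
    obtain d1 where d1: "d1 > 0" "\<And>h. norm h < d1 \<Longrightarrow> norm (k h) < d2" "\<And>h. norm h < d1 \<Longrightarrow> norm (h - B (k h)) \<le> e1 * norm h"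
      using near[OF e1(1) d2(1)] by auto
    have "\<bar>f (x + h) - f x - G x \<bullet> h - (h \<bullet> A h) / 2\<bar> \<le> e * (norm h)\<^sup>2" if h: "norm h < min d1 (r / 2)" for h
    proof -
      define l b c where "l = k h" and "b = B (k h) - h" and "c = S b"
      have l: "l = S h + c" by (simp add: l_def c_def b_def S.diff S(2))
      have Bl: "B l = h + b" by (simp add: l_def b_def)
      have nb: "norm b \<le> e1 * norm h" using d1(3)[of h] h by (simp add: b_def norm_minus_commute)
      have nl: "norm l \<le> M * norm h" unfolding l_def using h by (intro nk) auto
      have nc: "norm c \<le> K * norm b" using K(2)[of b] by (simp add: c_def mult.commute)
      have nSh: "norm (S h) \<le> K * norm h" using K(2)[of h] by (simp add: mult.commute)
      have E: "\<bar>envelope (w + l) - envelope w - g \<bullet> l - (l \<bullet> (l - B l)) / 2\<bar> \<le> e2 * (norm l)\<^sup>2"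
        using d2(2)[of l] d1(2)[of h] h unfolding Jw by (simp add: l_def w_def)
      have ew: "envelope w = f x + (g \<bullet> g) / 2"
        unfolding envelope_def Jw by (simp add: w_def power2_norm_eq_inner)
      have ewl: "envelope (w + l) = f (x + h) + ((h - l - g) \<bullet> (h - l - g)) / 2"
        unfolding envelope_def l_def Jk by (simp add: w_def power2_norm_eq_inner algebra_simps)
      \<comment> \<open>The expansion of the envelope at \<open>w + l\<close> is rewritten at
        \<open>x + h\<close>. In an exactly linear situation \<open>l\<close> would be
        \<open>S h\<close>; the corrections \<open>b\<close> and \<open>c = S b\<close> are of
        smaller order than \<open>h\<close>, so the second bracket is of smaller order than its
        square.\<close>
      have id: "f (x + h) - f x - g \<bullet> h - (h \<bullet> A h) / 2
          = (envelope (w + l) - envelope w - g \<bullet> l - (l \<bullet> (l - B l)) / 2)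
             + (h \<bullet> c - S h \<bullet> b - c \<bullet> b) / 2"
        unfolding ew ewl A_def Bl
        by (simp add: l algebra_simps inner_commute) (simp add: field_simps)
      have "\<bar>h \<bullet> c\<bar> \<le> norm h * norm c" by (rule Cauchy_Schwarz_ineq2)
      also have "\<dots> \<le> norm h * (K * norm b)" by (intro mult_left_mono nc) auto
      finally have 1: "\<bar>h \<bullet> c\<bar> \<le> norm h * (K * norm b)" .
      have "\<bar>S h \<bullet> b\<bar> \<le> norm (S h) * norm b" by (rule Cauchy_Schwarz_ineq2)
      also have "\<dots> \<le> (K * norm h) * norm b" by (intro mult_right_mono nSh) auto
      finally have 2: "\<bar>S h \<bullet> b\<bar> \<le> norm h * (K * norm b)" by (simp add: mult_ac)
      have nbh: "norm b \<le> norm h" using nb e1(2) mult_right_mono[of e1 1 "norm h"] by simp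
      have "\<bar>c \<bullet> b\<bar> \<le> norm c * norm b" by (rule Cauchy_Schwarz_ineq2)
      also have "\<dots> \<le> (K * norm b) * norm h" by (intro mult_mono nc nbh) (use K in auto)
      finally have 3: "\<bar>c \<bullet> b\<bar> \<le> norm h * (K * norm b)" by (simp add: mult_ac)
      have "norm h * (K * norm b) \<le> norm h * (K * (e1 * norm h))"
        using nb K(1) by (intro mult_left_mono) auto
      also have "\<dots> = (K * e1) * (norm h)\<^sup>2" by (simp add: power2_eq_square)
      also have "\<dots> \<le> e / 4 * (norm h)\<^sup>2" by (intro mult_right_mono e1) auto
      finally have 4: "norm h * (K * norm b) \<le> e / 4 * (norm h)\<^sup>2" .
      have "e2 * (norm l)\<^sup>2 \<le> e2 * (M * norm h)\<^sup>2"
        using e2(1) nl by (intro mult_left_mono power_mono) auto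
      also have "\<dots> = (e2 * M\<^sup>2) * (norm h)\<^sup>2" by (simp add: power_mult_distrib)
      finally have 5: "e2 * (norm l)\<^sup>2 \<le> e / 2 * (norm h)\<^sup>2" unfolding e2(2) .
      have "0 \<le> e * (norm h)\<^sup>2" using \<open>e > 0\<close> by simp
      then show ?thesis unfolding g_def[symmetric] id using E 1 2 3 4 5 unfolding abs_le_iff
        by (simp add: field_simps)
    qed
    then show ?thesis using d1(1) r by (intro exI[of _ "min d1 (r / 2)"]) auto
  qed
  ultimately show ?thesis unfolding second_order_expansion_def by blast
qed

text \<open>The bad points of \<open>J\<close> are moved from the \<open>w\<close> side to the
  \<open>x\<close> side. The Lipschitz map \<open>J\<close> keeps them negligible, and since
  \<open>J (x + G x) = x\<close>, a point \<open>x\<close> outside this set has \<open>J\<close>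
  differentiable at \<open>x + G x\<close>.\<close>

definition exceptional :: "'a set" where
  "exceptional = J ` {w. \<not> J differentiable (at w)}"

lemma negligible_exceptional: "negligible exceptional"
  unfolding exceptional_def
proof (rule negligible_locally_Lipschitz_image)
  show "negligible {w. \<not> J differentiable (at w)}"
    by (rule Rademacher) (rule J_nonexpansive)
  show "\<exists>T B. open T \<and> x \<in> T \<and> (\<forall>y\<in>{w. \<not> J differentiable (at w)} \<inter> T. norm (J y - J x) \<le> B * norm (y - x))" for x
    using J_nonexpansive by (intro exI[of _ UNIV] exI[of _ 1]) auto
qed auto

lemma Alexandrov_Taylor:
  assumes "x \<notin> exceptional" "C \<ge> 0" "r > 0"
    and "\<And>h. norm h \<le> r \<Longrightarrow> f (x + h) \<le> f x + G x \<bullet> h + C * (norm h)\<^sup>2"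
  shows "\<exists>A. second_order_expansion f x (G x) A"
proof -
  have "J differentiable (at (x + G x))"
  proof (rule ccontr)
    assume "\<not> J differentiable (at (x + G x))"
    then have "J (x + G x) \<in> exceptional" unfolding exceptional_def by blast
    then show False using assms(1) by (simp add: J_eq)
  qed
  then show ?thesis
    unfolding differentiable_def using second_order_Taylor[OF assms(4,2,3)] by blast
qed

end

section \<open>The theorem on sums\<close>

lemma inner_bounded_linear_scale:
  assumes "bounded_linear A"
  shows "(t *\<^sub>R h) \<bullet> A (t *\<^sub>R h) = t\<^sup>2 * (h \<bullet> A h)"
  using linear_scale[OF bounded_linear.linear[OF assms]] by (simp add: power2_eq_square)

text \<open>Both sides are homogeneous of degree two, so the estimate for small \<open>h\<close>
  extends to all \<open>h\<close> before \<open>e\<close> tends to zero.\<close>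

lemma quadratic_form_nonneg:
  assumes A: "bounded_linear A"
    and le: "\<And>e. e > 0 \<Longrightarrow> \<exists>d>0. \<forall>h. norm h < d \<longrightarrow> - (e * (norm h)\<^sup>2) \<le> h \<bullet> A h"
  shows "0 \<le> h \<bullet> A h"
proof -
  have "- (h \<bullet> A h) \<le> e * (norm h)\<^sup>2" if e: "e > 0" for e
  proof -
    obtain d where d: "d > 0" "\<And>h. norm h < d \<Longrightarrow> - (e * (norm h)\<^sup>2) \<le> h \<bullet> A h"
      using le[OF e] by blast
    define t where "t = d / (norm h + 1)"
    have t: "t > 0" using d by (simp add: t_def add_nonneg_pos)
    have "norm (t *\<^sub>R h) < d"
    proof -
      have "norm h + 1 > 0" by (simp add: add_nonneg_pos)
      then have "t * (norm h + 1) = d" by (simp add: t_def)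
      moreover have "t * norm h < t * (norm h + 1)" using t by simp
      ultimately show ?thesis using t by simp
    qed
    from d(2)[OF this] have "- (e * (t\<^sup>2 * (norm h)\<^sup>2)) \<le> t\<^sup>2 * (h \<bullet> A h)"
      unfolding inner_bounded_linear_scale[OF A] by (simp add: power_mult_distrib)
    then have "t\<^sup>2 * (- (h \<bullet> A h)) \<le> t\<^sup>2 * (e * (norm h)\<^sup>2)" by (simp add: algebra_simps)
    then show ?thesis using t by (subst (asm) mult_le_cancel_left_pos) auto
  qed
  then have "- (h \<bullet> A h) \<le> 0" by (rule nonpos_if_le_small_multiples)
  then show ?thesis by simp
qed

text \<open>
  Jensen's lemma: the slopes of a semiconvex function at its contact points with affine functions
  fill a ball, although the slope is a locally Lipschitz function of the contact point.  Hence the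
  contact points cannot all lie in the negligible set where Alexandrov's theorem fails.
\<close>

lemma Jensen_second_order:
  fixes f1 f2 :: "'a::euclidean_space \<Rightarrow> real"
  assumes f1: "subgradient f1 G1 R1" and f2: "subgradient f2 G2 R2"
    and H: "bounded_linear H" "\<And>x y. x \<bullet> H y = H x \<bullet> y"
    and \<rho>: "\<rho> > 0" and s: "s > 0"
    and U: "\<And>z. norm z = \<rho> \<Longrightarrow> f1 z + f2 z - p \<bullet> z - z \<bullet> H z < f1 0 + f2 0"
  shows "\<exists>z A1 A2. norm z < \<rho> \<and> norm (G1 z + G2 z - p - 2 *\<^sub>R H z) < s \<and>
           second_order_expansion f1 z (G1 z) A1 \<and> second_order_expansion f2 z (G2 z) A2 \<and>
           (\<forall>h. (h \<bullet> A1 h + h \<bullet> A2 h) / 2 \<le> h \<bullet> H h)"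
proof -
  interpret f1: subgradient f1 G1 R1 by fact
  interpret f2: subgradient f2 G2 R2 by fact
  interpret H: bounded_linear H by fact
  define V where "V = (\<lambda>z. f1 z + f2 z - p \<bullet> z - z \<bullet> H z)"
  define g where "g = (\<lambda>z. G1 z + G2 z - p - 2 *\<^sub>R H z)"
  have contV: "continuous_on S V" for S
    unfolding V_def by (intro continuous_intros f1.continuous f2.continuous H.continuous_on)
  have V0: "V 0 = f1 0 + f2 0" by (simp add: V_def H.zero)
  have Hadd: "(z + h) \<bullet> H (z + h) = z \<bullet> H z + 2 * (H z \<bullet> h) + h \<bullet> H h" for z h
    using H(2)[of h z] by (simp add: H.add algebra_simps inner_commute)
  obtain KH where KH: "KH > 0" "\<And>x. norm (H x) \<le> norm x * KH" using H.pos_bounded by blast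
  have Hle: "h \<bullet> H h \<le> KH * (norm h)\<^sup>2" for h
  proof -
    have "h \<bullet> H h \<le> norm h * norm (H h)" by (rule norm_cauchy_schwarz)
    also have "\<dots> \<le> norm h * (norm h * KH)" by (intro mult_left_mono KH) auto
    finally show ?thesis by (simp add: power2_eq_square mult_ac)
  qed
  have Vsub: "V z + g z \<bullet> h - h \<bullet> H h \<le> V (z + h)" for z h
    using f1.sub[of z "z + h"] f2.sub[of z "z + h"]
    unfolding V_def g_def Hadd by (simp add: algebra_simps inner_commute)
  obtain zm where zm: "norm zm = \<rho>" "\<And>z. norm z = \<rho> \<Longrightarrow> V z \<le> V zm"
  proof -
    have "compact (sphere (0::'a) \<rho>)" "sphere (0::'a) \<rho> \<noteq> {}" using \<rho> by auto
    then obtain x where "x \<in> sphere 0 \<rho>" "\<And>y. y \<in> sphere 0 \<rho> \<Longrightarrow> V y \<le> V x"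
      using continuous_attains_sup[of "sphere 0 \<rho>" V] contV by blast
    then show thesis by (intro that[of x]) auto
  qed
  define \<delta> where "\<delta> = V 0 - V zm"
  have \<delta>: "\<delta> > 0" using U[OF zm(1)] unfolding \<delta>_def V0 by (simp add: V_def)
  \<comment> \<open>\<open>\<delta>\<close> is the gap between the value at the centre and the
    largest value on the sphere. A tilt by a slope below \<open>s'\<close> cannot close it, so the
    maximum of the tilted function stays inside the ball.\<close>
  define s' where "s' = min s (\<delta> / (2 * \<rho>))"
  have s': "s' > 0" "s' \<le> s" "s' * \<rho> < \<delta>" using s \<delta> \<rho> by (auto simp: s'_def min_def field_simps)
  \<comment> \<open>The points at which an affine function of slope \<open>g z\<close> touches
    \<open>V\<close> from above on the ball.\<close>
  define K where "K = {z. norm z < \<rho> \<and> norm (g z) < s' \<and> (\<forall>y. norm y \<le> \<rho> \<longrightarrow> V y - g z \<bullet> y \<le> V z - g z \<bullet> z)}"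
  have contact: "V (z + h) \<le> V z + g z \<bullet> h" if "z \<in> K" "norm (z + h) \<le> \<rho>" for z h
  proof -
    have "V (z + h) - g z \<bullet> (z + h) \<le> V z - g z \<bullet> z" using that unfolding K_def by blast
    then show ?thesis by (simp add: inner_add_right)
  qed
  have onto: "ball 0 s' \<subseteq> g ` K"
  proof
    fix q :: 'a assume "q \<in> ball 0 s'"
    then have q: "norm q < s'" by simp
    have "compact (cball (0::'a) \<rho>)" "cball (0::'a) \<rho> \<noteq> {}" using \<rho> by auto
    moreover have "continuous_on (cball 0 \<rho>) (\<lambda>y. V y - q \<bullet> y)"
      by (intro continuous_intros contV)
    ultimately obtain z where "z \<in> cball 0 \<rho>" "\<And>y. y \<in> cball 0 \<rho> \<Longrightarrow> V y - q \<bullet> y \<le> V z - q \<bullet> z"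
      using continuous_attains_sup[of "cball 0 \<rho>" "\<lambda>y. V y - q \<bullet> y"] by blast
    then have z: "norm z \<le> \<rho>" "\<And>y. norm y \<le> \<rho> \<Longrightarrow> V y - q \<bullet> y \<le> V z - q \<bullet> z" by auto
    have "norm z < \<rho>"
    proof (rule ccontr)
      assume "\<not> norm z < \<rho>"
      then have nz: "norm z = \<rho>" using z by simp
      have "V 0 \<le> V z - q \<bullet> z" using z(2)[of 0] \<rho> by simp
      also have "\<dots> \<le> V zm + norm q * norm z"
        using zm(2)[OF nz] Cauchy_Schwarz_ineq2[of q z] by linarith
      also have "norm q * norm z \<le> s' * \<rho>" using q nz \<rho> s'(1) by (intro mult_mono) auto
      finally show False using s'(3) by (simp add: \<delta>_def)
    qed
    \<comment> \<open>\<open>g z\<close> supports \<open>V\<close> from below up to a quadratic term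
      and \<open>q\<close> touches it from above; a linear function squeezed below a quadratic one
      near zero vanishes.\<close>
    have "g z - q = 0"
    proof (rule zero_if_inner_le_quadratic)
      show "\<rho> - norm z > 0" using \<open>norm z < \<rho>\<close> by simp
      show "(g z - q) \<bullet> h \<le> KH * (norm h)\<^sup>2" if "norm h \<le> \<rho> - norm z" for h
      proof -
        have "norm (z + h) \<le> \<rho>" using norm_triangle_ineq[of z h] that by simp
        then have "V (z + h) - q \<bullet> (z + h) \<le> V z - q \<bullet> z" by (rule z)
        then show ?thesis using Vsub[of z h] Hle[of h] by (simp add: algebra_simps)
      qed
    qed
    then have "g z = q" by simp
    moreover have "z \<in> K" unfolding K_def using \<open>norm z < \<rho>\<close> q z(2) \<open>g z = q\<close> by simp
    ultimately show "q \<in> g ` K" by blast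
  qed
  \<comment> \<open>A paraboloid above the sum gives one above each summand, because the other
    summand lies above its supporting affine function.\<close>
  have up1: "f1 (z + h) \<le> f1 z + G1 z \<bullet> h + KH * (norm h)\<^sup>2"
    and up2: "f2 (z + h) \<le> f2 z + G2 z \<bullet> h + KH * (norm h)\<^sup>2"
    if z: "z \<in> K" and h: "norm h \<le> \<rho> - norm z" for z h
  proof -
    have "norm (z + h) \<le> \<rho>" using norm_triangle_ineq[of z h] h by simp
    then have "f1 (z + h) + f2 (z + h) \<le> f1 z + f2 z + G1 z \<bullet> h + G2 z \<bullet> h + h \<bullet> H h"
      using contact[OF z, of h] unfolding V_def g_def Hadd by (simp add: algebra_simps inner_commute)
    then show "f1 (z + h) \<le> f1 z + G1 z \<bullet> h + KH * (norm h)\<^sup>2" "f2 (z + h) \<le> f2 z + G2 z \<bullet> h + KH * (norm h)\<^sup>2"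
      using f1.sub[of z "z + h"] f2.sub[of z "z + h"] Hle[of h] by auto
  qed
  have "\<exists>z\<in>K. z \<notin> f1.exceptional \<union> f2.exceptional"
  proof (rule ccontr)
    assume "\<not> ?thesis"
    then have "K \<subseteq> f1.exceptional \<union> f2.exceptional" by blast
    then have "negligible K"
      by (rule negligible_subset[rotated]) (intro negligible_Un f1.negligible_exceptional f2.negligible_exceptional)
    then have "negligible (g ` K)"
    proof (rule negligible_locally_Lipschitz_image[rotated])
      fix z assume z: "z \<in> K"
      define r where "r = \<rho> - norm z"
      have r: "r > 0" using z by (simp add: r_def K_def)
      have "norm (g y - g z) \<le> (8 * KH + 2 * KH) * norm (y - z)" if y: "y \<in> ball z (r / 2)" for y
      proof -
        define h where "h = y - z"
        have h: "norm h \<le> r / 2" and yz: "y = z + h" using y by (auto simp: h_def dist_norm norm_minus_commute)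
        have 1: "norm (G1 (z + h) - G1 z) \<le> 4 * KH * norm h"
          using up1[OF z] KH(1) h unfolding r_def by (intro f1.subgradient_diff_le[of "\<rho> - norm z"]) auto
        have 2: "norm (G2 (z + h) - G2 z) \<le> 4 * KH * norm h"
          using up2[OF z] KH(1) h unfolding r_def by (intro f2.subgradient_diff_le[of "\<rho> - norm z"]) auto
        have 3: "norm (2 *\<^sub>R H h) \<le> 2 * KH * norm h" using KH(2)[of h] by (simp add: mult.commute)
        have "g y - g z = (G1 (z + h) - G1 z) + (G2 (z + h) - G2 z) - 2 *\<^sub>R H h"
          unfolding g_def yz by (simp add: H.add algebra_simps)
        also have "norm \<dots> \<le> norm (G1 (z + h) - G1 z) + norm (G2 (z + h) - G2 z) + norm (2 *\<^sub>R H h)"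
          by (meson norm_triangle_ineq norm_triangle_ineq4 order_trans add_right_mono)
        also have "\<dots> \<le> 4 * KH * norm h + 4 * KH * norm h + 2 * KH * norm h" by (intro add_mono 1 2 3)
        finally show ?thesis by (simp add: h_def algebra_simps)
      qed
      then show "\<exists>T B. open T \<and> z \<in> T \<and> (\<forall>y\<in>K \<inter> T. norm (g y - g z) \<le> B * norm (y - z))"
        using r by (intro exI[of _ "ball z (r / 2)"] exI[of _ "8 * KH + 2 * KH"]) auto
    qed auto
    then have "negligible (ball (0::'a) s')" using onto negligible_subset by blast
    then show False using s' open_not_negligible[of "ball (0::'a) s'"] by simp
  qed
  then obtain z where z: "z \<in> K" "z \<notin> f1.exceptional" "z \<notin> f2.exceptional" by blast
  have zr: "\<rho> - norm z > 0" "norm (g z) < s'" using z(1) by (auto simp: K_def)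
  obtain A1 where A1: "second_order_expansion f1 z (G1 z) A1"
    using f1.Alexandrov_Taylor[OF z(2) _ zr(1) up1[OF z(1)]] KH(1) by auto
  obtain A2 where A2: "second_order_expansion f2 z (G2 z) A2"
    using f2.Alexandrov_Taylor[OF z(3) _ zr(1) up2[OF z(1)]] KH(1) by auto
  have "(h \<bullet> A1 h + h \<bullet> A2 h) / 2 \<le> h \<bullet> H h" for h
  proof -
    define Q where "Q = (\<lambda>h. 2 *\<^sub>R H h - A1 h - A2 h)"
    have "0 \<le> h \<bullet> Q h"
    proof (rule quadratic_form_nonneg)
      show "bounded_linear Q" unfolding Q_def
        using A1 A2 unfolding second_order_expansion_def
        by (intro bounded_linear_sub bounded_linear_const_scaleR H(1)) auto
      fix e :: real assume e: "e > 0"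
      then have e4: "e / 4 > 0" by simp
      obtain d1 where d1: "d1 > 0" "\<And>h. norm h < d1 \<Longrightarrow> \<bar>f1 (z + h) - f1 z - G1 z \<bullet> h - (h \<bullet> A1 h) / 2\<bar> \<le> e / 4 * (norm h)\<^sup>2"
        using A1 e4 unfolding second_order_expansion_def by blast
      obtain d2 where d2: "d2 > 0" "\<And>h. norm h < d2 \<Longrightarrow> \<bar>f2 (z + h) - f2 z - G2 z \<bullet> h - (h \<bullet> A2 h) / 2\<bar> \<le> e / 4 * (norm h)\<^sup>2"
        using A2 e4 unfolding second_order_expansion_def by blast
      have "- (e * (norm h)\<^sup>2) \<le> h \<bullet> Q h" if h: "norm h < min (min d1 d2) (\<rho> - norm z)" for h
      proof -
        have "norm (z + h) \<le> \<rho>" using norm_triangle_ineq[of z h] h by simp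
        then have "f1 (z + h) + f2 (z + h) \<le> f1 z + f2 z + G1 z \<bullet> h + G2 z \<bullet> h + h \<bullet> H h"
          using contact[OF z(1), of h] unfolding V_def g_def Hadd by (simp add: algebra_simps inner_commute)
        moreover have "f1 z + G1 z \<bullet> h + (h \<bullet> A1 h) / 2 - e / 4 * (norm h)\<^sup>2 \<le> f1 (z + h)"
          using d1(2)[of h] h by linarith
        moreover have "f2 z + G2 z \<bullet> h + (h \<bullet> A2 h) / 2 - e / 4 * (norm h)\<^sup>2 \<le> f2 (z + h)"
          using d2(2)[of h] h by linarith
        moreover have "h \<bullet> Q h = 2 * (h \<bullet> H h) - h \<bullet> A1 h - h \<bullet> A2 h" by (simp add: Q_def inner_diff_right)
        moreover have "e * (norm h)\<^sup>2 = 4 * (e / 4 * (norm h)\<^sup>2)" by simp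
        moreover have "0 \<le> e / 4 * (norm h)\<^sup>2" using e by simp
        ultimately show ?thesis by linarith
      qed
      then show "\<exists>d>0. \<forall>h. norm h < d \<longrightarrow> - (e * (norm h)\<^sup>2) \<le> h \<bullet> Q h"
        using d1 d2 zr by (intro exI[of _ "min (min d1 d2) (\<rho> - norm z)"]) auto
    qed
    then show ?thesis by (simp add: Q_def inner_diff_right)
  qed
  then show ?thesis using z(1) A1 A2 s'(2) unfolding K_def g_def by (intro exI[of _ z] exI[of _ A1] exI[of _ A2]) auto
qed

text \<open>
  The function \<open>f\<close> below is the sup-convolution of \<open>u\<close> with the quadratic form of \<open>D\<close>, plus that form.
\<close>

lemma sup_convolution_subgradient:
  fixes u :: "'a::euclidean_space \<Rightarrow> real"
  assumes C: "compact C" "C \<noteq> {}" and u: "continuous_on C u"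
    and D: "bounded_linear D" "\<And>x y. x \<bullet> D y = D x \<bullet> y"
  obtains f Y R where "\<And>x. Y x \<in> C"
    "\<And>x. f x = u (Y x) - (x - Y x) \<bullet> D (x - Y x) + x \<bullet> D x"
    "\<And>x y. y \<in> C \<Longrightarrow> u y - (x - y) \<bullet> D (x - y) + x \<bullet> D x \<le> f x"
    "subgradient f (\<lambda>x. 2 *\<^sub>R D (Y x)) R"
proof -
  interpret D: bounded_linear D by fact
  \<comment> \<open>The added form of \<open>D\<close> cancels the terms quadratic in
    \<open>x\<close>. For each \<open>y\<close> the competitor is affine in \<open>x\<close> with
    slope \<open>2 *\<^sub>R D y\<close>; hence the maximum is convex, and the slope of a maximiser
    is a subgradient.\<close>
  define k where "k = (\<lambda>x y. u y - y \<bullet> D y + 2 * (D y \<bullet> x))"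
  have k: "u y - (x - y) \<bullet> D (x - y) + x \<bullet> D x = k x y" for x y
    using D(2)[of y x] unfolding k_def by (simp add: D.diff algebra_simps inner_commute)
  have "\<exists>y\<in>C. \<forall>y'\<in>C. k x y' \<le> k x y" for x
  proof (rule continuous_attains_sup[OF C])
    show "continuous_on C (k x)" unfolding k_def by (intro continuous_intros u D.continuous_on)
  qed
  then obtain Y where Y: "\<And>x. Y x \<in> C" "\<And>x y. y \<in> C \<Longrightarrow> k x y \<le> k x (Y x)" by metis
  define f where "f = (\<lambda>x. k x (Y x))"
  obtain B where B: "\<And>y. y \<in> C \<Longrightarrow> norm y \<le> B" using compact_imp_bounded[OF C(1)] bounded_iff by blast
  obtain K where K: "K > 0" "\<And>x. norm (D x) \<le> norm x * K" using D.pos_bounded by blast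
  have "subgradient f (\<lambda>x. 2 *\<^sub>R D (Y x)) (2 * (B * K))"
  proof
    fix x y
    have "f x + (2 *\<^sub>R D (Y x)) \<bullet> (y - x) = k y (Y x)"
      unfolding f_def k_def by (simp add: algebra_simps)
    also have "\<dots> \<le> f y" unfolding f_def by (intro Y)
    finally show "f x + (2 *\<^sub>R D (Y x)) \<bullet> (y - x) \<le> f y" .
    have "norm (D (Y x)) \<le> norm (Y x) * K" by (rule K)
    also have "\<dots> \<le> B * K" using B[OF Y(1)] K(1) by (intro mult_right_mono) auto
    finally show "norm (2 *\<^sub>R D (Y x)) \<le> 2 * (B * K)" by simp
  qed
  then show thesis using Y by (intro that[of Y f]) (auto simp: k f_def)
qed

section \<open>From sup-convolutions back to the original functions\<close>

text \<open>In the language of viscosity solutions, \<open>(g, A)\<close> is a second-order superjet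
  of \<open>f\<close> at \<open>y\<close>. Only this one-sided expansion passes from a
  sup-convolution to the function itself.\<close>

definition upper_expansion ::
  "('a::real_inner \<Rightarrow> real) \<Rightarrow> 'a \<Rightarrow> 'a \<Rightarrow> ('a \<Rightarrow> 'a) \<Rightarrow> bool" where
  "upper_expansion f y g A \<longleftrightarrow> bounded_linear A \<and> (\<forall>e>0. \<exists>d>0. \<forall>h. norm h < d \<longrightarrow>
     f (y + h) \<le> f y + g \<bullet> h + (h \<bullet> A h) / 2 + e * (norm h)\<^sup>2)"

text \<open>Here \<open>y\<close> attains the supremum at \<open>z\<close>. Taking
  \<open>y + h\<close> as competitor at \<open>z + h\<close> leaves the penalty unchanged, so near
  \<open>y\<close> the function \<open>u\<close> lies below a translate of its sup-convolution near
  \<open>z\<close>. The lower bound on the Hessian is the convexity of \<open>f\<close>, with the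
  form of \<open>D\<close> taken off again.\<close>

lemma sup_convolution_expansion:
  fixes u :: "'a::euclidean_space \<Rightarrow> real"
  assumes D: "bounded_linear D" "\<And>x y. x \<bullet> D y = D x \<bullet> y"
    and fY: "f z = u y - (z - y) \<bullet> D (z - y) + z \<bullet> D z"
    and fge: "\<And>x y. norm y \<le> r \<Longrightarrow> u y - (x - y) \<bullet> D (x - y) + x \<bullet> D x \<le> f x"
    and y: "norm y < r" and sub: "\<And>x. f z + g \<bullet> (x - z) \<le> f x"
    and A: "second_order_expansion f z g A"
  shows "upper_expansion u y (g - 2 *\<^sub>R D z) (\<lambda>h. A h - 2 *\<^sub>R D h)"
    and "- (2 * (h \<bullet> D h)) \<le> h \<bullet> (A h - 2 *\<^sub>R D h)"
proof -
  interpret D: bounded_linear D by fact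
  have A': "bounded_linear A" using A by (simp add: second_order_expansion_def)
  show "upper_expansion u y (g - 2 *\<^sub>R D z) (\<lambda>h. A h - 2 *\<^sub>R D h)"
    unfolding upper_expansion_def
  proof (intro conjI bounded_linear_sub A' bounded_linear_const_scaleR D(1) allI impI)
    fix e :: real assume "e > 0"
    then obtain d where d: "d > 0" "\<And>h. norm h < d \<Longrightarrow> \<bar>f (z + h) - f z - g \<bullet> h - (h \<bullet> A h) / 2\<bar> \<le> e * (norm h)\<^sup>2"
      using A unfolding second_order_expansion_def by blast
    have "u (y + h) \<le> u y + (g - 2 *\<^sub>R D z) \<bullet> h + (h \<bullet> (A h - 2 *\<^sub>R D h)) / 2 + e * (norm h)\<^sup>2"
      if h: "norm h < min d (r - norm y)" for h
    proof -
      have "norm (y + h) \<le> r" using norm_triangle_ineq[of y h] h by simp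
      from fge[OF this, of "z + h"]
      have "u (y + h) \<le> f (z + h) + (z - y) \<bullet> D (z - y) - (z + h) \<bullet> D (z + h)" by simp
      moreover have "(z + h) \<bullet> D (z + h) = z \<bullet> D z + 2 * (D z \<bullet> h) + h \<bullet> D h"
        using D(2)[of h z] by (simp add: D.add algebra_simps inner_commute)
      moreover have "(g - 2 *\<^sub>R D z) \<bullet> h = g \<bullet> h - 2 * (D z \<bullet> h)" by (simp add: inner_diff_left)
      moreover have "(h \<bullet> (A h - 2 *\<^sub>R D h)) / 2 = (h \<bullet> A h) / 2 - h \<bullet> D h" by (simp add: inner_diff_right)
      moreover have "f (z + h) - f z - g \<bullet> h - (h \<bullet> A h) / 2 \<le> e * (norm h)\<^sup>2"
        using d(2)[of h] h by (simp add: abs_le_iff)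
      ultimately show ?thesis using fY by linarith
    qed
    then show "\<exists>d>0. \<forall>h. norm h < d \<longrightarrow>
       u (y + h) \<le> u y + (g - 2 *\<^sub>R D z) \<bullet> h + (h \<bullet> (A h - 2 *\<^sub>R D h)) / 2 + e * (norm h)\<^sup>2"
      using d(1) y by (intro exI[of _ "min d (r - norm y)"]) auto
  qed
  have "0 \<le> h \<bullet> A h"
  proof (rule quadratic_form_nonneg)
    show "bounded_linear A" by (rule A')
    fix e :: real assume "e > 0"
    then have "e / 2 > 0" by simp
    then obtain d where d: "d > 0" "\<And>h. norm h < d \<Longrightarrow> \<bar>f (z + h) - f z - g \<bullet> h - (h \<bullet> A h) / 2\<bar> \<le> e / 2 * (norm h)\<^sup>2"
      using A unfolding second_order_expansion_def by blast
    have "- (e * (norm h)\<^sup>2) \<le> h \<bullet> A h" if "norm h < d" for h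
    proof -
      have "f (z + h) - f z - g \<bullet> h - (h \<bullet> A h) / 2 \<le> e / 2 * (norm h)\<^sup>2"
        using d(2)[OF that] by linarith
      moreover have "f z + g \<bullet> h \<le> f (z + h)" using sub[of "z + h"] by simp
      ultimately show ?thesis by (simp add: field_simps)
    qed
    then show "\<exists>d>0. \<forall>h. norm h < d \<longrightarrow> - (e * (norm h)\<^sup>2) \<le> h \<bullet> A h" using d(1) by blast
  qed
  then show "- (2 * (h \<bullet> D h)) \<le> h \<bullet> (A h - 2 *\<^sub>R D h)" by (simp add: inner_diff_right)
qed

definition diag_map :: "real \<Rightarrow> real \<Rightarrow> real \<times> 'b::real_inner \<Rightarrow> real \<times> 'b" where
  "diag_map a b z = (a * fst z, b *\<^sub>R snd z)"

lemma diag_map: "bounded_linear (diag_map a b)" "x \<bullet> diag_map a b y = diag_map a b x \<bullet> y"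
  "z \<bullet> diag_map a b z = a * (fst z)\<^sup>2 + b * (norm (snd z))\<^sup>2"
proof -
  show "bounded_linear (diag_map a b)" unfolding diag_map_def
    by (intro bounded_linear_Pair bounded_linear_const_mult bounded_linear_const_scaleR
        bounded_linear_fst bounded_linear_snd)
qed (auto simp: diag_map_def inner_prod_def power2_eq_square dot_square_norm)

lemma norm_snd_le_norm: "norm (snd z) \<le> norm z"
  by (metis norm_snd_le prod.collapse)

lemma norm_diag_map_le:
  assumes "a \<ge> 0" "b \<ge> 0"
  shows "norm (diag_map a b z) \<le> (a + b) * norm z"
proof -
  have "norm (diag_map a b z) \<le> norm (a * fst z) + norm (b *\<^sub>R snd z)"
    unfolding diag_map_def by (rule norm_Pair_le)
  also have "\<dots> = a * \<bar>fst z\<bar> + b * norm (snd z)" using assms by (simp add: abs_mult)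
  also have "\<dots> \<le> a * norm z + b * norm z"
    using assms norm_fst_le[of "fst z" "snd z"] norm_snd_le[of "snd z" "fst z"] by (intro add_mono mult_left_mono) auto
  finally show ?thesis by (simp add: algebra_simps)
qed

text \<open>\<open>y1\<close> and \<open>y2\<close> are displacements from the common maximum point.
  The bounds by \<open>K\<close> concern space only, because the time parts depend on how finely
  time is regularised.\<close>

definition touching_pair ::
  "(real \<times> 'b::euclidean_space \<Rightarrow> real) \<Rightarrow> (real \<times> 'b \<Rightarrow> real) \<Rightarrow> real \<Rightarrow> real \<Rightarrow> (real \<times> 'b) \<Rightarrow> real \<Rightarrow> real \<Rightarrow> real \<Rightarrow>
   (real \<times> 'b) \<Rightarrow> (real \<times> 'b) \<Rightarrow> (real \<times> 'b) \<Rightarrow> (real \<times> 'b) \<Rightarrow>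
   (real \<times> 'b \<Rightarrow> real \<times> 'b) \<Rightarrow> (real \<times> 'b \<Rightarrow> real \<times> 'b) \<Rightarrow> bool" where
  "touching_pair u w r \<delta> p \<omega> A K y1 y2 g1 g2 A1 A2 \<longleftrightarrow>
     norm y1 < r \<and> norm y2 < r \<and> \<bar>fst y1 - fst y2\<bar> \<le> \<delta> \<and>
     norm (g1 + g2 - p) \<le> \<omega> \<and> norm (snd g1) \<le> K \<and> norm (snd g2) \<le> K \<and>
     upper_expansion u y1 g1 A1 \<and> upper_expansion w y2 g2 A2 \<and>
     (\<forall>x. - (K * (norm x)\<^sup>2) \<le> (0, x) \<bullet> A1 (0, x)) \<and> (\<forall>x. - (K * (norm x)\<^sup>2) \<le> (0, x) \<bullet> A2 (0, x)) \<and>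
     (\<forall>x. (0, x) \<bullet> A1 (0, x) + (0, x) \<bullet> A2 (0, x) \<le> 2 * A * (norm x)\<^sup>2)"

text \<open>
  A version of the theorem on sums in which the space and the time variable are regularised on
  different scales: the bound \<open>K\<close> on the spatial derivatives does not depend on the distance \<open>\<delta>\<close>
  allowed between the times of the two points.
\<close>

theorem theorem_on_sums:
  fixes u w :: "real \<times> 'b::euclidean_space \<Rightarrow> real"
  assumes r: "r > 0" and cont: "continuous_on (cball 0 r) u" "continuous_on (cball 0 r) w"
    and \<kappa>: "\<kappa> > 0" and MA: "M \<ge> 0" "A \<ge> 0"
    and max: "\<And>z. norm z \<le> r \<Longrightarrow>
      u z + w z \<le> u 0 + w 0 + p \<bullet> z + M * (fst z)\<^sup>2 + A * (norm (snd z))\<^sup>2 - \<kappa> * (norm z)\<^sup>2"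
  shows "\<exists>K>0. \<forall>\<delta>>0. \<forall>\<eta>>0. \<exists>y1 y2 g1 g2 A1 A2.
     touching_pair u w r \<delta> p (\<eta> + 2 * (M + A) * r) A K y1 y2 g1 g2 A1 A2"
proof -
  let ?C = "cball (0::real \<times> 'b) r"
  define \<rho> where "\<rho> = r / 2"
  \<comment> \<open>On the sphere of radius \<open>\<rho>\<close> the maximum is strict by
    \<open>\<kappa> * \<rho>\<^sup>2\<close>; passing to the sup-convolutions may cost
    \<open>2 * \<sigma>\<close>, half of that.\<close>
  define \<sigma> where "\<sigma> = \<kappa> * \<rho>\<^sup>2 / 4"
  have \<rho>: "\<rho> > 0" and \<sigma>: "\<sigma> > 0" using r \<kappa> by (auto simp: \<rho>_def \<sigma>_def)
  have C: "compact ?C" "?C \<noteq> {}" using r by auto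
  have "bounded (u ` ?C)" "bounded (w ` ?C)"
    using C cont by (auto intro!: compact_imp_bounded compact_continuous_image)
  then obtain Bu Bw where "\<And>z. z \<in> ?C \<Longrightarrow> \<bar>u z\<bar> \<le> Bu" "\<And>z. z \<in> ?C \<Longrightarrow> \<bar>w z\<bar> \<le> Bw"
    unfolding bounded_iff by (metis imageI real_norm_def)
  then obtain B where B: "B > 0" "\<And>z. norm z \<le> r \<Longrightarrow> \<bar>u z\<bar> \<le> B" "\<And>z. norm z \<le> r \<Longrightarrow> \<bar>w z\<bar> \<le> B"
    using that[of "max (max Bu Bw) 1"] by (simp add: le_max_iff_disj) 
  have "uniformly_continuous_on ?C u" "uniformly_continuous_on ?C w"
    using C cont by (auto intro: compact_uniformly_continuous)
  then obtain du dw where du: "du > 0" "\<And>x y. x \<in> ?C \<Longrightarrow> y \<in> ?C \<Longrightarrow> dist y x < du \<Longrightarrow> dist (u y) (u x) < \<sigma>"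
    and dw: "dw > 0" "\<And>x y. x \<in> ?C \<Longrightarrow> y \<in> ?C \<Longrightarrow> dist y x < dw \<Longrightarrow> dist (w y) (w x) < \<sigma>"
    using \<sigma> unfolding uniformly_continuous_on_def by metis
  define d0 where "d0 = min (min du dw) (r / 4)"
  have d0: "d0 > 0" using du dw r by (simp add: d0_def)
  \<comment> \<open>Maximality bounds the penalty between \<open>z\<close> and its maximiser by
    \<open>2 * B\<close>, which with this \<open>a\<close> forces them closer than
    \<open>d0\<close>. The constant \<open>K\<close> is built from \<open>a\<close> and
    \<open>r\<close> alone, before \<open>\<delta>\<close> is given.\<close>
  define a where "a = 4 * B / d0\<^sup>2"
  have a: "a > 0" using B d0 by (simp add: a_def)
  define K where "K = 2 * a + 2 * a * r"
  have K: "K > 0" "2 * a \<le> K" "2 * a * r \<le> K" using a r by (auto simp: K_def intro: add_pos_pos)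
  show ?thesis
  proof (intro exI[of _ K] conjI K(1) allI impI)
    fix \<delta> \<eta> :: real assume \<delta>: "\<delta> > 0" and \<eta>: "\<eta> > 0"
    \<comment> \<open>The stronger penalty in time keeps each maximiser within
      \<open>\<delta> / 2\<close> of \<open>z\<close> in time, hence the two within
      \<open>\<delta>\<close> of each other.\<close>
    define b where "b = max a (8 * B / \<delta>\<^sup>2)"
    have b: "b \<ge> a" "b * (\<delta> / 2)\<^sup>2 \<ge> 2 * B"
    proof -
      have "8 * B / \<delta>\<^sup>2 * (\<delta> / 2)\<^sup>2 \<le> b * (\<delta> / 2)\<^sup>2" unfolding b_def by (intro mult_right_mono) auto
      then show "b * (\<delta> / 2)\<^sup>2 \<ge> 2 * B" using \<delta> by (simp add: power_divide)
    qed (simp add: b_def)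
    define D :: "real \<times> 'b \<Rightarrow> real \<times> 'b" where "D = diag_map b a"
    have D: "bounded_linear D" "\<And>x y. x \<bullet> D y = D x \<bullet> y" "\<And>z. z \<bullet> D z = b * (fst z)\<^sup>2 + a * (norm (snd z))\<^sup>2"
      unfolding D_def by (rule diag_map)+
    have qa: "a * (norm z)\<^sup>2 \<le> z \<bullet> D z" for z
    proof -
      have "(norm z)\<^sup>2 = (fst z)\<^sup>2 + (norm (snd z))\<^sup>2"
        by (simp add: norm_prod_def)
      then show ?thesis unfolding D(3) using b(1) by (simp add: algebra_simps mult_right_mono)
    qed
    have qb: "b * (fst z)\<^sup>2 \<le> z \<bullet> D z" for z unfolding D(3) using a by simp
    obtain f1 Y1 R1 where f1: "\<And>x. Y1 x \<in> ?C"
      "\<And>x. f1 x = u (Y1 x) - (x - Y1 x) \<bullet> D (x - Y1 x) + x \<bullet> D x"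
      "\<And>x y. y \<in> ?C \<Longrightarrow> u y - (x - y) \<bullet> D (x - y) + x \<bullet> D x \<le> f1 x"
      "subgradient f1 (\<lambda>x. 2 *\<^sub>R D (Y1 x)) R1"
      by (rule sup_convolution_subgradient[OF C cont(1) D(1,2)]) blast
    obtain f2 Y2 R2 where f2: "\<And>x. Y2 x \<in> ?C"
      "\<And>x. f2 x = w (Y2 x) - (x - Y2 x) \<bullet> D (x - Y2 x) + x \<bullet> D x"
      "\<And>x y. y \<in> ?C \<Longrightarrow> w y - (x - y) \<bullet> D (x - y) + x \<bullet> D x \<le> f2 x"
      "subgradient f2 (\<lambda>x. 2 *\<^sub>R D (Y2 x)) R2"
      by (rule sup_convolution_subgradient[OF C cont(2) D(1,2)]) blast
    have D0: "D 0 = 0" using D(1) by (simp add: bounded_linear.linear linear_0)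
    have close: "norm (z - y) < d0 \<and> \<bar>fst (z - y)\<bar> \<le> \<delta> / 2"
      if y: "norm y \<le> r" and z: "norm z \<le> r" and f: "f z \<le> f y - (z - y) \<bullet> D (z - y)"
        and fB: "\<And>z. norm z \<le> r \<Longrightarrow> \<bar>f z\<bar> \<le> B" for f z y
    proof
      have q: "(z - y) \<bullet> D (z - y) \<le> 2 * B" using f fB[OF z] fB[OF y] by simp
      then have "a * (norm (z - y))\<^sup>2 \<le> 2 * B" using qa[of "z - y"] by linarith
      also have "\<dots> < a * d0\<^sup>2" using B d0 by (simp add: a_def)
      finally have "(norm (z - y))\<^sup>2 < d0\<^sup>2" using a by simp
      then show "norm (z - y) < d0" using d0 by (simp add: power2_less_imp_less)
      have "b * (fst (z - y))\<^sup>2 \<le> b * (\<delta> / 2)\<^sup>2" using qb[of "z - y"] q b(2) by linarith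
      then have "(fst (z - y))\<^sup>2 \<le> (\<delta> / 2)\<^sup>2" using a b(1) by (subst (asm) mult_le_cancel_left_pos) auto
      then show "\<bar>fst (z - y)\<bar> \<le> \<delta> / 2" using \<delta> by (simp add: abs_le_square_iff[symmetric])
    qed
    have near1: "norm (z - Y1 z) < d0 \<and> \<bar>fst (z - Y1 z)\<bar> \<le> \<delta> / 2"
      and near2: "norm (z - Y2 z) < d0 \<and> \<bar>fst (z - Y2 z)\<bar> \<le> \<delta> / 2" if z: "norm z \<le> r" for z
      using close[of "Y1 z" z u] close[of "Y2 z" z w] z B(2,3) f1(1)[of z] f2(1)[of z]
        f1(3)[of z z] f1(2)[of z] f2(3)[of z z] f2(2)[of z] by (simp_all add: D0)
    have Dnn: "0 \<le> z \<bullet> D z" for z using qa[of z] a by (meson order_trans less_imp_le mult_nonneg_nonneg zero_le_power2)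
    define E :: "real \<times> 'b \<Rightarrow> real \<times> 'b" where "E = diag_map M A"
    have E: "bounded_linear E" "\<And>x y. x \<bullet> E y = E x \<bullet> y" "\<And>z. z \<bullet> E z = M * (fst z)\<^sup>2 + A * (norm (snd z))\<^sup>2"
      unfolding E_def by (rule diag_map)+
    \<comment> \<open>\<open>D\<close> occurs twice because \<open>f1\<close> and \<open>f2\<close>
      both contain its form; \<open>E\<close> is the quadratic part of the test function.\<close>
    define H where "H = (\<lambda>z. E z + 2 *\<^sub>R D z)"
    have H: "bounded_linear H" "\<And>x y. x \<bullet> H y = H x \<bullet> y"
      unfolding H_def by (auto intro!: bounded_linear_add E bounded_linear_const_scaleR D simp: inner_add_left inner_add_right E(2) D(2))
    have "f1 z + f2 z - p \<bullet> z - z \<bullet> H z < f1 0 + f2 0" if z: "norm z = \<rho>" for z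
    proof -
      have zr: "norm z \<le> r" using z r by (simp add: \<rho>_def)
      have "dist (Y1 z) z < du" "dist (Y2 z) z < dw"
        using near1[OF zr] near2[OF zr] unfolding d0_def dist_norm by (simp_all add: norm_minus_commute)
      then have "dist (u (Y1 z)) (u z) < \<sigma>" "dist (w (Y2 z)) (w z) < \<sigma>"
        using f1(1)[of z] f2(1)[of z] zr by (auto intro: du(2) dw(2))
      then have 1: "u (Y1 z) < u z + \<sigma>" "w (Y2 z) < w z + \<sigma>" by (auto simp: dist_real_def)
      have "f1 z + f2 z - p \<bullet> z - z \<bullet> H z \<le> u (Y1 z) + w (Y2 z) - p \<bullet> z - z \<bullet> E z"
        unfolding f1(2) f2(2) H_def using Dnn[of "z - Y1 z"] Dnn[of "z - Y2 z"] by (simp add: inner_add_right)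
      also have "\<dots> < u 0 + w 0 - \<kappa> * (norm z)\<^sup>2 + 2 * \<sigma>" using 1 max[OF zr] unfolding E(3) by linarith
      also have "\<dots> < u 0 + w 0" unfolding z using \<sigma> by (simp add: \<sigma>_def)
      also have "\<dots> \<le> f1 0 + f2 0" using f1(3)[of 0 0] f2(3)[of 0 0] r by (simp add: D0)
      finally show ?thesis .
    qed
    then obtain z A1 A2 where z: "norm z < \<rho>"
      and slope: "norm (2 *\<^sub>R D (Y1 z) + 2 *\<^sub>R D (Y2 z) - p - 2 *\<^sub>R H z) < \<eta>"
      and A1: "second_order_expansion f1 z (2 *\<^sub>R D (Y1 z)) A1" and A2: "second_order_expansion f2 z (2 *\<^sub>R D (Y2 z)) A2"
      and A12: "\<And>h. (h \<bullet> A1 h + h \<bullet> A2 h) / 2 \<le> h \<bullet> H h"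
      using Jensen_second_order[OF f1(4) f2(4) H \<rho> \<eta>] by blast
    have zr: "norm z \<le> r" using z r by (simp add: \<rho>_def)
    define g1 where "g1 = 2 *\<^sub>R D (Y1 z) - 2 *\<^sub>R D z"
    define g2 where "g2 = 2 *\<^sub>R D (Y2 z) - 2 *\<^sub>R D z"
    define A1' where "A1' = (\<lambda>h. A1 h - 2 *\<^sub>R D h)"
    define A2' where "A2' = (\<lambda>h. A2 h - 2 *\<^sub>R D h)"
    have point: "norm y < r \<and> norm (snd (2 *\<^sub>R D y - 2 *\<^sub>R D z)) \<le> K" if "norm (z - y) < d0" for y
    proof
      have n: "norm (y - z) < r / 4" using that by (simp add: d0_def norm_minus_commute)
      then show "norm y < r" using z norm_triangle_ineq[of z "y - z"] r by (simp add: \<rho>_def)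
      have "snd (2 *\<^sub>R D y - 2 *\<^sub>R D z) = (2 * a) *\<^sub>R snd (y - z)"
        unfolding D_def diag_map_def by (simp add: algebra_simps)
      then have "norm (snd (2 *\<^sub>R D y - 2 *\<^sub>R D z)) = 2 * a * norm (snd (y - z))" using a by simp
      also have "\<dots> \<le> 2 * a * r" using n a r norm_snd_le_norm[of "y - z"] by (intro mult_left_mono) linarith+
      finally show "norm (snd (2 *\<^sub>R D y - 2 *\<^sub>R D z)) \<le> K" using K(3) by simp
    qed
    have n1: "norm (Y1 z) < r" "norm (snd g1) \<le> K" and n2: "norm (Y2 z) < r" "norm (snd g2) \<le> K"
      unfolding g1_def g2_def using point near1[OF zr] near2[OF zr] by auto
    have time: "\<bar>fst (Y1 z) - fst (Y2 z)\<bar> \<le> \<delta>" using near1[OF zr] near2[OF zr] unfolding fst_diff by linarith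
    have g12: "norm (g1 + g2 - p) \<le> \<eta> + 2 * (M + A) * r"
    proof -
      \<comment> \<open>Jensen's point \<open>z\<close> is near the centre but not at it, so the
        gradient \<open>2 *\<^sub>R E z\<close> of the quadratic part remains; it is the origin of
        the error \<open>2 * (M + A) * r\<close>.\<close>
      have "g1 + g2 - p = (2 *\<^sub>R D (Y1 z) + 2 *\<^sub>R D (Y2 z) - p - 2 *\<^sub>R H z) + 2 *\<^sub>R E z"
        unfolding g1_def g2_def H_def
        by (simp add: algebra_simps) (simp flip: scaleR_left_distrib)
      then have "norm (g1 + g2 - p) \<le> norm (2 *\<^sub>R D (Y1 z) + 2 *\<^sub>R D (Y2 z) - p - 2 *\<^sub>R H z) + norm (2 *\<^sub>R E z)"
        by (metis norm_triangle_ineq)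
      also have "norm (2 *\<^sub>R E z) \<le> 2 * ((M + A) * norm z)" unfolding E_def using norm_diag_map_le[OF MA, of z] by simp
      also have "\<dots> \<le> 2 * ((M + A) * r)" using MA zr by (intro mult_left_mono) auto
      also have "2 * ((M + A) * r) = 2 * (M + A) * r" by simp
      finally show ?thesis using slope by linarith
    qed
    have sub1: "f1 z + (2 *\<^sub>R D (Y1 z)) \<bullet> (x - z) \<le> f1 x" and sub2: "f2 z + (2 *\<^sub>R D (Y2 z)) \<bullet> (x - z) \<le> f2 x" for x
      using subgradient.sub[OF f1(4)] subgradient.sub[OF f2(4)] by auto
    have ge1: "u y - (x - y) \<bullet> D (x - y) + x \<bullet> D x \<le> f1 x" and ge2: "w y - (x - y) \<bullet> D (x - y) + x \<bullet> D x \<le> f2 x"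
      if "norm y \<le> r" for x y using f1(3)[of y x] f2(3)[of y x] that by auto
    note ex1 = sup_convolution_expansion[OF D(1,2) f1(2) ge1 n1(1) sub1 A1, folded g1_def A1'_def]
    note ex2 = sup_convolution_expansion[OF D(1,2) f2(2) ge2 n2(1) sub2 A2, folded g2_def A2'_def]
    have low: "- (K * (norm x)\<^sup>2) \<le> - (2 * ((0, x) \<bullet> D (0, x)))" for x :: 'b
      unfolding D(3) using mult_right_mono[OF K(2), of "(norm x)\<^sup>2"] by simp
    have A12': "(0, x) \<bullet> A1' (0, x) + (0, x) \<bullet> A2' (0, x) \<le> 2 * A * (norm x)\<^sup>2" for x :: 'b
      using A12[of "(0, x)"] unfolding A1'_def A2'_def H_def inner_diff_right inner_add_right E(3)
      by simp
    show "\<exists>y1 y2 g1 g2 A1 A2. touching_pair u w r \<delta> p (\<eta> + 2 * (M + A) * r) A K y1 y2 g1 g2 A1 A2"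
      unfolding touching_pair_def
    proof (intro exI conjI)
      show "norm (Y1 z) < r" "norm (Y2 z) < r" by (rule n1 n2)+
      show "\<bar>fst (Y1 z) - fst (Y2 z)\<bar> \<le> \<delta>" by (rule time)
      show "norm (g1 + g2 - p) \<le> \<eta> + 2 * (M + A) * r" by (rule g12)
      show "norm (snd g1) \<le> K" "norm (snd g2) \<le> K" by (rule n1 n2)+
      show "upper_expansion u (Y1 z) g1 A1'" by (rule ex1(1))
      show "upper_expansion w (Y2 z) g2 A2'" by (rule ex2(1))
      show "\<forall>x. - (K * (norm x)\<^sup>2) \<le> (0, x) \<bullet> A1' (0, x)"
        using order_trans[OF low ex1(2)] unfolding A1'_def by blast
      show "\<forall>x. - (K * (norm x)\<^sup>2) \<le> (0, x) \<bullet> A2' (0, x)"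
        using order_trans[OF low ex2(2)] unfolding A2'_def by blast
      show "\<forall>x. (0, x) \<bullet> A1' (0, x) + (0, x) \<bullet> A2' (0, x) \<le> 2 * A * (norm x)\<^sup>2"
        by (intro allI A12')
    qed
  qed
qed

section \<open>Jets of viscosity solutions on a slab\<close>

lemma touching_pairD:
  assumes "touching_pair u w r \<delta> p \<omega> A K y1 y2 g1 g2 A1 A2"
  shows "norm y1 < r" "norm y2 < r" "\<bar>fst y1 - fst y2\<bar> \<le> \<delta>"
    "norm (g1 + g2 - p) \<le> \<omega>" "norm (snd g1) \<le> K" "norm (snd g2) \<le> K"
    "upper_expansion u y1 g1 A1" "upper_expansion w y2 g2 A2"
    "\<And>x. - (K * (norm x)\<^sup>2) \<le> (0, x) \<bullet> A1 (0, x)" "\<And>x. - (K * (norm x)\<^sup>2) \<le> (0, x) \<bullet> A2 (0, x)"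
    "\<And>x. (0, x) \<bullet> A1 (0, x) + (0, x) \<bullet> A2 (0, x) \<le> 2 * A * (norm x)\<^sup>2"
  using assms unfolding touching_pair_def by blast+

lemma norm_fst_le_norm: "norm (fst z) \<le> norm z"
  by (metis norm_fst_le prod.collapse)

lemma symmetric_mat_inner:
  assumes "symmetric_mat X"
  shows "x \<bullet> (X *v y) = (X *v x) \<bullet> y"
  using assms dot_lmul_matrix[of x X y] transpose_matrix_vector[of X x]
  by (simp add: symmetric_mat_def)

lemma uminus_matrix_vector_mult: "(- X) *v z = - (X *v z)" for X :: "real ^ 'd::finite ^ 'd"
  by (simp add: matrix_vector_mult_def vec_eq_iff sum_negf)

lemma C12_on_quadratic:
  fixes X :: "real ^ 'd::finite ^ 'd"
  assumes X: "symmetric_mat X"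
  shows "C12_on a b
     (\<lambda>s z. c + \<alpha> * (s - t) + p \<bullet> (z - y) + ((z - y) \<bullet> (X *v (z - y))) / 2 + N * (s - t)\<^sup>2)
     (\<lambda>s z. \<alpha> + 2 * N * (s - t)) (\<lambda>s z. p + X *v (z - y)) (\<lambda>s z. X)"
proof -
  have lin: "bounded_linear (\<lambda>h. X *v h)" by (rule matrix_vector_mul_bounded_linear)
  have c1: "continuous_on S (\<lambda>q. X *v (snd q - y))" for S :: "(real \<times> (real ^ 'd)) set"
    by (rule bounded_linear.continuous_on[OF lin]) (intro continuous_intros)
  show ?thesis unfolding C12_on_def
  proof (intro conjI ballI allI)
    fix s z
    show "((\<lambda>s. c + \<alpha> * (s - t) + p \<bullet> (z - y) + ((z - y) \<bullet> (X *v (z - y))) / 2 + N * (s - t)\<^sup>2)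
        has_real_derivative \<alpha> + 2 * N * (s - t)) (at s within {a..<b})"
      by (auto intro!: derivative_eq_intros)
    have dX: "((\<lambda>z. X *v (z - y)) has_derivative (\<lambda>h. X *v h)) (at z)"
      by (rule bounded_linear.has_derivative[OF lin]) (auto intro!: derivative_eq_intros)
    then show "((\<lambda>z. p + X *v (z - y)) has_derivative (\<lambda>h. X *v h)) (at z)"
      by (auto intro!: derivative_eq_intros)
    have "((\<lambda>z. (z - y) \<bullet> (X *v (z - y))) has_derivative
        (\<lambda>h. (z - y) \<bullet> (X *v h) + h \<bullet> (X *v (z - y)))) (at z)"
      by (rule has_derivative_inner[OF _ dX]) (auto intro!: derivative_eq_intros)
    also have "(\<lambda>h. (z - y) \<bullet> (X *v h) + h \<bullet> (X *v (z - y))) = (\<lambda>h. 2 * ((X *v (z - y)) \<bullet> h))"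
      using symmetric_mat_inner[OF X, of "z - y"] by (auto simp: inner_commute)
    finally have dq: "((\<lambda>z. (z - y) \<bullet> (X *v (z - y))) has_derivative (\<lambda>h. 2 * ((X *v (z - y)) \<bullet> h))) (at z)" .
    show "((\<lambda>z. c + \<alpha> * (s - t) + p \<bullet> (z - y) + ((z - y) \<bullet> (X *v (z - y))) / 2 + N * (s - t)\<^sup>2)
        has_derivative (\<lambda>h. (p + X *v (z - y)) \<bullet> h)) (at z)"
      by (rule derivative_eq_intros dq refl | simp add: inner_add_left)+
  next
    let ?S = "{a..<b} \<times> (UNIV :: (real ^ 'd) set)"
    show "continuous_on ?S (\<lambda>(s, z). c + \<alpha> * (s - t) + p \<bullet> (z - y) + ((z - y) \<bullet> (X *v (z - y))) / 2 + N * (s - t)\<^sup>2)"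
      unfolding case_prod_unfold by (intro continuous_intros c1) auto
    show "continuous_on ?S (\<lambda>(s, z). \<alpha> + 2 * N * (s - t))"
      unfolding case_prod_unfold by (intro continuous_intros)
    show "continuous_on ?S (\<lambda>(s, z). p + X *v (z - y))"
      unfolding case_prod_unfold by (intro continuous_intros c1)
    show "continuous_on ?S (\<lambda>(s, z). X)"
      unfolding case_prod_unfold by (intro continuous_intros)
  qed
qed

text \<open>A term quadratic in time has zero time derivative at \<open>t\<close>, so it can be
  added to the test function without changing the inequality.\<close>

lemma subsolution_jet:
  fixes u :: "real \<Rightarrow> real ^ 'd::finite \<Rightarrow> real"
  assumes visc: "viscosity_subsolution a b G u" and t: "t \<in> {a..<b}" and X: "symmetric_mat X" and d: "d > 0"
    and le: "\<And>s z. norm (s - t, z - y) < d \<Longrightarrow> s \<in> {a..<b} \<Longrightarrow>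
      u s z \<le> u t y + \<alpha> * (s - t) + p \<bullet> (z - y) + ((z - y) \<bullet> (X *v (z - y))) / 2 + N * (s - t)\<^sup>2"
  shows "- \<alpha> - G t (u t y) p X \<le> 0"
proof -
  define \<phi> where "\<phi> = (\<lambda>s z. u t y + \<alpha> * (s - t) + p \<bullet> (z - y) + ((z - y) \<bullet> (X *v (z - y))) / 2 + N * (s - t)\<^sup>2)"
  have ev: "\<forall>\<^sub>F (s, z) in at (t, y) within {a..<b} \<times> UNIV. u s z - \<phi> s z \<le> 0"
    unfolding eventually_at
  proof (intro exI[of _ d] conjI d ballI impI)
    fix q assume q: "q \<in> {a..<b} \<times> (UNIV :: (real ^ 'd) set)" "q \<noteq> (t, y) \<and> dist q (t, y) < d"
    obtain s z where sz: "q = (s, z)" by fastforce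
    show "case q of (s, z) \<Rightarrow> u s z - \<phi> s z \<le> 0"
      using le[of s z] q unfolding sz \<phi>_def by (simp add: dist_norm)
  qed
  have "- (\<alpha> + 2 * N * (t - t)) - G t (\<phi> t y) (p + X *v (y - y)) X \<le> 0"
    using visc[unfolded viscosity_subsolution_def, rule_format, OF C12_on_quadratic[OF X, of a b "u t y" \<alpha> t p y N, folded \<phi>_def] t _ ev]
    by (simp add: \<phi>_def)
  then show ?thesis by (simp add: \<phi>_def matrix_vector_mult_0_right)
qed

text \<open>Reduces statements on supersolutions to their counterparts for subsolutions.\<close>

lemma viscosity_supersolution_uminus:
  assumes visc: "viscosity_supersolution a b G v"
  shows "viscosity_subsolution a b (\<lambda>t y p X. - G t (- y) (- p) (- X)) (\<lambda>t y. - v t y)"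
  unfolding viscosity_subsolution_def
proof (intro allI impI ballI)
  fix \<phi> \<phi>t \<phi>x \<phi>xx t y
  assume C: "C12_on a b \<phi> \<phi>t \<phi>x \<phi>xx" and t: "t \<in> {a..<b}" and eq: "- v t y = \<phi> t y"
    and ev: "\<forall>\<^sub>F (s, y') in at (t, y) within {a..<b} \<times> UNIV. - v s y' - \<phi> s y' \<le> 0"
  have "C12_on a b (\<lambda>s z. - \<phi> s z) (\<lambda>s z. - \<phi>t s z) (\<lambda>s z. - \<phi>x s z) (\<lambda>s z. - \<phi>xx s z)"
    unfolding C12_on_def
  proof (intro conjI ballI allI)
    fix s z assume "s \<in> {a..<b}"
    then have d: "((\<lambda>s. \<phi> s z) has_real_derivative \<phi>t s z) (at s within {a..<b})"
      "((\<lambda>z. \<phi> s z) has_derivative (\<lambda>h. \<phi>x s z \<bullet> h)) (at z)"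
      "((\<lambda>z. \<phi>x s z) has_derivative (\<lambda>h. \<phi>xx s z *v h)) (at z)"
      using C unfolding C12_on_def by blast+
    show "((\<lambda>s. - \<phi> s z) has_real_derivative - \<phi>t s z) (at s within {a..<b})"
      using d(1) by (rule DERIV_minus)
    show "((\<lambda>z. - \<phi> s z) has_derivative (\<lambda>h. - \<phi>x s z \<bullet> h)) (at z)"
      unfolding inner_minus_left using d(2) by (rule has_derivative_minus)
    show "((\<lambda>z. - \<phi>x s z) has_derivative (\<lambda>h. - \<phi>xx s z *v h)) (at z)"
      unfolding uminus_matrix_vector_mult using d(3) by (rule has_derivative_minus)
  qed (use C in \<open>auto simp: C12_on_def case_prod_unfold intro: continuous_on_minus\<close>)
  moreover have "\<forall>\<^sub>F (s, y') in at (t, y) within {a..<b} \<times> UNIV. v s y' - (- \<phi> s y') \<ge> 0"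
    using ev by eventually_elim auto
  ultimately have "- (- \<phi>t t y) - G t (- \<phi> t y) (- \<phi>x t y) (- \<phi>xx t y) \<ge> 0"
    using visc[unfolded viscosity_supersolution_def, rule_format,
        of "\<lambda>s z. - \<phi> s z" "\<lambda>s z. - \<phi>t s z" "\<lambda>s z. - \<phi>x s z" "\<lambda>s z. - \<phi>xx s z" t y] t eq by simp
  then show "- \<phi>t t y - - G t (- \<phi> t y) (- \<phi>x t y) (- \<phi>xx t y) \<le> 0" by simp
qed

text \<open>The space block of \<open>A\<close> is replaced by its symmetric part, which has the
  same quadratic form, since the generator is controlled on symmetric matrices only.\<close>

lemma spatial_symmetric_matrix:
  fixes A :: "real \<times> (real ^ 'd::finite) \<Rightarrow> real \<times> (real ^ 'd)"
  assumes A: "bounded_linear A"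
  obtains X where "symmetric_mat X" "\<And>x. x \<bullet> (X *v x) = (0, x) \<bullet> A (0, x)"
proof -
  define L where "L = (\<lambda>x. snd (A (0, x)))"
  have "bounded_linear L" unfolding L_def
    by (intro bounded_linear_compose[OF bounded_linear_snd] bounded_linear_compose[OF A] bounded_linear_Pair
        bounded_linear_zero bounded_linear_ident)
  then have "linear L" by (rule bounded_linear.linear)
  define N where "N = matrix L"
  have L: "L x = N *v x" for x
    unfolding N_def using fun_cong[OF matrix_vector_mul(2)[OF \<open>linear L\<close>], of x] by simp
  define X where "X = (1/2) *\<^sub>R (N + transpose N)"
  have "transpose X = X"
    by (simp add: X_def transpose_def vec_eq_iff add.commute)
  moreover have "x \<bullet> (X *v x) = (0, x) \<bullet> A (0, x)" for x
  proof -
    have "x \<bullet> (transpose N *v x) = x \<bullet> (N *v x)"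
      using dot_lmul_matrix[of x N x] by (simp add: transpose_matrix_vector inner_commute)
    then have "x \<bullet> (X *v x) = x \<bullet> L x"
      unfolding X_def L by (simp add: scaleR_matrix_vector_assoc[symmetric] matrix_vector_mult_add_rdistrib inner_add_right)
    then show ?thesis by (simp add: L_def inner_prod_def)
  qed
  ultimately show thesis using that by (simp add: symmetric_mat_def)
qed

lemma mat_1_scaleR_mult: "(c *\<^sub>R mat 1 :: real ^ 'd::finite ^ 'd) *v x = c *\<^sub>R x"
  by (simp add: scaleR_matrix_vector_assoc[symmetric])

lemma symmetric_mat_add: "symmetric_mat X \<Longrightarrow> symmetric_mat Y \<Longrightarrow> symmetric_mat (X + Y)"
  and symmetric_mat_uminus: "symmetric_mat X \<Longrightarrow> symmetric_mat (- X)"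
  and symmetric_mat_scaleR_1: "symmetric_mat (c *\<^sub>R mat 1)"
  for X Y :: "real ^ 'd::finite ^ 'd"
  by (auto simp: symmetric_mat_def transpose_def vec_eq_iff mat_def)

text \<open>Young's inequality on the mixed terms: an arbitrarily small share is charged to space,
  at the price of a large coefficient in time, where it is harmless for the equation.\<close>

lemma quadratic_form_time_split:
  fixes A :: "real \<times> 'b::real_inner \<Rightarrow> real \<times> 'b"
  assumes A: "bounded_linear A" and e: "e > 0"
  obtains N where "N \<ge> 0" "\<And>\<tau> x. (\<tau>, x) \<bullet> A (\<tau>, x) \<le> (0, x) \<bullet> A (0, x) + e * (norm x)\<^sup>2 + N * \<tau>\<^sup>2"
proof -
  interpret A: bounded_linear A by fact
  obtain K where K: "K > 0" "\<And>z. norm (A z) \<le> norm z * K" using A.pos_bounded by blast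
  have K2: "y \<bullet> A z \<le> K * (norm y * norm z)" for y z
  proof -
    have "y \<bullet> A z \<le> norm y * norm (A z)" by (rule norm_cauchy_schwarz)
    also have "\<dots> \<le> norm y * (norm z * K)" by (intro mult_left_mono K) auto
    finally show ?thesis by (simp add: mult_ac)
  qed
  define N where "N = K + K\<^sup>2 / e"
  have "(\<tau>, x) \<bullet> A (\<tau>, x) \<le> (0, x) \<bullet> A (0, x) + e * (norm x)\<^sup>2 + N * \<tau>\<^sup>2" for \<tau> x
  proof -
    have split: "(\<tau>, x) = (\<tau>, 0) + (0, x)" by simp
    have nt: "norm (\<tau>, 0 :: 'b) = \<bar>\<tau>\<bar>" and nx: "norm (0 :: real, x) = norm x" by (auto simp: norm_prod_def)
    have "(\<tau>, x) \<bullet> A (\<tau>, x) = (\<tau>, 0) \<bullet> A (\<tau>, 0) + (\<tau>, 0) \<bullet> A (0, x) + (0, x) \<bullet> A (\<tau>, 0) + (0, x) \<bullet> A (0, x)"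
      unfolding split A.add inner_add_left inner_add_right by simp
    also have "\<dots> \<le> K * (\<bar>\<tau>\<bar> * \<bar>\<tau>\<bar>) + K * (\<bar>\<tau>\<bar> * norm x) + K * (norm x * \<bar>\<tau>\<bar>) + (0, x) \<bullet> A (0, x)"
      using K2[of "(\<tau>, 0)" "(\<tau>, 0)"] K2[of "(\<tau>, 0)" "(0, x)"] K2[of "(0, x)" "(\<tau>, 0)"] unfolding nt nx
      by (intro add_mono) auto
    finally have le: "(\<tau>, x) \<bullet> A (\<tau>, x) \<le> K * (\<bar>\<tau>\<bar> * \<bar>\<tau>\<bar>) + K * (\<bar>\<tau>\<bar> * norm x)
        + K * (norm x * \<bar>\<tau>\<bar>) + (0, x) \<bullet> A (0, x)" .
    moreover have "K * (\<bar>\<tau>\<bar> * norm x) + K * (norm x * \<bar>\<tau>\<bar>) \<le> e * (norm x)\<^sup>2 + K\<^sup>2 / e * \<tau>\<^sup>2"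
    proof -
      have "0 \<le> (e * norm x - K * \<bar>\<tau>\<bar>)\<^sup>2" by simp
      then have "2 * (e * (K * (\<bar>\<tau>\<bar> * norm x))) \<le> e\<^sup>2 * (norm x)\<^sup>2 + K\<^sup>2 * \<tau>\<^sup>2"
        by (simp add: power2_diff power_mult_distrib mult_ac)
      then have "e * (2 * (K * (\<bar>\<tau>\<bar> * norm x))) \<le> e * (e * (norm x)\<^sup>2 + K\<^sup>2 / e * \<tau>\<^sup>2)"
        using e by (simp add: power2_eq_square algebra_simps)
      then have "2 * (K * (\<bar>\<tau>\<bar> * norm x)) \<le> e * (norm x)\<^sup>2 + K\<^sup>2 / e * \<tau>\<^sup>2"
        using e by (subst (asm) mult_le_cancel_left_pos) auto
      then show ?thesis by (simp add: mult_ac)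
    qed
    moreover have "K * (\<bar>\<tau>\<bar> * \<bar>\<tau>\<bar>) = K * \<tau>\<^sup>2" by (simp add: power2_eq_square)
    moreover have "N * \<tau>\<^sup>2 = K * \<tau>\<^sup>2 + K\<^sup>2 / e * \<tau>\<^sup>2" by (simp add: N_def distrib_right)
    ultimately show ?thesis by linarith
  qed
  moreover have "N \<ge> 0" using K e by (simp add: N_def)
  ultimately show thesis using that by blast
qed

text \<open>The second-order errors in space add up to at most \<open>e / 2\<close> times the square
  of \<open>norm x\<close>, which explains the perturbation \<open>e *\<^sub>R mat 1\<close> of the
  Hessian; those in time go into \<open>N\<close>.\<close>

lemma parabolic_upper_jet:
  fixes f :: "real \<times> (real ^ 'd::finite) \<Rightarrow> real"
  assumes A: "upper_expansion f y g A"
    and X: "\<And>x. x \<bullet> (X *v x) = (0, x) \<bullet> A (0, x)" and e: "e > 0"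
  obtains d N where "d > 0" "\<And>\<tau> x. norm (\<tau>, x) < d \<Longrightarrow>
     f (y + (\<tau>, x)) \<le> f y + fst g * \<tau> + snd g \<bullet> x + (x \<bullet> ((X + e *\<^sub>R mat 1) *v x)) / 2 + N * \<tau>\<^sup>2"
proof -
  define e' where "e' = e / 4"
  have e': "e' > 0" using e by (simp add: e'_def)
  obtain d where d: "d > 0" "\<And>h. norm h < d \<Longrightarrow> f (y + h) \<le> f y + g \<bullet> h + (h \<bullet> A h) / 2 + e' * (norm h)\<^sup>2"
    using A e' unfolding upper_expansion_def by blast
  have "bounded_linear A" using A by (simp add: upper_expansion_def)
  then obtain N where N: "N \<ge> 0" "\<And>\<tau> x. (\<tau>, x) \<bullet> A (\<tau>, x) \<le> (0, x) \<bullet> A (0, x) + e' * (norm x)\<^sup>2 + N * \<tau>\<^sup>2"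
    using quadratic_form_time_split e' by blast
  have "f (y + (\<tau>, x)) \<le> f y + fst g * \<tau> + snd g \<bullet> x + (x \<bullet> ((X + e *\<^sub>R mat 1) *v x)) / 2 + (N / 2 + e') * \<tau>\<^sup>2"
    if "norm (\<tau>, x) < d" for \<tau> x
  proof -
    have n: "(norm (\<tau>, x))\<^sup>2 = \<tau>\<^sup>2 + (norm x)\<^sup>2" by (simp add: norm_prod_def)
    have q: "x \<bullet> ((X + e *\<^sub>R mat 1) *v x) = (0, x) \<bullet> A (0, x) + e * (norm x)\<^sup>2"
      by (simp add: matrix_vector_mult_add_rdistrib mat_1_scaleR_mult inner_add_right X dot_square_norm)
    have g: "g \<bullet> (\<tau>, x) = fst g * \<tau> + snd g \<bullet> x" by (simp add: inner_prod_def)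
    have "0 \<le> (norm x)\<^sup>2" by simp
    then have "0 \<le> e * (norm x)\<^sup>2" using e by simp
    then show ?thesis using d(2)[OF that] N(2)[of \<tau> x] unfolding n q g e'_def
      by (simp add: field_simps)
  qed
  then show thesis using that d(1) by blast
qed

text \<open>Polarisation bounds each entry by \<open>K\<close>, as the squared norms of the sum and
  the difference of two unit vectors add up to 4.\<close>

lemma norm_matrix_le:
  fixes X :: "real ^ 'd::finite ^ 'd"
  assumes X: "symmetric_mat X" and K: "\<And>x. \<bar>x \<bullet> (X *v x)\<bar> \<le> K * (norm x)\<^sup>2"
  shows "norm X \<le> real CARD('d) * (real CARD('d) * K)"
proof -
  have ent: "\<bar>X $ i $ j\<bar> \<le> K" for i j
  proof -
    define a b where "a = (axis i 1 :: real ^ 'd)" and "b = (axis j 1 :: real ^ 'd)"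
    have ab: "a \<bullet> (X *v b) = X $ i $ j"
      by (simp add: a_def b_def inner_axis' matrix_vector_mult_basis column_def)
    have "4 * (a \<bullet> (X *v b)) = (a + b) \<bullet> (X *v (a + b)) - (a - b) \<bullet> (X *v (a - b))"
      using symmetric_mat_inner[OF X, of b a]
      by (simp add: matrix_vector_right_distrib matrix_vector_mult_diff_distrib algebra_simps inner_commute)
    also have "\<bar>\<dots>\<bar> \<le> K * (norm (a + b))\<^sup>2 + K * (norm (a - b))\<^sup>2"
      using K[of "a + b"] K[of "a - b"] by linarith
    also have "\<dots> = K * 4"
    proof -
      have "(norm (a + b))\<^sup>2 + (norm (a - b))\<^sup>2 = 2 * (norm a)\<^sup>2 + 2 * (norm b)\<^sup>2"
        unfolding power2_norm_eq_inner by (simp add: algebra_simps inner_commute)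
      also have "\<dots> = 4" by (simp add: a_def b_def)
      finally show ?thesis by (simp add: distrib_left[symmetric])
    qed
    finally show ?thesis using ab by simp
  qed
  have "norm X \<le> (\<Sum>i\<in>UNIV. norm (X $ i))"
    unfolding norm_vec_def by (rule L2_set_le_sum) auto
  also have "\<dots> \<le> (\<Sum>i\<in>(UNIV :: 'd set). real CARD('d) * K)"
  proof (rule sum_mono)
    fix i
    have "norm (X $ i) \<le> (\<Sum>j\<in>UNIV. \<bar>X $ i $ j\<bar>)" by (rule norm_le_l1_cart)
    also have "\<dots> \<le> (\<Sum>j\<in>(UNIV :: 'd set). K)" by (intro sum_mono ent)
    finally show "norm (X $ i) \<le> real CARD('d) * K" by simp
  qed
  finally show ?thesis by simp
qed

text \<open>
  The generators seen by one slab: the path is frozen, so they depend neither on it nor on the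
  space variable.
\<close>

locale slab_generator =
  fixes a b C :: real and G :: "real \<Rightarrow> real \<Rightarrow> real ^ 'd::finite \<Rightarrow> real ^ 'd ^ 'd \<Rightarrow> real"
  assumes ab: "a < b"
    and C_nonneg: "C \<ge> 0"
    and time_continuous: "\<And>y p X. symmetric_mat X \<Longrightarrow> continuous_on {a..<b} (\<lambda>t. G t y p X)"
    and lipschitz: "\<And>t y p X y' p' X'. t \<in> {a..<b} \<Longrightarrow> symmetric_mat X \<Longrightarrow> symmetric_mat X' \<Longrightarrow>
       \<bar>G t y p X - G t y' p' X'\<bar> \<le> C * (\<bar>y - y'\<bar> + norm (p - p') + norm (X - X'))"
    and mono: "\<And>t y p X X'. t \<in> {a..<b} \<Longrightarrow> symmetric_mat X \<Longrightarrow> symmetric_mat X' \<Longrightarrow> mat_le X X' \<Longrightarrow>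
       G t y p X \<le> G t y p X'"
begin

text \<open>Continuity in time and a Lipschitz bound in the other arguments, uniform in time, give
  joint continuity, hence uniform continuity on compact sets. Since \<open>\<delta>\<close> depends
  on \<open>R\<close>, slopes and Hessians must be bounded before times are compared.\<close>

lemma uniform_time_modulus:
  assumes "a \<le> l" "m < b" "e > 0"
  obtains \<delta> where "\<delta> > 0" "\<And>t s y p X. t \<in> {l..m} \<Longrightarrow> s \<in> {l..m} \<Longrightarrow> \<bar>t - s\<bar> \<le> \<delta> \<Longrightarrow>
    \<bar>y\<bar> \<le> R \<Longrightarrow> norm p \<le> R \<Longrightarrow> norm X \<le> R \<Longrightarrow> symmetric_mat X \<Longrightarrow> \<bar>G t y p X - G s y p X\<bar> < e"
proof -
  define S where "S = {l..m} \<times> cball (0::real) R \<times> cball (0 :: real ^ 'd) R \<times> (cball 0 R \<inter> {X :: real ^ 'd ^ 'd. symmetric_mat X})"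
  have "closed {X :: real ^ 'd ^ 'd. symmetric_mat X}"
    unfolding symmetric_mat_def transpose_def by (intro closed_Collect_eq continuous_intros)
  then have S: "compact S" unfolding S_def
    by (intro compact_Times compact_Int_closed) auto
  have "continuous_on S (\<lambda>(t, y, p, X). G t y p X)"
    unfolding continuous_on_iff
  proof (intro ballI allI impI)
    fix q and e' :: real assume q: "q \<in> S" and e': "e' > 0"
    obtain t y p X where qe: "q = (t, y, p, X)" by (metis prod_cases4)
    have t: "t \<in> {a..<b}" "symmetric_mat X" using q assms by (auto simp: qe S_def)
    obtain d where d: "d > 0" "\<And>t'. t' \<in> {a..<b} \<Longrightarrow> dist t' t < d \<Longrightarrow> dist (G t' y p X) (G t y p X) < e' / 2"
      using time_continuous[OF t(2), of y p] t(1) half_gt_zero[OF e'] unfolding continuous_on_iff by metis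
    define d' where "d' = min d (e' / (6 * (C + 1)))"
    have "d' > 0" using d e' C_nonneg by (simp add: d'_def)
    moreover have "dist (case q' of (t, y, p, X) \<Rightarrow> G t y p X) (case q of (t, y, p, X) \<Rightarrow> G t y p X) < e'"
      if q': "q' \<in> S" "dist q' q < d'" for q'
    proof -
      obtain t' y' p' X' where qe': "q' = (t', y', p', X')" by (metis prod_cases4)
      have t': "t' \<in> {a..<b}" "symmetric_mat X'" using q' assms by (auto simp: qe' S_def)
      have "dist t' t < d'" "dist y' y < d'" "dist p' p < d'" "dist X' X < d'"
        using q'(2) dist_fst_le[of q' q] dist_snd_le[of q' q] dist_fst_le[of "snd q'" "snd q"] dist_snd_le[of "snd q'" "snd q"]
          dist_fst_le[of "snd (snd q')" "snd (snd q)"] dist_snd_le[of "snd (snd q')" "snd (snd q)"]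
        by (auto simp: qe qe')
      then have ds: "dist t' t < d" "\<bar>y' - y\<bar> \<le> d'" "norm (p' - p) \<le> d'" "norm (X' - X) \<le> d'"
        by (auto simp: d'_def dist_norm)
      have "\<bar>G t' y' p' X' - G t' y p X\<bar> \<le> C * (\<bar>y' - y\<bar> + norm (p' - p) + norm (X' - X))"
        by (rule lipschitz[OF t' t(2)])
      also have "\<dots> \<le> C * (3 * d')" using ds C_nonneg by (intro mult_left_mono) auto
      also have "\<dots> \<le> (C + 1) * (3 * d')" using \<open>d' > 0\<close> by (intro mult_right_mono) auto
      also have "\<dots> \<le> (C + 1) * (3 * (e' / (6 * (C + 1))))"
        using C_nonneg by (intro mult_left_mono) (auto simp: d'_def)
      also have "\<dots> = e' / 2" using C_nonneg by (simp add: field_simps add_nonneg_eq_0_iff)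
      finally have "\<bar>G t' y' p' X' - G t' y p X\<bar> \<le> e' / 2" .
      moreover have "\<bar>G t' y p X - G t y p X\<bar> < e' / 2"
        using d(2)[OF t'(1) ds(1)] by (simp add: dist_real_def)
      ultimately have "\<bar>G t' y' p' X' - G t y p X\<bar> < e'" by linarith
      then show ?thesis by (simp add: qe qe' dist_real_def)
    qed
    ultimately show "\<exists>d>0. \<forall>q'\<in>S. dist q' q < d \<longrightarrow>
        dist (case q' of (t, y, p, X) \<Rightarrow> G t y p X) (case q of (t, y, p, X) \<Rightarrow> G t y p X) < e'" by blast
  qed
  then have "uniformly_continuous_on S (\<lambda>(t, y, p, X). G t y p X)"
    using S by (rule compact_uniformly_continuous)
  then obtain d where d: "d > 0" "\<And>q q'. q \<in> S \<Longrightarrow> q' \<in> S \<Longrightarrow> dist q' q < d \<Longrightarrow>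
      dist (case q' of (t, y, p, X) \<Rightarrow> G t y p X) (case q of (t, y, p, X) \<Rightarrow> G t y p X) < e"
    using \<open>e > 0\<close> unfolding uniformly_continuous_on_def by metis
  show thesis
  proof (rule that[of "d / 2"])
    fix t s y :: real and p :: "real ^ 'd" and X :: "real ^ 'd ^ 'd"
    assume *: "t \<in> {l..m}" "s \<in> {l..m}" "\<bar>t - s\<bar> \<le> d / 2" "\<bar>y\<bar> \<le> R" "norm p \<le> R" "norm X \<le> R" "symmetric_mat X"
    have "dist (t, y, p, X) (s, y, p, X) < d" using * d(1) by (simp add: dist_Pair_Pair dist_real_def)
    then show "\<bar>G t y p X - G s y p X\<bar> < e"
      using d(2)[of "(s, y, p, X)" "(t, y, p, X)"] * by (simp add: S_def dist_real_def)
  qed (use d in simp)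
qed

text \<open>The jet becomes a test function once its Hessian is enlarged by
  \<open>e *\<^sub>R mat 1\<close>, and the Lipschitz bound removes the enlargement as
  \<open>e\<close> tends to zero. The inequality between \<open>G'\<close> and \<open>G\<close> is
  inserted here, so that the later estimates see a single generator.\<close>

lemma subsolution_second_order:
  assumes visc: "viscosity_subsolution a b G' u"
    and G': "\<And>t y p X. t \<in> {a..<b} \<Longrightarrow> symmetric_mat X \<Longrightarrow> G' t y p X \<le> G t y p X" and t: "a < t" "t < b"
    and A: "upper_expansion (\<lambda>(s, z). u s z) (t, y) g A"
    and X: "symmetric_mat X" "\<And>x. x \<bullet> (X *v x) = (0, x) \<bullet> A (0, x)"
  shows "- fst g \<le> G t (u t y) (snd g) X"
proof -
  have "- fst g - G t (u t y) (snd g) X \<le> e * (C * norm (mat 1 :: real ^ 'd ^ 'd))" if e: "e > 0" for e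
  proof -
    define f where "f = (\<lambda>(s, z). u s z)"
    obtain d N where d: "d > 0" "\<And>\<tau> x. norm (\<tau>, x) < d \<Longrightarrow>
     f ((t, y) + (\<tau>, x)) \<le> f (t, y) + fst g * \<tau> + snd g \<bullet> x + (x \<bullet> ((X + e *\<^sub>R mat 1) *v x)) / 2 + N * \<tau>\<^sup>2"
      using parabolic_upper_jet[OF A[folded f_def] X(2) e] by blast
    have "- fst g - G' t (u t y) (snd g) (X + e *\<^sub>R mat 1) \<le> 0"
    proof (rule subsolution_jet[OF visc _ _ d(1)])
      show "symmetric_mat (X + e *\<^sub>R mat 1)" by (intro symmetric_mat_add X symmetric_mat_scaleR_1)
      show "u s z \<le> u t y + fst g * (s - t) + snd g \<bullet> (z - y) + ((z - y) \<bullet> ((X + e *\<^sub>R mat 1) *v (z - y))) / 2 + N * (s - t)\<^sup>2"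
        if "norm (s - t, z - y) < d" for s z
        using d(2)[OF that] by (simp add: f_def)
    qed (use t in auto)
    moreover have "G' t (u t y) (snd g) (X + e *\<^sub>R mat 1) \<le> G t (u t y) (snd g) (X + e *\<^sub>R mat 1)"
      using t by (intro G' symmetric_mat_add X symmetric_mat_scaleR_1) auto
    moreover have "\<bar>G t (u t y) (snd g) (X + e *\<^sub>R mat 1) - G t (u t y) (snd g) X\<bar>
       \<le> C * (\<bar>u t y - u t y\<bar> + norm (snd g - snd g) + norm (X + e *\<^sub>R mat 1 - X))"
      using t by (intro lipschitz symmetric_mat_add X symmetric_mat_scaleR_1) auto
    ultimately show ?thesis using e by (simp add: mult_ac)
  qed
  then have "- fst g - G t (u t y) (snd g) X \<le> 0" by (rule nonpos_if_le_small_multiples)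
  then show ?thesis by simp
qed

text \<open>The subsolution case for \<open>- v\<close> and the dual generator, which is again
  monotone because the order is reversed twice.\<close>

lemma supersolution_second_order:
  assumes visc: "viscosity_supersolution a b G v" and t: "a < t" "t < b"
    and A: "upper_expansion (\<lambda>(s, z). - v s z) (t, y) g A"
    and X: "symmetric_mat X" "\<And>x. x \<bullet> (X *v x) = (0, x) \<bullet> A (0, x)"
  shows "G t (v t y) (- snd g) (- X) \<le> fst g"
proof -
  interpret dual: slab_generator a b C "\<lambda>t y p X. - G t (- y) (- p) (- X)"
  proof
    show "continuous_on {a..<b} (\<lambda>t. - G t (- y) (- p) (- X))" if "symmetric_mat X" for y p X
      using that by (intro continuous_on_minus time_continuous symmetric_mat_uminus)
    show "\<bar>- G t (- y) (- p) (- X) - - G t (- y') (- p') (- X')\<bar> \<le> C * (\<bar>y - y'\<bar> + norm (p - p') + norm (X - X'))"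
      if "t \<in> {a..<b}" "symmetric_mat X" "symmetric_mat X'" for t y p X y' p' X'
      using lipschitz[OF that(1) symmetric_mat_uminus[OF that(2)] symmetric_mat_uminus[OF that(3)], of "- y" "- p" "- y'" "- p'"]
      by (simp add: abs_minus_commute norm_minus_commute)
    show "- G t (- y) (- p) (- X) \<le> - G t (- y) (- p) (- X')"
      if "t \<in> {a..<b}" "symmetric_mat X" "symmetric_mat X'" "mat_le X X'" for t y p X X'
      using mono[OF that(1) symmetric_mat_uminus[OF that(3)] symmetric_mat_uminus[OF that(2)]] that(4)
      by (simp add: mat_le_def uminus_matrix_vector_mult)
  qed (rule ab C_nonneg)+
  show ?thesis
    using dual.subsolution_second_order[where A = A, OF viscosity_supersolution_uminus[OF visc] order_refl t A X] by simp
qed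

text \<open>
  The difference of a subsolution and a supersolution is a subsolution of an extremal equation;
  here only test functions with a scalar Hessian are needed.
\<close>

lemma difference_subsolution:
  fixes u v :: "real \<Rightarrow> real ^ 'd \<Rightarrow> real" and p :: "real \<times> (real ^ 'd)"
  assumes sub: "viscosity_subsolution a b G' u" and G': "\<And>t y p X. t \<in> {a..<b} \<Longrightarrow> symmetric_mat X \<Longrightarrow> G' t y p X \<le> G t y p X"
    and super: "viscosity_supersolution a b G v"
    and cont: "continuous_on ({a..<b} \<times> UNIV) (\<lambda>(t, y). u t y)" "continuous_on ({a..<b} \<times> UNIV) (\<lambda>(t, y). v t y)"
    and t0: "a < t0" "t0 < b" and r0: "r0 > 0" and \<kappa>: "\<kappa> > 0" and MA: "M \<ge> 0" "A \<ge> 0"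
    and max: "\<And>\<tau> h. norm (\<tau>, h) \<le> r0 \<Longrightarrow> u (t0 + \<tau>) (y0 + h) - v (t0 + \<tau>) (y0 + h) \<le>
       u t0 y0 - v t0 y0 + p \<bullet> (\<tau>, h) + M * \<tau>\<^sup>2 + A * (norm h)\<^sup>2 - \<kappa> * (norm (\<tau>, h))\<^sup>2"
  shows "- fst p \<le> C * (\<bar>u t0 y0 - v t0 y0\<bar> + norm (snd p) + 2 * A * norm (mat 1 :: real ^ 'd ^ 'd))"
proof -
  define I where "I = (mat 1 :: real ^ 'd ^ 'd)"
  \<comment> \<open>Shifted to the maximum point and with \<open>- v\<close> in place of
    \<open>v\<close>, to match the theorem on sums.\<close>
  define U where "U = (\<lambda>z. case (t0, y0) + z of (s, x) \<Rightarrow> u s x)"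
  define W where "W = (\<lambda>z. case (t0, y0) + z of (s, x) \<Rightarrow> - v s x)"
  define c where "c = min (t0 - a) (b - t0)"
  have c: "c > 0" using t0 by (simp add: c_def)
  have inside: "(t0, y0) + z \<in> {a..<b} \<times> UNIV" "a < t0 + fst z" "t0 + fst z < b" if "norm z < c" for z :: "real \<times> (real ^ 'd)"
  proof -
    have "\<bar>fst z\<bar> < c" using that norm_fst_le[of "fst z" "snd z"] by simp
    then show "(t0, y0) + z \<in> {a..<b} \<times> UNIV" "a < t0 + fst z" "t0 + fst z < b"
      by (cases z; auto simp: c_def)+
  qed
  have contU: "continuous_on (ball 0 c) U" "continuous_on (ball 0 c) W"
  proof -
    have shift: "continuous_on (ball 0 c) (\<lambda>z. f (t0 + fst z) (y0 + snd z))"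
      if "continuous_on ({a..<b} \<times> UNIV) (\<lambda>(t, y). f t y)" for f :: "real \<Rightarrow> real ^ 'd \<Rightarrow> real"
    proof (rule continuous_on_compose2[OF that[unfolded case_prod_unfold], of _ "\<lambda>z. (t0 + fst z, y0 + snd z)", unfolded fst_conv snd_conv])
      show "continuous_on (ball 0 c) (\<lambda>z. (t0 + fst z, y0 + snd z))" by (intro continuous_intros)
      show "(\<lambda>z. (t0 + fst z, y0 + snd z)) ` ball 0 c \<subseteq> {a..<b} \<times> UNIV"
        using inside(2,3) by (force intro: less_imp_le)
    qed
    have "U = (\<lambda>z. u (t0 + fst z) (y0 + snd z))" "W = (\<lambda>z. - v (t0 + fst z) (y0 + snd z))"
      by (auto simp: U_def W_def case_prod_unfold)
    then show "continuous_on (ball 0 c) U" "continuous_on (ball 0 c) W"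
      using shift[OF cont(1)] shift[OF cont(2)] by (auto intro: continuous_on_minus)
  qed
  have U0: "U 0 = u t0 y0" "W 0 = - v t0 y0" by (auto simp: U_def W_def zero_prod_def)
  have "- fst p - C * (\<bar>u t0 y0 - v t0 y0\<bar> + norm (snd p) + 2 * A * norm I) \<le> e * (4 * C + 3)" if e: "e > 0" for e
  proof -
    have "isCont U 0" "isCont W 0" using contU c by (auto intro: continuous_on_interior)
    then obtain dU dW where dU: "dU > 0" "\<And>z. norm z < dU \<Longrightarrow> \<bar>U z - U 0\<bar> < e"
      and dW: "dW > 0" "\<And>z. norm z < dW \<Longrightarrow> \<bar>W z - W 0\<bar> < e"
      using e unfolding continuous_at_eps_delta dist_norm by (metis diff_zero real_norm_def)
    \<comment> \<open>Small enough that \<open>u\<close> and \<open>v\<close> move by less than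
      \<open>e\<close> and that the slope error \<open>2 * (M + A) * r\<close> is at most
      \<open>e\<close>.\<close>
    define r where "r = min (min (c / 2) r0) (min (min dU dW) (e / (2 * (M + A + 1))))"
    have r: "r > 0" "r < c" "r \<le> r0" "r \<le> dU" "r \<le> dW"
      using c r0 dU dW e MA by (auto simp: r_def)
    have rM: "2 * (M + A) * r \<le> e"
    proof -
      have "2 * (M + A) * r \<le> 2 * (M + A + 1) * r" using r by simp
      also have "\<dots> \<le> 2 * (M + A + 1) * (e / (2 * (M + A + 1)))"
        using MA by (intro mult_left_mono) (auto simp: r_def)
      also have "\<dots> = e" using MA by (simp add: add_nonneg_eq_0_iff)
      finally show ?thesis .
    qed
    have sub_ball: "cball 0 r \<subseteq> ball (0 :: real \<times> (real ^ 'd)) c" using r by auto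
    have "U z + W z \<le> U 0 + W 0 + p \<bullet> z + M * (fst z)\<^sup>2 + A * (norm (snd z))\<^sup>2 - \<kappa> * (norm z)\<^sup>2"
      if "norm z \<le> r" for z
      using max[of "fst z" "snd z"] that r unfolding U0 by (simp add: U_def W_def case_prod_unfold)
    then have "\<exists>K>0. \<forall>\<delta>>0. \<forall>\<eta>>0. \<exists>y1 y2 g1 g2 A1 A2.
       touching_pair U W r \<delta> p (\<eta> + 2 * (M + A) * r) A K y1 y2 g1 g2 A1 A2"
      by (rule theorem_on_sums[OF r(1) continuous_on_subset[OF contU(1) sub_ball]
            continuous_on_subset[OF contU(2) sub_ball] \<kappa> MA])
    then obtain K where KS: "K > 0 \<and> (\<forall>\<delta>>0. \<forall>\<eta>>0. \<exists>y1 y2 g1 g2 A1 A2.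
       touching_pair U W r \<delta> p (\<eta> + 2 * (M + A) * r) A K y1 y2 g1 g2 A1 A2)" ..
    note K = conjunct1[OF KS] and sums = conjunct2[OF KS, rule_format]
    \<comment> \<open>\<open>R\<close> bounds the value, slope and Hessian at which \<open>G\<close>
      is compared between the two times. It is made from \<open>K\<close>, which is known before
      \<open>\<delta>\<close> is taken from the modulus and handed to the theorem on sums.\<close>
    define KX where "KX = real CARD('d) * (real CARD('d) * (2 * A + K))"
    define R where "R = max (max (\<bar>v t0 y0\<bar> + e) K) KX"
    have lr: "a \<le> t0 - r" "t0 + r < b" using r c by (auto simp: c_def)
    obtain \<delta> where \<delta>: "\<delta> > 0" "\<And>t s y p X. t \<in> {t0 - r..t0 + r} \<Longrightarrow> s \<in> {t0 - r..t0 + r} \<Longrightarrow> \<bar>t - s\<bar> \<le> \<delta> \<Longrightarrow>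
      \<bar>y\<bar> \<le> R \<Longrightarrow> norm p \<le> R \<Longrightarrow> norm X \<le> R \<Longrightarrow> symmetric_mat X \<Longrightarrow> \<bar>G t y p X - G s y p X\<bar> < e"
      using uniform_time_modulus[OF lr e] by blast
    from sums[OF \<delta>(1) e] obtain y1 y2 g1 g2 A1 A2 where
      tp: "touching_pair U W r \<delta> p (e + 2 * (M + A) * r) A K y1 y2 g1 g2 A1 A2" by blast
    note y12 = touching_pairD(1-3)[OF tp] and g12 = touching_pairD(4-6)[OF tp]
      and jU = touching_pairD(7)[OF tp] and jW = touching_pairD(8)[OF tp]
      and low = touching_pairD(9,10)[OF tp] and up = touching_pairD(11)[OF tp]
    have bl: "bounded_linear A1" "bounded_linear A2" using jU jW by (auto simp: upper_expansion_def)
    obtain X1 where X1: "symmetric_mat X1" "\<And>x. x \<bullet> (X1 *v x) = (0, x) \<bullet> A1 (0, x)"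
      using spatial_symmetric_matrix[OF bl(1)] by blast
    obtain X2 where X2: "symmetric_mat X2" "\<And>x. x \<bullet> (X2 *v x) = (0, x) \<bullet> A2 (0, x)"
      using spatial_symmetric_matrix[OF bl(2)] by blast
    define t1 x1 t2 x2 where "t1 = t0 + fst y1" and "x1 = y0 + snd y1" and "t2 = t0 + fst y2" and "x2 = y0 + snd y2"
    have t12: "a < t1" "t1 < b" "a < t2" "t2 < b"
      using inside(2,3)[of y1] inside(2,3)[of y2] y12 r by (auto simp: t1_def t2_def)
    have "upper_expansion (\<lambda>(s, z). u s z) (t1, x1) g1 A1"
      using jU by (simp add: upper_expansion_def U_def t1_def x1_def case_prod_unfold add.assoc)
    then have s1: "- fst g1 \<le> G t1 (u t1 x1) (snd g1) X1"
      using subsolution_second_order[where A = A1, OF sub G' t12(1,2) _ X1] by blast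
    have "upper_expansion (\<lambda>(s, z). - v s z) (t2, x2) g2 A2"
      using jW by (simp add: upper_expansion_def W_def t2_def x2_def case_prod_unfold add.assoc)
    then have s2: "G t2 (v t2 x2) (- snd g2) (- X2) \<le> fst g2"
      by (rule supersolution_second_order[where A = A2, OF super t12(3,4) _ X2])
    have uv: "\<bar>u t1 x1 - u t0 y0\<bar> < e" "\<bar>v t2 x2 - v t0 y0\<bar> < e"
      using dU(2)[of y1] dW(2)[of y2] y12 r unfolding U0
      by (auto simp: U_def W_def t1_def t2_def x1_def x2_def case_prod_unfold)
    have sX: "symmetric_mat (- X2)" "symmetric_mat (- X2 + (2 * A) *\<^sub>R I)"
      unfolding I_def by (intro symmetric_mat_add symmetric_mat_uminus X2 symmetric_mat_scaleR_1)+
    \<comment> \<open>The two Hessians together are at most \<open>2 * A\<close> times the identity,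
      the spatial Hessian of the test function.\<close>
    have "mat_le X1 (- X2 + (2 * A) *\<^sub>R I)"
      unfolding mat_le_def
    proof
      fix x
      have "x \<bullet> ((- X2 + (2 * A) *\<^sub>R I) *v x) = - (x \<bullet> (X2 *v x)) + 2 * A * (norm x)\<^sup>2"
        unfolding I_def matrix_vector_mult_add_rdistrib mat_1_scaleR_mult
        by (simp add: uminus_matrix_vector_mult inner_add_right inner_diff_right dot_square_norm)
      then show "x \<bullet> (X1 *v x) \<le> x \<bullet> ((- X2 + (2 * A) *\<^sub>R I) *v x)" using up[of x] X1(2) X2(2) by simp
    qed
    then have m1: "G t1 (u t1 x1) (snd g1) X1 \<le> G t1 (u t1 x1) (snd g1) (- X2 + (2 * A) *\<^sub>R I)"
      using t12 by (intro mono X1 sX) auto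
    have m2: "\<bar>G t1 (u t1 x1) (snd g1) (- X2 + (2 * A) *\<^sub>R I) - G t1 (v t2 x2) (- snd g2) (- X2)\<bar>
       \<le> C * (\<bar>u t1 x1 - v t2 x2\<bar> + norm (snd g1 - (- snd g2)) + norm ((- X2 + (2 * A) *\<^sub>R I) - (- X2)))"
      using t12 by (intro lipschitz sX) auto
    have gp: "norm (snd g1 + snd g2 - snd p) \<le> 2 * e" "\<bar>fst g1 + fst g2 - fst p\<bar> \<le> 2 * e"
      using g12(1) rM norm_snd_le_norm[of "g1 + g2 - p"] norm_fst_le_norm[of "g1 + g2 - p"]
      by auto
    have "norm (snd g1 - (- snd g2)) \<le> norm (snd p) + 2 * e"
      using gp(1) norm_triangle_ineq[of "snd p" "snd g1 + snd g2 - snd p"] by simp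
    moreover have "norm ((- X2 + (2 * A) *\<^sub>R I) - (- X2)) = 2 * A * norm I" using MA by simp
    ultimately have "\<bar>u t1 x1 - v t2 x2\<bar> + norm (snd g1 - (- snd g2)) + norm ((- X2 + (2 * A) *\<^sub>R I) - (- X2))
       \<le> \<bar>u t0 y0 - v t0 y0\<bar> + norm (snd p) + 2 * A * norm I + 4 * e"
      using uv by linarith
    then have m3: "C * (\<bar>u t1 x1 - v t2 x2\<bar> + norm (snd g1 - (- snd g2)) + norm ((- X2 + (2 * A) *\<^sub>R I) - (- X2)))
       \<le> C * (\<bar>u t0 y0 - v t0 y0\<bar> + norm (snd p) + 2 * A * norm I + 4 * e)"
      using C_nonneg by (intro mult_left_mono)
    have "norm X2 \<le> KX" unfolding KX_def
    proof (rule norm_matrix_le[OF X2(1)])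
      fix x
      have "- (K * (norm x)\<^sup>2) \<le> x \<bullet> (X2 *v x)" "x \<bullet> (X2 *v x) \<le> 2 * A * (norm x)\<^sup>2 + K * (norm x)\<^sup>2"
        using low[of x] up[of x] X2(2) by auto
      moreover have "0 \<le> 2 * A * (norm x)\<^sup>2" using MA by simp
      ultimately show "\<bar>x \<bullet> (X2 *v x)\<bar> \<le> (2 * A + K) * (norm x)\<^sup>2"
        unfolding abs_le_iff by (simp add: algebra_simps)
    qed
    \<comment> \<open>The times differ by at most \<open>\<delta>\<close>; the positions
      \<open>x1\<close> and \<open>x2\<close> enter only through the values of \<open>u\<close> and
      \<open>v\<close>.\<close>
    then have m4: "\<bar>G t1 (v t2 x2) (- snd g2) (- X2) - G t2 (v t2 x2) (- snd g2) (- X2)\<bar> < e"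
      using y12 uv g12 sX norm_fst_le[of "fst y1" "snd y1"] norm_fst_le[of "fst y2" "snd y2"]
      by (intro \<delta>(2)) (auto simp: t1_def t2_def R_def le_max_iff_disj)
    \<comment> \<open>The error is \<open>e * (4 * C + 3)\<close>: \<open>4 * C\<close> from the
      Lipschitz estimate, 2 from the time slopes, 1 from the change of time in
      \<open>G\<close>.\<close>
    show ?thesis
      using s1 s2 m1 m2 m3 m4 gp(2) by (simp add: algebra_simps abs_le_iff abs_less_iff) 
  qed
  then have "- fst p - C * (\<bar>u t0 y0 - v t0 y0\<bar> + norm (snd p) + 2 * A * norm I) \<le> 0"
    by (rule nonpos_if_le_small_multiples)
  then show ?thesis by (simp add: I_def)
qed

end

section \<open>Comparison on a slab\<close>

lemma second_order_remainder_bound: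
  fixes f f' f'' :: "real \<Rightarrow> real"
  assumes f: "\<And>x. \<bar>x - c\<bar> \<le> r \<Longrightarrow> (f has_real_derivative f' x) (at x)"
    and f': "\<And>x. \<bar>x - c\<bar> \<le> r \<Longrightarrow> (f' has_real_derivative f'' x) (at x)"
    and B: "\<And>x. \<bar>x - c\<bar> \<le> r \<Longrightarrow> \<bar>f'' x\<bar> \<le> B" and \<tau>: "\<bar>\<tau>\<bar> \<le> r"
  shows "\<bar>f (c + \<tau>) - f c - f' c * \<tau>\<bar> \<le> B * \<tau>\<^sup>2"
proof (cases "\<tau> = 0")
  case False
  define d where "d = (\<lambda>m::nat. if m = 0 then f else if m = 1 then f' else f'')"
  have "\<exists>t. (if c + \<tau> < c then c + \<tau> < t \<and> t < c else c < t \<and> t < c + \<tau>) \<and>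
      f (c + \<tau>) = (\<Sum>m<2. d m c / fact m * (c + \<tau> - c) ^ m) + d 2 t / fact 2 * (c + \<tau> - c)\<^sup>2"
  proof (rule Taylor[of 2 d f "c - r" "c + r" c "c + \<tau>"])
    show "\<forall>m t. m < 2 \<and> c - r \<le> t \<and> t \<le> c + r \<longrightarrow> (d m has_real_derivative d (Suc m) t) (at t)"
      using f f' by (auto simp: d_def less_2_cases_iff abs_le_iff)
  qed (use False \<tau> in \<open>auto simp: d_def\<close>)
  then obtain t where t': "if c + \<tau> < c then c + \<tau> < t \<and> t < c else c < t \<and> t < c + \<tau>"
    and "f (c + \<tau>) = (\<Sum>m<2. d m c / fact m * (c + \<tau> - c) ^ m) + d 2 t / fact 2 * (c + \<tau> - c)\<^sup>2"
    by blast
  then have t: "\<bar>t - c\<bar> \<le> r" "f (c + \<tau>) = f c + f' c * \<tau> + f'' t / 2 * \<tau>\<^sup>2"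
    using \<tau> by (auto simp: d_def numeral_2_eq_2 power2_eq_square split: if_splits)
  have "\<bar>f (c + \<tau>) - f c - f' c * \<tau>\<bar> = \<bar>f'' t\<bar> / 2 * \<tau>\<^sup>2" using t(2) by (simp add: abs_mult)
  also have "\<dots> \<le> B * \<tau>\<^sup>2" using B[OF t(1)] by (intro mult_right_mono) auto
  finally show ?thesis .
qed simp

lemma inverse_power_has_derivative:
  fixes t a :: real
  assumes "t \<noteq> a"
  shows "((\<lambda>t. (1 / (t - a)) ^ m) has_real_derivative - real m * (1 / (t - a)) ^ Suc m) (at t)"
proof -
  have "((\<lambda>t. 1 / (t - a)) has_real_derivative - (1 / (t - a))\<^sup>2) (at t)"
    using assms by (auto intro!: derivative_eq_intros simp: power2_eq_square)
  note d = DERIV_power[OF this, of m]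
  have "real m * (- x\<^sup>2 * x ^ (m - Suc 0)) = - real m * x ^ Suc m" for x :: real
    by (cases m) (simp_all add: power2_eq_square algebra_simps)
  with d show ?thesis by (simp only:)
qed

text \<open>The mixed term of the product is split by Young's inequality with only
  \<open>\<kappa>\<close> charged to space. The spatial coefficient must be nearly sharp because it
  enters the estimate for the difference as a Hessian; that estimate is free of \<open>M\<close>,
  which may be large.\<close>

lemma barrier_expansion:
  fixes y0 :: "'b::real_inner" and n :: nat
  assumes at0: "a < t0" and \<kappa>: "\<kappa> > 0"
  defines "k \<equiv> \<lambda>t. (1 / (t - a)) ^ n"
  obtains M r where "M \<ge> 0" "r > 0" "\<And>\<tau> h. norm (\<tau>, h) \<le> r \<Longrightarrow>
     k (t0 + \<tau>) * (1 + (norm (y0 + h))\<^sup>2) \<le> k t0 * (1 + (norm y0)\<^sup>2)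
       + (- real n * (1 / (t0 - a)) ^ Suc n) * (1 + (norm y0)\<^sup>2) * \<tau>
       + 2 * k t0 * (y0 \<bullet> h) + (k t0 + \<kappa>) * (norm h)\<^sup>2 + M * \<tau>\<^sup>2"
proof -
  define k1 where "k1 = (\<lambda>t. - real n * (1 / (t - a)) ^ Suc n)"
  define k2 where "k2 = (\<lambda>t. real n * (real (Suc n) * (1 / (t - a)) ^ Suc (Suc n)))"
  \<comment> \<open>Keeps times at least \<open>(t0 - a) / 2\<close> away from the singularity at
    \<open>a\<close>, so that \<open>B\<close> bounds the second derivative.\<close>
  define r where "r = min 1 ((t0 - a) / 2)"
  define B where "B = real n * (real (Suc n) * (2 / (t0 - a)) ^ Suc (Suc n))"
  have r: "r > 0" "r \<le> 1" using at0 by (auto simp: r_def)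
  have B0: "B \<ge> 0" using at0 by (simp add: B_def)
  have ta: "t - a \<ge> (t0 - a) / 2" "t \<noteq> a" if "\<bar>t - t0\<bar> \<le> r" for t
  proof -
    have "\<bar>t - t0\<bar> \<le> (t0 - a) / 2" using that by (simp add: r_def)
    then show "t - a \<ge> (t0 - a) / 2" using abs_ge_minus_self[of "t - t0"] by (simp add: field_simps)
    then show "t \<noteq> a" using at0 by auto
  qed
  have rem: "\<bar>k (t0 + \<tau>) - k t0 - k1 t0 * \<tau>\<bar> \<le> B * \<tau>\<^sup>2" if "\<bar>\<tau>\<bar> \<le> r" for \<tau>
  proof (rule second_order_remainder_bound[OF _ _ _ that])
    fix t assume t: "\<bar>t - t0\<bar> \<le> r"
    show "(k has_real_derivative k1 t) (at t)"
      unfolding k_def k1_def by (rule inverse_power_has_derivative[OF ta(2)[OF t]])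
    show "(k1 has_real_derivative k2 t) (at t)"
      unfolding k1_def k2_def
      by (rule DERIV_cong[OF DERIV_cmult[OF inverse_power_has_derivative[OF ta(2)[OF t]]]])
        (simp only: mult_minus_left mult_minus_right minus_minus)
    have "0 < 1 / (t - a)" "1 / (t - a) \<le> 2 / (t0 - a)"
      using ta(1)[OF t] at0 by (auto simp: field_simps)
    then have "0 \<le> k2 t" "k2 t \<le> B"
      unfolding k2_def B_def by (intro mult_nonneg_nonneg mult_left_mono power_mono; simp)+
    then show "\<bar>k2 t\<bar> \<le> B" by simp
  qed
  define K1 where "K1 = \<bar>k1 t0\<bar> + B"
  have lip: "\<bar>k (t0 + \<tau>) - k t0\<bar> \<le> K1 * \<bar>\<tau>\<bar>" if \<tau>: "\<bar>\<tau>\<bar> \<le> r" for \<tau>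
  proof -
    have "\<bar>k (t0 + \<tau>) - k t0\<bar> \<le> \<bar>k1 t0 * \<tau>\<bar> + B * \<tau>\<^sup>2" using rem[OF \<tau>] by linarith
    also have "B * \<tau>\<^sup>2 \<le> B * \<bar>\<tau>\<bar>"
    proof (rule mult_left_mono)
      have "\<bar>\<tau>\<bar> * \<bar>\<tau>\<bar> \<le> 1 * \<bar>\<tau>\<bar>" using \<tau> r by (intro mult_right_mono) auto
      then show "\<tau>\<^sup>2 \<le> \<bar>\<tau>\<bar>" by (simp add: power2_eq_square)
    qed (rule B0)
    finally show ?thesis by (simp add: K1_def abs_mult distrib_right)
  qed
  define Y where "Y = 1 + (norm y0)\<^sup>2"
  define c where "c = 2 * norm y0 + 1"
  define M where "M = B * Y + (K1 * c)\<^sup>2 / \<kappa>"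
  have Y: "Y > 0" by (simp add: Y_def add_pos_nonneg)
  have c: "c > 0" by (simp add: c_def add_nonneg_pos)
  have K1: "K1 \<ge> 0" using B0 by (simp add: K1_def)
  have "k (t0 + \<tau>) * (1 + (norm (y0 + h))\<^sup>2) \<le> k t0 * Y + k1 t0 * Y * \<tau>
       + 2 * k t0 * (y0 \<bullet> h) + (k t0 + \<kappa>) * (norm h)\<^sup>2 + M * \<tau>\<^sup>2" if n: "norm (\<tau>, h) \<le> r" for \<tau> h
  proof -
    have \<tau>: "\<bar>\<tau>\<bar> \<le> r" and h: "norm h \<le> 1"
      using n r norm_fst_le[of \<tau> h] norm_snd_le[of h \<tau>] by auto
    define z where "z = 2 * (y0 \<bullet> h) + (norm h)\<^sup>2"
    have z: "1 + (norm (y0 + h))\<^sup>2 = Y + z"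
      unfolding Y_def z_def power2_norm_eq_inner by (simp add: algebra_simps inner_commute)
    have "\<bar>z\<bar> \<le> 2 * \<bar>y0 \<bullet> h\<bar> + (norm h)\<^sup>2" unfolding z_def using abs_triangle_ineq[of "2 * (y0 \<bullet> h)" "(norm h)\<^sup>2"] by (simp add: abs_mult)
    also have "\<dots> \<le> 2 * (norm y0 * norm h) + norm h * norm h"
      using Cauchy_Schwarz_ineq2[of y0 h] by (simp add: power2_eq_square)
    also have "\<dots> \<le> 2 * (norm y0 * norm h) + 1 * norm h" using h by (intro add_left_mono mult_right_mono) auto
    also have "\<dots> = c * norm h" by (simp add: c_def algebra_simps)
    finally have zle: "\<bar>z\<bar> \<le> c * norm h" .
    have "(k (t0 + \<tau>) - k t0) * z \<le> \<bar>k (t0 + \<tau>) - k t0\<bar> * \<bar>z\<bar>"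
      by (metis abs_ge_self abs_mult)
    also have "\<dots> \<le> (K1 * \<bar>\<tau>\<bar>) * (c * norm h)" using lip[OF \<tau>] zle K1 by (intro mult_mono) auto
    also have "\<dots> \<le> \<kappa> * (norm h)\<^sup>2 + (K1 * c)\<^sup>2 / \<kappa> * \<tau>\<^sup>2"
    proof -
      define p q where "p = \<kappa> * norm h" and "q = K1 * c * \<bar>\<tau>\<bar>"
      have "p * q \<le> p\<^sup>2 + q\<^sup>2"
      proof -
        have "0 \<le> (p - q)\<^sup>2" "0 \<le> p\<^sup>2" "0 \<le> q\<^sup>2" by simp_all
        moreover have "(p - q)\<^sup>2 = p\<^sup>2 - 2 * (p * q) + q\<^sup>2" by (simp add: power2_diff)
        ultimately show ?thesis by linarith
      qed
      then have "\<kappa> * ((K1 * \<bar>\<tau>\<bar>) * (c * norm h)) \<le> \<kappa> * (\<kappa> * (norm h)\<^sup>2 + (K1 * c)\<^sup>2 / \<kappa> * \<tau>\<^sup>2)"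
        using \<kappa> by (simp add: p_def q_def power_mult_distrib power2_eq_square algebra_simps)
      then show ?thesis using \<kappa> by (subst (asm) mult_le_cancel_left_pos) auto
    qed
    finally have 1: "(k (t0 + \<tau>) - k t0) * z \<le> \<kappa> * (norm h)\<^sup>2 + (K1 * c)\<^sup>2 / \<kappa> * \<tau>\<^sup>2" .
    have "k (t0 + \<tau>) \<le> k t0 + k1 t0 * \<tau> + B * \<tau>\<^sup>2" using rem[OF \<tau>] by linarith
    then have 2: "k (t0 + \<tau>) * Y \<le> (k t0 + k1 t0 * \<tau> + B * \<tau>\<^sup>2) * Y" using Y by (intro mult_right_mono) auto
    have "k (t0 + \<tau>) * (Y + z) = k (t0 + \<tau>) * Y + k t0 * z + (k (t0 + \<tau>) - k t0) * z" by (simp add: algebra_simps)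
    also have "\<dots> \<le> (k t0 + k1 t0 * \<tau> + B * \<tau>\<^sup>2) * Y + k t0 * z + (\<kappa> * (norm h)\<^sup>2 + (K1 * c)\<^sup>2 / \<kappa> * \<tau>\<^sup>2)"
      using 1 2 by linarith
    also have "\<dots> = k t0 * Y + k1 t0 * Y * \<tau> + 2 * k t0 * (y0 \<bullet> h) + (k t0 + \<kappa>) * (norm h)\<^sup>2 + M * \<tau>\<^sup>2"
      by (simp add: z_def M_def algebra_simps)
    finally show ?thesis unfolding z .
  qed
  moreover have "M \<ge> 0" using B0 Y \<kappa> by (simp add: M_def)
  ultimately show thesis using that[of M r] r(1) unfolding Y_def k1_def by blast
qed

context slab_generator
begin

theorem slab_comparison:
  fixes u v :: "real \<Rightarrow> real ^ 'd \<Rightarrow> real"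
  assumes sub: "viscosity_subsolution a b G' u" and G': "\<And>t y p X. t \<in> {a..<b} \<Longrightarrow> symmetric_mat X \<Longrightarrow> G' t y p X \<le> G t y p X"
    and super: "viscosity_supersolution a b G v"
    and cont: "continuous_on ({a..<b} \<times> UNIV) (\<lambda>(t, y). u t y)" "continuous_on ({a..<b} \<times> UNIV) (\<lambda>(t, y). v t y)"
    and growth: "\<And>t y. t \<in> {a..<b} \<Longrightarrow> \<bar>u t y\<bar> \<le> K * (1 + norm y)" "\<And>t y. t \<in> {a..<b} \<Longrightarrow> \<bar>v t y\<bar> \<le> K * (1 + norm y)"
    and terminal: "\<And>y e. e > 0 \<Longrightarrow> \<forall>\<^sub>F (t, y') in at_left b \<times>\<^sub>F nhds y. u t y' - v t y' < e"
    and t: "t \<in> {a..<b}"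
  shows "u t y \<le> v t y"
proof -
  define I where "I = norm (mat 1 :: real ^ 'd ^ 'd)"
  have I: "I \<ge> 0" by (simp add: I_def)
  have "K * (1 + norm (0 :: real ^ 'd)) \<ge> 0" using growth(1)[of a 0] ab by force
  then have K: "K \<ge> 0" by simp
  \<comment> \<open>Relative to the touching value, the time derivative of the barrier contributes
    at least \<open>n / (b - a)\<close>. Against it stands \<open>C\<close> times 1 for the value, 1
    for the slope and \<open>2 * I\<close> for the Hessian.\<close>
  obtain n where n: "real n > (b - a) * (C * (2 + 2 * I)) + 1" using reals_Archimedean2 by blast
  have "(b - a) * (C * (2 + 2 * I)) \<ge> 0" using ab C_nonneg I by simp
  then have n1: "n \<ge> 1" using n by linarith
  have nC: "real n / (b - a) > C * (2 + 2 * I)" using n ab by (simp add: field_simps)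
  define k where "k = (\<lambda>t. (1 / (t - a)) ^ n)"
  define \<psi> where "\<psi> = (\<lambda>t (y :: real ^ 'd). k t * (1 + (norm y)\<^sup>2))"
  define D where "D = (\<lambda>t y. u t y - v t y)"
  have k: "k t > 0" if "t > a" for t using that by (simp add: k_def)
  have \<psi>: "\<psi> t y > 0" "k t \<le> \<psi> t y" if "t > a" for t y
    using k[OF that] by (auto simp: \<psi>_def add_pos_nonneg mult_le_cancel_left1)
  define kb where "kb = k b"
  have kb: "kb > 0" "\<And>t. a < t \<Longrightarrow> t < b \<Longrightarrow> kb \<le> k t"
    using k[OF ab] unfolding kb_def k_def by (auto intro!: power_mono simp: frac_le)
  have Dle: "D t y \<le> 2 * K * (1 + norm y)" if "t \<in> {a..<b}" for t y
    using growth(1)[OF that, of y] growth(2)[OF that, of y] unfolding D_def by (simp add: abs_le_iff)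
  have contD: "continuous_on ({a..<b} \<times> UNIV) (\<lambda>(t, y). D t y)"
    unfolding D_def case_prod_unfold using cont unfolding case_prod_unfold by (rule continuous_on_diff)
  have interior: "u s z \<le> v s z" if s: "a < s" "s < b" for s z
  proof (rule ccontr)
    assume "\<not> u s z \<le> v s z"
    then have Dpos: "D s z > 0" by (simp add: D_def)
    define \<theta> where "\<theta> = D s z / \<psi> s z"
    have \<theta>: "\<theta> > 0" using Dpos \<psi>(1)[OF s(1)] by (simp add: \<theta>_def)
    \<comment> \<open>Beyond \<open>R\<close> the multiple \<open>\<theta>\<close> of the barrier,
      quadratic in \<open>y\<close> with coefficient at least \<open>\<theta> * kb\<close>, exceeds
      the linear growth of \<open>u - v\<close>.\<close>
    define R where "R = max (norm z) (4 * K / (\<theta> * kb) + 1)"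
    have R: "R \<ge> 1" "R \<ge> 4 * K / (\<theta> * kb) + 1" "norm z \<le> R" using K \<theta> kb by (auto simp: R_def le_max_iff_disj)
    have yR: "norm y \<le> R" if ty: "a < t" "t < b" "D t y \<ge> \<theta> * \<psi> t y" for t y
    proof (rule ccontr)
      assume "\<not> norm y \<le> R"
      then have y: "norm y > R" by simp
      have "\<theta> * (kb * (norm y)\<^sup>2) \<le> \<theta> * \<psi> t y"
        unfolding \<psi>_def using \<theta> kb(1) kb(2)[OF ty(1,2)] by (intro mult_left_mono mult_mono) auto
      also have "\<dots> \<le> 2 * K * (1 + norm y)" using ty Dle[of t y] by simp
      also have "\<dots> \<le> 2 * K * (2 * norm y)" using y R K by (intro mult_left_mono) auto
      finally have "norm y * (\<theta> * kb * norm y) \<le> norm y * (4 * K)" by (simp add: power2_eq_square mult_ac)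
      then have "\<theta> * kb * norm y \<le> 4 * K" using y R by (subst (asm) mult_le_cancel_left_pos) auto
      then have "norm y \<le> 4 * K / (\<theta> * kb)" using \<theta> kb by (simp add: field_simps)
      then show False using y R by simp
    qed
    \<comment> \<open>Within \<open>c1\<close> of \<open>a\<close> the multiple
      \<open>\<theta>\<close> of the barrier, at least \<open>\<theta> / (t - a)\<close>, exceeds
      every value of \<open>u - v\<close> on the ball of radius \<open>R\<close>.\<close>
    define c1 where "c1 = min (min 1 (\<theta> / (2 * K * (1 + R) + 1))) (s - a)"
    have KR: "2 * K * (1 + R) \<ge> 0" using K R by simp
    have c1: "c1 > 0" using \<theta> KR s by (simp add: c1_def add_nonneg_pos)
    have tc1: "t \<ge> a + c1" if ty: "a < t" "t < b" "D t y \<ge> \<theta> * \<psi> t y" for t y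
    proof (rule ccontr)
      assume "\<not> t \<ge> a + c1"
      then have t1: "t - a < 1" "t - a < \<theta> / (2 * K * (1 + R) + 1)" by (auto simp: c1_def)
      have "1 \<le> 1 / (t - a)" using t1 ty by simp
      then have "1 / (t - a) \<le> k t" unfolding k_def using self_le_power[of "1 / (t - a)" n] n1 by simp
      then have "\<theta> * (1 / (t - a)) \<le> \<theta> * \<psi> t y"
        using \<theta> \<psi>(2)[OF ty(1), of y] by (intro mult_left_mono) auto
      also have "\<dots> \<le> 2 * K * (1 + norm y)" using ty Dle[of t y] by simp
      also have "\<dots> \<le> 2 * K * (1 + R)" using yR[OF ty] K by (intro mult_left_mono) auto
      finally have "\<theta> \<le> 2 * K * (1 + R) * (t - a)" using ty by (simp add: field_simps)
      also have "\<dots> \<le> (2 * K * (1 + R) + 1) * (t - a)" using ty by (intro mult_right_mono) auto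
      finally show False using t1(2) KR by (simp add: field_simps)
    qed
    \<comment> \<open>The terminal inequality is local in \<open>y\<close>; compactness of the ball
      makes one time interval before \<open>b\<close> serve all its points.\<close>
    have "\<exists>c2>0. \<forall>t y. b - c2 < t \<longrightarrow> t < b \<longrightarrow> norm y \<le> R \<longrightarrow> D t y < \<theta> * kb"
    proof -
      have "\<exists>d>0. \<exists>V. open V \<and> y \<in> V \<and> (\<forall>t y'. b - d < t \<longrightarrow> t < b \<longrightarrow> y' \<in> V \<longrightarrow> D t y' < \<theta> * kb)" for y
      proof -
        have "\<forall>\<^sub>F (t, y') in at_left b \<times>\<^sub>F nhds y. D t y' < \<theta> * kb"
          unfolding D_def using \<theta> kb by (intro terminal) simp
        then obtain P Q where PQ: "eventually P (at_left b)" "eventually Q (nhds y)"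
          "\<And>t y'. P t \<Longrightarrow> Q y' \<Longrightarrow> D t y' < \<theta> * kb"
          unfolding eventually_prod_filter by auto
        obtain l where l: "l < b" "\<And>t. l < t \<Longrightarrow> t < b \<Longrightarrow> P t"
          using PQ(1) unfolding eventually_at_left_field by blast
        obtain V where V: "open V" "y \<in> V" "\<And>y'. y' \<in> V \<Longrightarrow> Q y'"
          using PQ(2) unfolding eventually_nhds by blast
        show ?thesis using l V PQ(3) by (intro exI[of _ "b - l"] conjI exI[of _ V]) auto
      qed
      then obtain d V where dV: "\<And>y. d y > 0" "\<And>y. open (V y)" "\<And>y. y \<in> V y"
        "\<And>y t y'. b - d y < t \<Longrightarrow> t < b \<Longrightarrow> y' \<in> V y \<Longrightarrow> D t y' < \<theta> * kb" by metis
      have cov: "cball (0 :: real ^ 'd) R \<subseteq> (\<Union>y\<in>UNIV. V y)" using dV(3) by blast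
      obtain F where F: "finite F" "cball 0 R \<subseteq> (\<Union>y\<in>F. V y)"
        by (rule compactE_image[OF compact_cball _ cov]) (use dV(2) in auto)
      have "F \<noteq> {}" using F(2) R(1) by auto
      then have "Min (d ` F) > 0" using F(1) dV(1) by simp
      moreover have "D t y < \<theta> * kb" if ty: "b - Min (d ` F) < t" "t < b" "norm y \<le> R" for t y
      proof -
        have "y \<in> (\<Union>y\<in>F. V y)" using subsetD[OF F(2), of y] ty(3) by simp
        then obtain y' where y': "y' \<in> F" "y \<in> V y'" by blast
        have "Min (d ` F) \<le> d y'" using F(1) y'(1) by simp
        then show ?thesis using dV(4)[of y' t y] ty y' by simp
      qed
      ultimately show ?thesis by blast
    qed
    then obtain c2 where c2: "c2 > 0" "\<And>t y. b - c2 < t \<Longrightarrow> t < b \<Longrightarrow> norm y \<le> R \<Longrightarrow> D t y < \<theta> * kb"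
      by blast
    define S where "S = {a + c1..b - c2} \<times> cball (0 :: real ^ 'd) R"
    have Ssub: "S \<subseteq> {a..<b} \<times> UNIV" using c1 c2 by (auto simp: S_def)
    have inS: "(t, y) \<in> S" if ty: "a < t" "t < b" "D t y \<ge> \<theta> * \<psi> t y" for t y
    proof -
      have "\<theta> * kb \<le> \<theta> * \<psi> t y"
        using \<theta> kb(2)[OF ty(1,2)] \<psi>(2)[OF ty(1), of y] by (intro mult_left_mono) auto
      then have "\<not> D t y < \<theta> * kb" using ty(3) by simp
      then have "t \<le> b - c2" using c2(2)[of t y] ty(2) yR[OF ty] by fastforce
      then show ?thesis using tc1[OF ty] yR[OF ty] by (simp add: S_def)
    qed
    have compS: "compact S" unfolding S_def by (intro compact_Times) auto
    have "D s z \<ge> \<theta> * \<psi> s z" using \<psi>(1)[OF s(1), of z] by (simp add: \<theta>_def)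
    then have sS: "(s, z) \<in> S" by (rule inS[OF s])
    then have neS: "S \<noteq> {}" by blast
    define Q where "Q = (\<lambda>(t, y). D t y / \<psi> t y)"
    have contQ: "continuous_on S Q"
    proof -
      have "continuous_on S (\<lambda>q. D (fst q) (snd q))"
        using continuous_on_subset[OF contD Ssub] by (simp add: case_prod_unfold)
      moreover have "continuous_on S (\<lambda>q. \<psi> (fst q) (snd q))"
        unfolding \<psi>_def k_def using c1 by (intro continuous_intros) (auto simp: S_def)
      moreover have "\<psi> (fst q) (snd q) \<noteq> 0" if "q \<in> S" for q
        using \<psi>(1)[of "fst q" "snd q"] that c1 by (auto simp: S_def)
      ultimately show ?thesis unfolding Q_def case_prod_unfold by (intro continuous_on_divide) auto
    qed
    obtain q where q: "q \<in> S" "\<forall>q'\<in>S. Q q' \<le> Q q"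
      using continuous_attains_sup[OF compS neS contQ] by blast
    obtain t0 y0 where q0: "q = (t0, y0)" by fastforce
    have t0: "a < t0" "t0 < b" using q(1) c1 c2 by (auto simp: q0 S_def)
    define \<Theta> where "\<Theta> = D t0 y0 / \<psi> t0 y0"
    have D0: "D t0 y0 = \<Theta> * \<psi> t0 y0" using \<psi>(1)[OF t0(1), of y0] by (simp add: \<Theta>_def)
    have max: "D t y / \<psi> t y \<le> \<Theta>" if "(t, y) \<in> S" for t y
      using bspec[OF q(2) that] by (simp add: q0 \<Theta>_def Q_def)
    have \<Theta>: "\<Theta> \<ge> \<theta>" using max[OF sS] by (simp add: \<theta>_def)
    \<comment> \<open>Outside \<open>S\<close> the quotient is below \<open>\<theta>\<close>, so a
      maximum over \<open>S\<close> is one over the whole open slab.\<close>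
    have glob: "D t y \<le> \<Theta> * \<psi> t y" if ty: "a < t" "t < b" for t y
    proof (cases "D t y \<ge> \<theta> * \<psi> t y")
      case True
      then show ?thesis using max[OF inS[OF ty True]] \<psi>(1)[OF ty(1), of y] by (simp add: field_simps)
    next
      case False
      moreover have "\<theta> * \<psi> t y \<le> \<Theta> * \<psi> t y"
        using \<psi>(1)[OF ty(1), of y] by (intro mult_right_mono \<Theta>) simp
      ultimately show ?thesis by linarith
    qed
    define P where "P = \<Theta> * \<psi> t0 y0"
    have P: "P > 0" using \<theta> \<Theta> \<psi>(1)[OF t0(1), of y0] by (simp add: P_def)
    define q0 where "q0 = 1 / (t0 - a)"
    have "P * (real n * q0 - C * (2 + 2 * I)) \<le> e * (2 * C * (\<Theta> + 1) * I)" if e: "e > 0" for e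
    proof -
      obtain M r where M: "M \<ge> 0" and r: "r > 0" and exp: "\<And>\<tau> h. norm (\<tau>, h) \<le> r \<Longrightarrow>
         k (t0 + \<tau>) * (1 + (norm (y0 + h))\<^sup>2) \<le> k t0 * (1 + (norm y0)\<^sup>2)
         + (- real n * (1 / (t0 - a)) ^ Suc n) * (1 + (norm y0)\<^sup>2) * \<tau>
         + 2 * k t0 * (y0 \<bullet> h) + (k t0 + e) * (norm h)\<^sup>2 + M * \<tau>\<^sup>2"
        using barrier_expansion[OF t0(1) e, of n y0] unfolding k_def by blast
      define r' where "r' = min r (min ((t0 - a) / 2) ((b - t0) / 2))"
      have r': "r' > 0" "r' \<le> r" "r' < t0 - a" "r' < b - t0" using r t0 by (auto simp: r'_def min_less_iff_disj)
      \<comment> \<open>\<open>p\<close> is the gradient of \<open>\<Theta> * \<psi>\<close> at the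
        touching point. Both \<open>A\<close> and the time coefficient
        \<open>\<Theta> * M + e\<close> carry an extra \<open>e\<close>, which pays for the
        strictness of the maximum that the difference estimate demands.\<close>
      define p where "p = (\<Theta> * ((- real n * (1 / (t0 - a)) ^ Suc n) * (1 + (norm y0)\<^sup>2)), (2 * \<Theta> * k t0) *\<^sub>R y0)"
      define A where "A = \<Theta> * (k t0 + e) + e"
      have \<Theta>0: "\<Theta> > 0" using \<theta> \<Theta> by simp
      have A: "A \<ge> 0" using \<Theta>0 e k[OF t0(1)] by (simp add: A_def)
      have "- fst p \<le> C * (\<bar>u t0 y0 - v t0 y0\<bar> + norm (snd p) + 2 * A * norm (mat 1 :: real ^ 'd ^ 'd))"
      proof (rule difference_subsolution[OF sub G' super cont t0 r'(1) e _ A])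
        show "\<Theta> * M + e \<ge> 0" using \<Theta>0 M e by simp
        fix \<tau> :: real and h :: "real ^ 'd" assume n: "norm (\<tau>, h) \<le> r'"
        have "\<bar>\<tau>\<bar> \<le> r'" using n norm_fst_le[of \<tau> h] by simp
        then have tt: "a < t0 + \<tau>" "t0 + \<tau> < b" using r' by auto
        have nn: "(norm (\<tau>, h))\<^sup>2 = \<tau>\<^sup>2 + (norm h)\<^sup>2" by (simp add: norm_prod_def)
        have "D (t0 + \<tau>) (y0 + h) \<le> \<Theta> * (k (t0 + \<tau>) * (1 + (norm (y0 + h))\<^sup>2))"
          using glob[OF tt] unfolding \<psi>_def .
        also have "\<dots> \<le> \<Theta> * (k t0 * (1 + (norm y0)\<^sup>2)
         + (- real n * (1 / (t0 - a)) ^ Suc n) * (1 + (norm y0)\<^sup>2) * \<tau>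
         + 2 * k t0 * (y0 \<bullet> h) + (k t0 + e) * (norm h)\<^sup>2 + M * \<tau>\<^sup>2)"
          using \<Theta>0 n r'(2) by (intro mult_left_mono exp) auto
        also have "\<dots> = D t0 y0 + p \<bullet> (\<tau>, h) + (\<Theta> * M + e) * \<tau>\<^sup>2 + A * (norm h)\<^sup>2 - e * (norm (\<tau>, h))\<^sup>2"
          unfolding D0 nn p_def A_def \<psi>_def inner_Pair by (simp add: algebra_simps)
        finally show "u (t0 + \<tau>) (y0 + h) - v (t0 + \<tau>) (y0 + h) \<le> u t0 y0 - v t0 y0 + p \<bullet> (\<tau>, h)
            + (\<Theta> * M + e) * \<tau>\<^sup>2 + A * (norm h)\<^sup>2 - e * (norm (\<tau>, h))\<^sup>2"
          unfolding D_def .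
      qed
      moreover have "- fst p = P * (real n * q0)"
        by (simp add: p_def P_def \<psi>_def k_def q0_def)
      moreover have "\<bar>u t0 y0 - v t0 y0\<bar> = P" using D0 P unfolding D_def P_def by simp
      moreover have "norm (snd p) \<le> P"
      proof -
        have "0 \<le> (norm y0 - 1)\<^sup>2" by simp
        then have "2 * norm y0 \<le> 1 + (norm y0)\<^sup>2" by (simp add: power2_diff)
        then have "\<Theta> * k t0 * (2 * norm y0) \<le> \<Theta> * k t0 * (1 + (norm y0)\<^sup>2)"
          using \<Theta>0 k[OF t0(1)] by (intro mult_left_mono) auto
        then show ?thesis using \<Theta>0 k[OF t0(1)] by (simp add: p_def P_def \<psi>_def mult_ac)
      qed
      moreover have "2 * A * I \<le> 2 * I * P + e * (2 * (\<Theta> + 1) * I)"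
      proof -
        have "\<Theta> * k t0 \<le> P" unfolding P_def using \<Theta>0 \<psi>(2)[OF t0(1), of y0] by (intro mult_left_mono) auto
        then have "2 * I * (\<Theta> * k t0) \<le> 2 * I * P" using I by (intro mult_left_mono) auto
        then show ?thesis by (simp add: A_def algebra_simps)
      qed
      ultimately have "P * (real n * q0) \<le> C * (P + P + 2 * A * I)" "2 * A * I \<le> 2 * I * P + e * (2 * (\<Theta> + 1) * I)"
        using C_nonneg unfolding I_def by (auto elim!: order_trans intro!: mult_left_mono)
      moreover have "C * (P + P + 2 * A * I) \<le> C * (P + P + (2 * I * P + e * (2 * (\<Theta> + 1) * I)))"
        using calculation(2) C_nonneg by (intro mult_left_mono) auto
      ultimately show ?thesis by (simp add: algebra_simps)
    qed
    then have "P * (real n * q0 - C * (2 + 2 * I)) \<le> 0" by (rule nonpos_if_le_small_multiples)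
    then have "real n * q0 \<le> C * (2 + 2 * I)" using P by (simp add: mult_le_0_iff)
    moreover have "real n / (b - a) \<le> real n * q0"
      using t0 ab by (simp add: q0_def frac_le)
    ultimately show False using nC by simp
  qed
  show ?thesis
  proof (cases "t = a")
    case False
    then show ?thesis using interior[of t y] t by simp
  next
    \<comment> \<open>The barrier is singular at \<open>a\<close>, so the left end is reached from
      the interior by continuity.\<close>
    case True
    define w where "w = (\<lambda>s. D s y)"
    have "continuous_on {a..<b} w" unfolding w_def
    proof (rule continuous_on_compose2[OF contD[unfolded case_prod_unfold], of _ "\<lambda>s. (s, y)", unfolded fst_conv snd_conv])
      show "continuous_on {a..<b} (\<lambda>s. (s, y))" by (intro continuous_intros)
    qed auto
    then have "continuous_on {a..(a + b) / 2} w"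
      by (rule continuous_on_subset) (use ab in auto)
    then have lim: "(w \<longlongrightarrow> w a) (at_right a)"
      by (rule continuous_on_Icc_at_rightD) (use ab in simp)
    have "\<forall>\<^sub>F s in at_right a. w s \<le> 0"
      using ab interior unfolding w_def D_def by (intro eventually_at_rightI[of a b]) auto
    then have "w a \<le> 0" using tendsto_upperbound[OF lim] by simp
    then show ?thesis by (simp add: True w_def D_def)
  qed
qed

end

section \<open>Comparison on a grid\<close>

locale time_grid =
  fixes T :: real and \<pi> :: grids and n :: nat
  assumes first: "\<pi> n 0 = 0" and last: "\<pi> n n = T"
    and mono: "strict_mono_on {0..n} (\<pi> n)"
begin

lemma less: "i < j \<Longrightarrow> j \<le> n \<Longrightarrow> \<pi> n i < \<pi> n j"
  using mono by (auto simp: strict_mono_on_def)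

lemma le: "i \<le> j \<Longrightarrow> j \<le> n \<Longrightarrow> \<pi> n i \<le> \<pi> n j"
  using less[of i j] by (cases "i = j") auto

lemma bounds: "i \<le> n \<Longrightarrow> 0 \<le> \<pi> n i \<and> \<pi> n i \<le> T"
  using le[of 0 i] le[of i n] first last by auto

lemma eta_grid: "i \<le> n \<Longrightarrow> eta \<pi> n (\<pi> n i) = \<pi> n i"
  unfolding eta_def by (rule Max_eqI) auto

lemma eta_slab:
  assumes "i < n" "\<pi> n i \<le> s" "s < \<pi> n (Suc i)"
  shows "eta \<pi> n s = \<pi> n i"
  unfolding eta_def
proof (rule Max_eqI)
  fix y assume "y \<in> {s' \<in> \<pi> n ` {0..n}. s' \<le> s}"
  then obtain j where j: "j \<le> n" "y = \<pi> n j" "\<pi> n j \<le> s" by auto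
  have "j \<le> i"
    using j assms le[of "Suc i" j] by (meson not_less_eq_eq not_less order_trans)
  then show "y \<le> \<pi> n i" using j le[of j i] assms by simp
qed (use assms in auto)

lemma next_point_slab:
  assumes "i < n" "\<pi> n i \<le> s" "s < \<pi> n (Suc i)"
  shows "next_point \<pi> n s = \<pi> n (Suc i)"
  unfolding next_point_def
proof (rule Min_eqI)
  fix y assume "y \<in> {s' \<in> \<pi> n ` {0..n}. s < s'}"
  then obtain j where j: "j \<le> n" "y = \<pi> n j" "s < \<pi> n j" by auto
  have "Suc i \<le> j"
    using j assms le[of j i] by (meson not_less_eq_eq not_less order_trans less_imp_le)
  then show "\<pi> n (Suc i) \<le> y" using j le[of "Suc i" j] by simp
qed (use assms in auto)

lemma in_slab_right:
  assumes "m \<le> n" "0 \<le> s" "s < \<pi> n m"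
  obtains i where "i < m" "\<pi> n i \<le> s" "s < \<pi> n (Suc i)"
proof -
  have "\<exists>i<m. \<pi> n i \<le> s \<and> s < \<pi> n (Suc i)" using assms
  proof (induction m)
    case (Suc m)
    then show ?case by (cases "s < \<pi> n m") (auto intro: less_SucI)
  qed (use first in auto)
  then show thesis using that by blast
qed

lemma in_slab_left:
  assumes "m \<le> n" "0 < s" "s \<le> \<pi> n m"
  obtains i where "i < m" "\<pi> n i < s" "s \<le> \<pi> n (Suc i)"
proof -
  have "\<exists>i<m. \<pi> n i < s \<and> s \<le> \<pi> n (Suc i)" using assms
  proof (induction m)
    case (Suc m)
    then show ?case by (cases "s \<le> \<pi> n m") (auto intro: less_SucI)
  qed (use first in auto)
  then show thesis using that by blast
qed

lemma Proj_after: "t \<le> s \<Longrightarrow> Proj S \<pi> n t x s = x t"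
  by (simp add: Proj_def)

section \<open>Projected paths\<close>

text \<open>The slab is closed on the right, although \<open>eta\<close> jumps to the next grid
  point there: the interpolation formula holds from both sides, so the pieces can be glued
  continuously.\<close>

lemma Proj_continuous_slab:
  assumes "m \<le> n" "i < m" "\<pi> n i \<le> s" "s \<le> \<pi> n (Suc i)"
  shows "Proj Continuous_Paths \<pi> n (\<pi> n m) x s = x (\<pi> n i) +
    ((s - \<pi> n i) / (\<pi> n (Suc i) - \<pi> n i)) *\<^sub>R (x (\<pi> n (Suc i)) - x (\<pi> n i))"
proof (cases "s < \<pi> n (Suc i)")
  case True
  then have "s < \<pi> n m" using le[of "Suc i" m] assms by simp
  then show ?thesis
    using eta_slab[of i s] next_point_slab[of i s] assms True le[of "Suc i" m]
    by (simp add: Proj_def Let_def min_def)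
next
  case False
  then have s: "s = \<pi> n (Suc i)" using assms by simp
  have d: "\<pi> n (Suc i) - \<pi> n i \<noteq> 0" using less[of i "Suc i"] assms by simp
  show ?thesis
  proof (cases "Suc i = m")
    case True
    then show ?thesis using d by (simp add: s Proj_after)
  next
    case False
    then have "Suc i < m" using assms by simp
    then have "s < \<pi> n m" "eta \<pi> n s = s" using less[of "Suc i" m] eta_grid[of "Suc i"] assms s by auto
    then show ?thesis using d by (simp add: Proj_def Let_def s)
  qed
qed

text \<open>\<open>x\<close> is arbitrary because jump conditions evaluate solutions at concatenated
  paths, which may be discontinuous even when the paths of the space are continuous.\<close>

lemma Proj_in_Omega:
  assumes m: "m \<le> n"
  shows "Proj S \<pi> n (\<pi> n m) x \<in> Omega T S"
proof (cases S)
  case Continuous_Paths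
  define f where "f = Proj Continuous_Paths \<pi> n (\<pi> n m) x"
  have "continuous_on {0..\<pi> n j} f" if "j \<le> m" for j
    using that
  proof (induction j)
    case (Suc j)
    have "continuous_on {\<pi> n j..\<pi> n (Suc j)} (\<lambda>s. x (\<pi> n j) +
        ((s - \<pi> n j) / (\<pi> n (Suc j) - \<pi> n j)) *\<^sub>R (x (\<pi> n (Suc j)) - x (\<pi> n j)))"
      using less[of j "Suc j"] Suc.prems m by (intro continuous_intros) auto
    then have "continuous_on {\<pi> n j..\<pi> n (Suc j)} f"
      by (rule continuous_on_eq) (use Suc.prems in \<open>simp add: f_def Proj_continuous_slab[OF m, of j]\<close>)
    moreover have "continuous_on {0..\<pi> n j} f" using Suc by simp
    ultimately have "continuous_on ({0..\<pi> n j} \<union> {\<pi> n j..\<pi> n (Suc j)}) f"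
      by (intro continuous_on_closed_Un) auto
    also have "{0..\<pi> n j} \<union> {\<pi> n j..\<pi> n (Suc j)} = {0..\<pi> n (Suc j)}"
      using bounds[of j] le[of j "Suc j"] Suc.prems m by (intro ivl_disj_un_two_touch) auto
    finally show ?case .
  qed (simp add: first)
  then have 1: "continuous_on {0..\<pi> n m} f" by simp
  have 2: "continuous_on {\<pi> n m..T} f"
    by (rule continuous_on_eq[OF continuous_on_const[of _ "x (\<pi> n m)"]]) (auto simp: f_def Proj_after)
  have "continuous_on ({0..\<pi> n m} \<union> {\<pi> n m..T}) f"
    using 1 2 by (intro continuous_on_closed_Un) auto
  also have "{0..\<pi> n m} \<union> {\<pi> n m..T} = {0..T}"
    using bounds[OF m] by (intro ivl_disj_un_two_touch) auto
  finally show ?thesis by (simp add: Omega_def Continuous_Paths f_def)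
next
  case (Cadlag_Paths \<mu>)
  define f where "f = Proj (Cadlag_Paths \<mu>) \<pi> n (\<pi> n m) x"
  have after: "f s = x (\<pi> n m)" if "\<pi> n m \<le> s" for s
    using that by (simp add: f_def Proj_after)
  have slab: "f s = x (\<pi> n i)" if "i < m" "\<pi> n i \<le> s" "s < \<pi> n (Suc i)" for i s
  proof -
    have "s < \<pi> n m" using that le[of "Suc i" m] m by simp
    then show ?thesis using that m eta_slab[of i s] by (simp add: f_def Proj_def)
  qed
  have "(f \<longlongrightarrow> f t) (at_right t)" if t: "t \<in> {0..<T}" for t
  proof (cases "\<pi> n m \<le> t")
    case True
    then have "\<forall>\<^sub>F s in at_right t. f s = f t"
      using after by (auto simp: eventually_at_filter)
    then show ?thesis by (rule tendsto_eventually)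
  next
    case False
    then obtain i where i: "i < m" "\<pi> n i \<le> t" "t < \<pi> n (Suc i)" using in_slab_right[OF m, of t] t by auto
    have "\<forall>\<^sub>F s in at_right t. f s = f t"
      using i slab by (intro eventually_at_rightI[of t "\<pi> n (Suc i)"]) auto
    then show ?thesis by (rule tendsto_eventually)
  qed
  moreover have "\<exists>l. (f \<longlongrightarrow> l) (at_left t)" if t: "t \<in> {0<..T}" for t
  proof (cases "\<pi> n m < t")
    case True
    then have "\<forall>\<^sub>F s in at_left t. f s = x (\<pi> n m)"
      using after by (intro eventually_at_leftI[of "\<pi> n m" t]) auto
    then show ?thesis by (intro exI tendsto_eventually)
  next
    case False
    then obtain i where i: "i < m" "\<pi> n i < t" "t \<le> \<pi> n (Suc i)" using in_slab_left[OF m, of t] t by auto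
    have "\<forall>\<^sub>F s in at_left t. f s = x (\<pi> n i)"
      using i slab by (intro eventually_at_leftI[of "\<pi> n i" t]) auto
    then show ?thesis by (intro exI tendsto_eventually)
  qed
  ultimately show ?thesis by (simp add: Omega_def Cadlag_Paths cadlag_on_def f_def)
qed

end

section \<open>Backward induction over the slabs\<close>

lemma semicontinuous_imp_continuous:
  assumes "lsc_on A f" "usc_on A f"
  shows "continuous_on A f"
  unfolding continuous_on_def
proof
  fix p assume "p \<in> A"
  then show "(f \<longlongrightarrow> f p) (at p within A)"
    using assms unfolding lsc_on_def usc_on_def by (intro order_tendstoI) auto
qed

lemma jump_condition_eventually:
  assumes "jump_condition T S \<pi> n \<delta> u" "x \<in> Omega T S" "i < n" "e > 0"
  shows "\<forall>\<^sub>F (t, y') in at_left (\<pi> n (Suc i)) \<times>\<^sub>F nhds y.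
    - e < \<delta> * (u t x y' - grid_value S \<pi> n u (\<pi> n (Suc i))
                 (path_concat (\<pi> n (Suc i)) (Proj S \<pi> n T x) (\<lambda>_. y)) y)"
proof -
  have "0 \<le> Liminf (at_left (\<pi> n (Suc i)) \<times>\<^sub>F nhds y)
          (\<lambda>(t, y'). ereal (\<delta> * (u t x y'
             - grid_value S \<pi> n u (\<pi> n (Suc i))
                 (path_concat (\<pi> n (Suc i)) (Proj S \<pi> n T x) (\<lambda>_. y)) y)))"
    using assms(1-3) unfolding jump_condition_def by blast
  then have "\<forall>\<^sub>F q in at_left (\<pi> n (Suc i)) \<times>\<^sub>F nhds y. ereal (- e) < (case q of (t, y') \<Rightarrow> ereal (\<delta> * (u t x y'
             - grid_value S \<pi> n u (\<pi> n (Suc i))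
                 (path_concat (\<pi> n (Suc i)) (Proj S \<pi> n T x) (\<lambda>_. y)) y)))"
    unfolding le_Liminf_iff using assms(4) by simp
  then show ?thesis by eventually_elim auto
qed

lemma (in time_grid) pi_comparison:
  fixes u v :: "real \<Rightarrow> ('d::finite) path \<Rightarrow> real ^ 'd \<Rightarrow> real"
  assumes F1: "F_regular T S L F1" "F_monotone T S F1"
    and F12: "\<And>t x y z \<gamma>. t \<in> {0..T} \<Longrightarrow> x \<in> Omega T S \<Longrightarrow> symmetric_mat \<gamma> \<Longrightarrow> F2 t x y z \<gamma> \<le> F1 t x y z \<gamma>"
    and u: "u \<in> C_n T S \<pi> n Lu" "Lu > 0" "pi_subsolution T S \<pi> n F2 u"
    and v: "v \<in> C_n T S \<pi> n Lv" "Lv > 0" "pi_supersolution T S \<pi> n F1 v"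
    and terminal: "\<And>x. x \<in> Omega T S \<Longrightarrow> u T x (x T) \<le> v T x (x T)"
    and tx: "t \<in> {0..T}" "x \<in> Omega T S" "relevant T t x y"
  shows "u t x y \<le> v t x y"
proof -
  \<comment> \<open>\<open>j\<close> counts the slabs from \<open>T\<close> downwards. The claim is
    made for all paths at once, since the jump at the end of a slab leads to a path other than
    \<open>x\<close>.\<close>
  have step: "u t x y \<le> v t x y" if "j \<le> n" "t \<in> {\<pi> n (n - j)..T}" "x \<in> Omega T S" "relevant T t x y" for j t x y
    using that
  proof (induction j arbitrary: t x y)
    case 0
    then have "t = T" "y = x T" by (auto simp: last relevant_def)
    then show ?case using terminal 0 by simp
  next
    case (Suc j)
    define i where "i = n - Suc j"
    have i: "i < n" "n - j = Suc i" using Suc.prems by (auto simp: i_def)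
    define a b where "a = \<pi> n i" and "b = \<pi> n (Suc i)"
    have abT: "a < b" "0 \<le> a" "b \<le> T" using less[of i "Suc i"] bounds[of i] bounds[of "Suc i"] i by (auto simp: a_def b_def)
    show ?case
    proof (cases "t < b")
      case False
      then show ?thesis using Suc.IH[of t x y] Suc.prems i by (auto simp: b_def)
    next
      case True
      then have t: "t \<in> {a..<b}" using Suc.prems by (simp add: a_def i_def)
      define xh where "xh = Proj S \<pi> n a x"
      have xh: "xh \<in> Omega T S" unfolding xh_def a_def using i by (intro Proj_in_Omega) simp
      have inT: "s \<in> {0..T}" if "s \<in> {a..<b}" for s using that abT by auto
      have Fn: "F_n S \<pi> n F s x r p X = F s xh r p X" if "s \<in> {a..<b}" for F :: "'d generator" and s r p X
        using eta_slab[OF i(1), of s] that unfolding F_n_def xh_def a_def b_def by simp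
      \<comment> \<open>The absolute value and the added 1 make \<open>R\<close> positive, as the
        local Lipschitz bound requires, whatever the value of the supremum.\<close>
      define R where "R = \<bar>sup_norm T xh\<bar> + 1"
      have R: "R > 0" "sup_norm T xh \<le> R" by (auto simp: R_def)
      obtain C where C: "C > 0" "\<And>s r p X r' p' X'. s \<in> {0..T} \<Longrightarrow> symmetric_mat X \<Longrightarrow> symmetric_mat X' \<Longrightarrow>
          \<bar>F1 s xh r p X - F1 s xh r' p' X'\<bar> \<le> C * (\<bar>r - r'\<bar> + norm (p - p') + norm (X - X'))"
        using F1(1) R xh unfolding F_regular_def by meson
      interpret slab_generator a b C "\<lambda>s. F_n S \<pi> n F1 s x"
      proof
        show "a < b" by (rule abT(1))
        show "C \<ge> 0" using C by simp
        show "continuous_on {a..<b} (\<lambda>s. F_n S \<pi> n F1 s x r p X)" if "symmetric_mat X" for r p X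
        proof -
          have "continuous_on {0..T} (\<lambda>s. F1 s xh r p X)"
            using F1(1) xh that unfolding F_regular_def by blast
          then have "continuous_on {a..<b} (\<lambda>s. F1 s xh r p X)"
            by (rule continuous_on_subset) (use inT in blast)
          then show ?thesis by (rule continuous_on_eq) (simp add: Fn)
        qed
        show "\<bar>F_n S \<pi> n F1 s x r p X - F_n S \<pi> n F1 s x r' p' X'\<bar> \<le> C * (\<bar>r - r'\<bar> + norm (p - p') + norm (X - X'))"
          if "s \<in> {a..<b}" "symmetric_mat X" "symmetric_mat X'" for s r p X r' p' X'
          unfolding Fn[OF that(1)] using that inT by (intro C) auto
        show "F_n S \<pi> n F1 s x r p X \<le> F_n S \<pi> n F1 s x r p X'"
          if "s \<in> {a..<b}" "symmetric_mat X" "symmetric_mat X'" "mat_le X X'" for s r p X X'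
          unfolding Fn[OF that(1)] using F1(2) that inT xh unfolding F_monotone_def by blast
      qed
      have x: "x \<in> Omega T S" by (rule Suc.prems)
      have growth: "\<bar>w s x z\<bar> \<le> (Lu + Lv) * (1 + \<bar>sup_norm T x\<bar>) * (1 + norm z)"
        if "w \<in> C_n T S \<pi> n L'" "s \<in> {a..<b}" "L' \<ge> 0" "L' \<le> Lu + Lv" for w L' s z
      proof -
        have "s < T" using that(2) abT(3) by auto
        then have "\<bar>w s x z\<bar> \<le> L' * (1 + sup_norm T x + norm z)"
          using that(1) inT[OF that(2)] x unfolding C_n_def LSC_n_def grid_functions_def relevant_def by blast
        also have "\<dots> \<le> L' * ((1 + \<bar>sup_norm T x\<bar>) * (1 + norm z))"
          using that(3) by (intro mult_left_mono) (auto simp: algebra_simps intro: add_increasing2)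
        also have "\<dots> \<le> (Lu + Lv) * ((1 + \<bar>sup_norm T x\<bar>) * (1 + norm z))"
          using that(4) by (intro mult_right_mono) auto
        finally show ?thesis by (simp add: mult.assoc)
      qed
      have cont: "continuous_on ({a..<b} \<times> UNIV) (\<lambda>(s, z). w s x z)" if "w \<in> C_n T S \<pi> n L'" for w L'
        using that x i(1) unfolding C_n_def LSC_n_def USC_n_def slab_def a_def b_def
        by (intro semicontinuous_imp_continuous) auto
      have jump: "\<forall>\<^sub>F (s, z') in at_left b \<times>\<^sub>F nhds z. u s x z' - v s x z' < e" if "e > 0" for z e
      proof -
        \<comment> \<open>The path continued by the constant \<open>z\<close> from \<open>b\<close>
          on. Its projection \<open>zh\<close> lies in \<open>Omega\<close> and ends at
          \<open>z\<close>, so the induction hypothesis applies even for \<open>b = T\<close>, where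
          only the end value of the path is relevant.\<close>
        define zp where "zp = path_concat b (Proj S \<pi> n T x) (\<lambda>_. z)"
        define zh where "zh = Proj S \<pi> n (eta \<pi> n b) zp"
        have eb: "eta \<pi> n b = b" unfolding b_def using i by (intro eta_grid) simp
        have zh: "zh \<in> Omega T S" unfolding zh_def eb unfolding b_def using i by (intro Proj_in_Omega) simp
        have "relevant T b zh z"
          using abT by (auto simp: relevant_def zh_def eb Proj_after zp_def path_concat_def)
        then have le: "grid_value S \<pi> n u b zp z \<le> grid_value S \<pi> n v b zp z"
          unfolding grid_value_def zh_def[symmetric]
          using Suc.IH[of b zh z] zh Suc.prems i abT by (simp add: b_def)
        have e2: "e / 2 > 0" using that by simp
        have "jump_condition T S \<pi> n (- 1) u" using u(3) by (simp add: pi_subsolution_def)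
        from jump_condition_eventually[OF this x i(1) e2, of z]
        have ju: "\<forall>\<^sub>F (s, z') in at_left b \<times>\<^sub>F nhds z. - (e / 2) < - 1 * (u s x z' - grid_value S \<pi> n u b zp z)"
          unfolding b_def zp_def .
        have "jump_condition T S \<pi> n 1 v" using v(3) by (simp add: pi_supersolution_def)
        from jump_condition_eventually[OF this x i(1) e2, of z]
        have jv: "\<forall>\<^sub>F (s, z') in at_left b \<times>\<^sub>F nhds z. - (e / 2) < 1 * (v s x z' - grid_value S \<pi> n v b zp z)"
          unfolding b_def zp_def .
        from ju jv show ?thesis by eventually_elim (use le in auto)
      qed
      show ?thesis
      proof (rule slab_comparison[OF _ _ _ cont[OF u(1)] cont[OF v(1)] _ _ jump t])
        show "viscosity_subsolution a b (\<lambda>s. F_n S \<pi> n F2 s x) (\<lambda>s. u s x)"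
          using u(3) x i(1) unfolding pi_subsolution_def a_def b_def by blast
        show "viscosity_supersolution a b (\<lambda>s. F_n S \<pi> n F1 s x) (\<lambda>s. v s x)"
          using v(3) x i(1) unfolding pi_supersolution_def a_def b_def by blast
        show "F_n S \<pi> n F2 s x r p X \<le> F_n S \<pi> n F1 s x r p X" if "s \<in> {a..<b}" "symmetric_mat X" for s r p X
          unfolding Fn[OF that(1)] using that inT xh by (intro F12) auto
        show "\<bar>u s x z\<bar> \<le> (Lu + Lv) * (1 + \<bar>sup_norm T x\<bar>) * (1 + norm z)" if "s \<in> {a..<b}" for s z
          using growth[OF u(1) that] u(2) v(2) by simp
        show "\<bar>v s x z\<bar> \<le> (Lu + Lv) * (1 + \<bar>sup_norm T x\<bar>) * (1 + norm z)" if "s \<in> {a..<b}" for s z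
          using growth[OF v(1) that] u(2) v(2) by simp
      qed
    qed
  qed
  show ?thesis using step[of n t x y] tx by (simp add: first)
qed

theorem proposition2p8:
  fixes T L :: real
    and S :: path_space
    and \<pi> :: grids
    and F1 F2 :: "('d::finite) generator"
    and g1 g2 :: "'d path \<Rightarrow> real"
    and v1 v2 :: "real \<Rightarrow> 'd path \<Rightarrow> real"
  assumes "T > 0" and "L > 0"
    and "grid_sequence T \<pi>"
    and "admissible_space T \<pi> S"
    and "g1 \<in> C_L T S L" and "g2 \<in> C_L T S L"
    and "assumption_F TYPE('e1::finite) T S L F1"
    and "assumption_F TYPE('e2::finite) T S L F2"
    and "pi_approximate_viscosity_solution T S \<pi> F1 g1 v1"
    and "pi_approximate_viscosity_solution T S \<pi> F2 g2 v2"
    and "\<And>t x y z \<gamma>. t \<in> {0..T} \<Longrightarrow> x \<in> Omega T S \<Longrightarrow> symmetric_mat \<gamma> \<Longrightarrow>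
           F1 t x y z \<gamma> \<ge> F2 t x y z \<gamma>"
    and "\<And>x. x \<in> Omega T S \<Longrightarrow> g1 x \<ge> g2 x"
  shows "\<forall>t\<in>{0..T}. \<forall>x\<in>Omega T S. v1 t x \<ge> v2 t x"
proof (intro ballI)
  fix t :: real and x :: "'d path"
  assume t: "t \<in> {0..T}" and x: "x \<in> Omega T S"
  obtain w1 where w1: "\<And>n. n \<ge> 1 \<Longrightarrow> w1 n \<in> (\<Union>L'\<in>{0<..}. C_n T S \<pi> n L')"
      "\<And>n. n \<ge> 1 \<Longrightarrow> pi_solution T S \<pi> n F1 (w1 n)"
      "\<And>n x. n \<ge> 1 \<Longrightarrow> x \<in> Omega T S \<Longrightarrow> w1 n T x (x T) = g1 (Proj S \<pi> n T x)"
      "\<And>t x. t \<in> {0..T} \<Longrightarrow> x \<in> Omega T S \<Longrightarrow> (\<lambda>n. w1 n t x (x t)) \<longlonglongrightarrow> v1 t x"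
    using assms(9) unfolding pi_approximate_viscosity_solution_def by blast
  obtain w2 where w2: "\<And>n. n \<ge> 1 \<Longrightarrow> w2 n \<in> (\<Union>L'\<in>{0<..}. C_n T S \<pi> n L')"
      "\<And>n. n \<ge> 1 \<Longrightarrow> pi_solution T S \<pi> n F2 (w2 n)"
      "\<And>n x. n \<ge> 1 \<Longrightarrow> x \<in> Omega T S \<Longrightarrow> w2 n T x (x T) = g2 (Proj S \<pi> n T x)"
      "\<And>t x. t \<in> {0..T} \<Longrightarrow> x \<in> Omega T S \<Longrightarrow> (\<lambda>n. w2 n t x (x t)) \<longlonglongrightarrow> v2 t x"
    using assms(10) unfolding pi_approximate_viscosity_solution_def by blast
  have "w2 n t x (x t) \<le> w1 n t x (x t)" if n: "n \<ge> 1" for n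
  proof -
    interpret time_grid T \<pi> n
      using assms(3) n unfolding grid_sequence_def by unfold_locales auto
    obtain L1 where L1: "w1 n \<in> C_n T S \<pi> n L1" "L1 > 0" using w1(1)[OF n] by auto
    obtain L2 where L2: "w2 n \<in> C_n T S \<pi> n L2" "L2 > 0" using w2(1)[OF n] by auto
    show ?thesis
    \<comment> \<open>\<open>w2\<close> takes the role of the subsolution and \<open>w1\<close> that
      of the supersolution, so the Lipschitz bounds come from \<open>F1\<close>.\<close>
    proof (rule pi_comparison[OF _ _ _ L2 _ L1 _ _ t x])
      show "F_regular T S L F1" "F_monotone T S F1" using assms(7) by (auto simp: assumption_F_def)
      show "F2 t x y z \<gamma> \<le> F1 t x y z \<gamma>" if "t \<in> {0..T}" "x \<in> Omega T S" "symmetric_mat \<gamma>" for t x y z \<gamma>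
        by (rule assms(11)[OF that])
      show "pi_subsolution T S \<pi> n F2 (w2 n)" "pi_supersolution T S \<pi> n F1 (w1 n)"
        using w1(2)[OF n] w2(2)[OF n] by (auto simp: pi_solution_def)
      show "w2 n T x (x T) \<le> w1 n T x (x T)" if "x \<in> Omega T S" for x
        \<comment> \<open>The terminal data are compared at the projected path, which lies in
          \<open>Omega\<close> because \<open>\<pi> n n = T\<close>.\<close>
        using assms(12)[OF Proj_in_Omega[of n S x]] by (simp add: w1(3)[OF n that] w2(3)[OF n that] last)
      show "relevant T t x (x t)" using t by (cases "t = T") (auto simp: relevant_def)
    qed
  qed
  then show "v2 t x \<le> v1 t x"
    by (intro LIMSEQ_le[OF w2(4)[OF t x] w1(4)[OF t x]]) blast
qed

end
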